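(* Let $W$ be the affine Weyl group of type $\tilde B_2$ and let $u,w\in c_2$ with $u\le w$, $u\sim_L w$ and $u\not\sim_R w$. (i) If $\mathcal{L}(w)\not\subseteq\mathcal{L}(u)$, then $\mu(u,w)=1$ if $l(w)-l(u)=1$ and $0$ otherwise. (ii) If $\mathcal{L}(w)\subseteq\mathcal{L}(u)$, then $\mu(u,w)=1$ if $l(w)-l(u)=5$ and $0$ otherwise.
   Context: $W$ is the Coxeter group with simple reflections $S=\{r,s,t\}$ and relations $r^2=s^2=t^2=e$, $rt=tr$, $(rs)^4=(st)^4=e$; $l$ is the length and $\le$ the Bruhat order. $\mathcal{L}(w)=\{s'\in S\mid s'w<w\}$, $\mathcal{R}(w)=\{s'\in S\mid ws'<w\}$. $\sim_L,\sim_R$ are the Kazhdan–Lusztig left and right cell equivalences. $c_2=\{w\in W\mid a(w)=2\}$ for Lusztig's $a$-function; explicitly $c_2=\{u\,rt(srt)^m\,v\mid u\in\{e,s,ts,rs\},\ v\in\{e,s,st,sr\},\ m\in\mathbb{N}\}$. $P_{u,w}$ are the Kazhdan–Lusztig polynomials and, for $u\le w$, $\mu(u,w)$ is the coefficient of $q^{\frac12(l(w)-l(u)-1)}$ in $P_{u,w}$ (zero if the exponent is not an integer). *)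

theory Defs
  imports
    "HOL-Library.Poly_Mapping"
    "HOL-Library.Extended_Nat"
    "HOL-Computational_Algebra.Polynomial"
begin

section \<open>The Coxeter group of type affine B2\<close>

datatype simple = Sr | Ss | St

definition coxeter_relations :: "(simple list \<times> simple list) set" where
  "coxeter_relations =
     {([Sr, Sr], []), ([Ss, Ss], []), ([St, St], []),
      ([Sr, St], [St, Sr]),
      (concat (replicate 4 [Sr, Ss]), []), (concat (replicate 4 [Ss, St]), [])}"

definition coxeter_step :: "simple list \<Rightarrow> simple list \<Rightarrow> bool" where
  "coxeter_step xs ys \<longleftrightarrow>
     (\<exists>us vs p q. (p, q) \<in> coxeter_relations \<and> xs = us @ p @ vs \<and> ys = us @ q @ vs)"

abbreviation coxeter_eq :: "simple list \<Rightarrow> simple list \<Rightarrow> bool" where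
  "coxeter_eq \<equiv> equivclp coxeter_step"

text \<open>
  \<open>W\<close> is the group presented by these generators and relations. Because every generator is an
  involution, it is also the monoid with this presentation, and words in the
  generators need no formal inverses.
\<close>

quotient_type W = "simple list" / coxeter_eq
  by (rule equivp_evquivclp)

lemma coxeter_step_context: "coxeter_step xs ys \<Longrightarrow> coxeter_step (us @ xs @ vs) (us @ ys @ vs)"
  unfolding coxeter_step_def by (metis append.assoc)

lemma coxeter_eq_context:
  assumes "coxeter_eq xs ys"
  shows "coxeter_eq (us @ xs @ vs) (us @ ys @ vs)"
  using assms
proof (induction rule: equivclp_induct)
  case base
  show ?case by simp
next
  case (step y z)
  from step.hyps(2) have "coxeter_eq (us @ y @ vs) (us @ z @ vs)"
    using coxeter_step_context by (meson r_into_equivclp equivclp_sym)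
  with step.IH show ?case by (rule equivclp_trans)
qed

lemma coxeter_eq_append:
  assumes "coxeter_eq xs xs'" "coxeter_eq ys ys'"
  shows "coxeter_eq (xs @ ys) (xs' @ ys')"
  using coxeter_eq_context[OF assms(1), of "[]" ys] coxeter_eq_context[OF assms(2), of xs' "[]"]
  by (simp, meson equivclp_trans)

lemma coxeter_eq_cancel: "coxeter_eq (a # a # xs) xs"
proof -
  have "coxeter_step ([] @ [a, a] @ xs) ([] @ [] @ xs)"
    unfolding coxeter_step_def coxeter_relations_def by (cases a) blast+
  then show ?thesis by (simp add: r_into_equivclp)
qed

lemma coxeter_eq_rev_left: "coxeter_eq (rev xs @ xs) []"
proof (induction xs)
  case Nil
  show ?case by simp
next
  case (Cons a xs)
  have "coxeter_eq (rev xs @ (a # a # xs) @ []) (rev xs @ xs @ [])"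
    by (intro coxeter_eq_context coxeter_eq_cancel)
  then have "coxeter_eq (rev (a # xs) @ a # xs) (rev xs @ xs)" by simp
  with Cons.IH show ?case by (meson equivclp_trans)
qed

lemma coxeter_eq_rev:
  assumes "coxeter_eq xs ys"
  shows "coxeter_eq (rev xs) (rev ys)"
proof -
  have 1: "coxeter_eq (rev xs @ ys @ rev ys) (rev xs @ [])"
    using coxeter_eq_context[OF coxeter_eq_rev_left[of "rev ys"], of "rev xs" "[]"] by simp
  have "coxeter_eq (rev xs @ ys) []"
    using coxeter_eq_context[OF equivclp_sym[OF assms], of "rev xs" "[]"]
      coxeter_eq_rev_left[of xs] by (simp, meson equivclp_trans)
  then have 2: "coxeter_eq (rev xs @ ys @ rev ys) (rev ys)"
    using coxeter_eq_context[of "rev xs @ ys" "[]" "[]" "rev ys"] by simp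
  show ?thesis using 1 2 by (simp, meson equivclp_sym equivclp_trans)
qed

instantiation W :: "{monoid_mult, inverse}"
begin

lift_definition one_W :: W is "[]" .

lift_definition times_W :: "W \<Rightarrow> W \<Rightarrow> W" is "(@)"
  by (rule coxeter_eq_append)

lift_definition inverse_W :: "W \<Rightarrow> W" is rev
  by (rule coxeter_eq_rev)

definition divide_W :: "W \<Rightarrow> W \<Rightarrow> W" where
  "divide_W x y = x * inverse y"

instance
  by standard (transfer; simp)+

end

lemma W_left_inverse: "inverse (x :: W) * x = 1"
  by transfer (rule coxeter_eq_rev_left)

lift_definition word :: "simple list \<Rightarrow> W" is "\<lambda>xs. xs" .

definition gen :: "simple \<Rightarrow> W" where
  "gen s = word [s]"

definition len :: "W \<Rightarrow> nat" where
  "len w = (LEAST n. \<exists>xs. word xs = w \<and> length xs = n)"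

definition reflections :: "W set" where
  "reflections = {x * gen s * inverse x | x s. True}"

definition bruhat_step :: "W \<Rightarrow> W \<Rightarrow> bool" where
  "bruhat_step u w \<longleftrightarrow> len u < len w \<and> (\<exists>t\<in>reflections. w = u * t)"

definition bruhat_le :: "W \<Rightarrow> W \<Rightarrow> bool" (infix \<open>\<le>\<^sub>B\<close> 50) where
  "bruhat_le = bruhat_step\<^sup>*\<^sup>*"

definition bruhat_less :: "W \<Rightarrow> W \<Rightarrow> bool" (infix \<open><\<^sub>B\<close> 50) where
  "u <\<^sub>B w \<longleftrightarrow> u \<le>\<^sub>B w \<and> u \<noteq> w"

definition left_descents :: "W \<Rightarrow> simple set" where
  "left_descents w = {s. gen s * w <\<^sub>B w}"


section \<open>The Hecke algebra\<close>

text \<open>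
  The Laurent polynomial ring in \<open>q\<^sup>1\<^sup>/\<^sup>2\<close> over the integers; the key \<open>k\<close> is the exponent
  of \<open>q\<^sup>1\<^sup>/\<^sup>2\<close>, and multiplication is convolution.
\<close>

type_synonym laurent = "int \<Rightarrow>\<^sub>0 int"

definition half_q_pow :: "int \<Rightarrow> laurent" where
  "half_q_pow k = Poly_Mapping.single k 1"

definition q_var :: laurent where
  "q_var = half_q_pow 2"

definition laurent_bar :: "laurent \<Rightarrow> laurent" where
  "laurent_bar = Poly_Mapping.map_key uminus"

definition q_poly :: "int poly \<Rightarrow> laurent" where
  "q_poly p = poly (map_poly of_int p) q_var"

text \<open>
  The Hecke algebra is the free module with basis \<open>T_basis w\<close>; its product is \<open>hecke_mult\<close> below, which
  is characterised by \<open>T\<^sub>s T\<^sub>w = T\<^sub>s\<^sub>w\<close> if \<open>s w > w\<close> and \<open>T\<^sub>s T\<^sub>w = (q - 1) T\<^sub>w + q T\<^sub>s\<^sub>w\<close> if \<open>s w < w\<close>.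
\<close>

type_synonym hecke = "W \<Rightarrow>\<^sub>0 laurent"

definition scale :: "laurent \<Rightarrow> hecke \<Rightarrow> hecke" where
  "scale a h = Poly_Mapping.map (\<lambda>c. a * c) h"

definition T_basis :: "W \<Rightarrow> hecke" where
  "T_basis w = Poly_Mapping.single w 1"

definition gen_mult :: "simple \<Rightarrow> hecke \<Rightarrow> hecke" where
  "gen_mult s h = (\<Sum>w\<in>Poly_Mapping.keys h. scale (Poly_Mapping.lookup h w)
     (if len w < len (gen s * w) then T_basis (gen s * w)
      else scale (q_var - 1) (T_basis w) + scale q_var (T_basis (gen s * w))))"

text \<open>By Matsumoto's theorem the choice of the reduced word does not matter.\<close>

definition T_mult :: "W \<Rightarrow> hecke \<Rightarrow> hecke" where
  "T_mult w h = foldr gen_mult (SOME xs. word xs = w \<and> length xs = len w) h"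

definition hecke_mult :: "hecke \<Rightarrow> hecke \<Rightarrow> hecke" where
  "hecke_mult h h' =
     (\<Sum>w\<in>Poly_Mapping.keys h. scale (Poly_Mapping.lookup h w) (T_mult w h'))"

definition T_inverse :: "W \<Rightarrow> hecke" where
  "T_inverse w = (THE h. hecke_mult (T_basis w) h = T_basis 1 \<and> hecke_mult h (T_basis w) = T_basis 1)"

definition hecke_bar :: "hecke \<Rightarrow> hecke" where
  "hecke_bar h = (\<Sum>w\<in>Poly_Mapping.keys h.
     scale (laurent_bar (Poly_Mapping.lookup h w)) (T_inverse (inverse w)))"


section \<open>Kazhdan-Lusztig polynomials and cells\<close>

definition kl_sum :: "W \<Rightarrow> (W \<Rightarrow> int poly) \<Rightarrow> hecke" where
  "kl_sum w P = scale (half_q_pow (- int (len w)))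
     (\<Sum>u\<in>{u. u \<le>\<^sub>B w}. scale (q_poly (P u)) (T_basis u))"

text \<open>
  The degree bound is \<open>deg P\<^sub>u \<le> (l(w) - l(u) - 1)/2\<close> for \<open>u < w\<close>.
\<close>

definition is_kl_family :: "W \<Rightarrow> (W \<Rightarrow> int poly) \<Rightarrow> bool" where
  "is_kl_family w P \<longleftrightarrow>
     P w = 1 \<and>
     (\<forall>u. u <\<^sub>B w \<longrightarrow> 2 * Polynomial.degree (P u) + 1 \<le> len w - len u) \<and>
     (\<forall>u. \<not> u \<le>\<^sub>B w \<longrightarrow> P u = 0) \<and>
     hecke_bar (kl_sum w P) = kl_sum w P"

definition kl_poly :: "W \<Rightarrow> W \<Rightarrow> int poly" where
  "kl_poly u w = (THE P. is_kl_family w P) u"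

definition kl_basis :: "W \<Rightarrow> hecke" where
  "kl_basis w = kl_sum w (\<lambda>u. kl_poly u w)"

text \<open>
  For \<open>u \<le> w\<close> the exponent \<open>(l(w) - l(u) - 1)/2\<close> is an integer exactly when \<open>l(w) - l(u)\<close> is odd;
  in that case it is nonnegative.
\<close>

definition mu :: "W \<Rightarrow> W \<Rightarrow> int" where
  "mu u w = (if odd (len w - len u) then coeff (kl_poly u w) ((len w - len u - 1) div 2) else 0)"

definition joined :: "W \<Rightarrow> W \<Rightarrow> bool" where
  "joined x y \<longleftrightarrow> (x \<le>\<^sub>B y \<and> mu x y \<noteq> 0) \<or> (y \<le>\<^sub>B x \<and> mu y x \<noteq> 0)"

text \<open>The cell preorders of Kazhdan and Lusztig (1979).\<close>

definition left_step :: "W \<Rightarrow> W \<Rightarrow> bool" where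
  "left_step x y \<longleftrightarrow> joined x y \<and> \<not> left_descents x \<subseteq> left_descents y"

definition left_le :: "W \<Rightarrow> W \<Rightarrow> bool" (infix \<open>\<le>\<^sub>L\<close> 50) where
  "left_le = left_step\<^sup>*\<^sup>*"

definition right_le :: "W \<Rightarrow> W \<Rightarrow> bool" (infix \<open>\<le>\<^sub>R\<close> 50) where
  "x \<le>\<^sub>R y \<longleftrightarrow> inverse x \<le>\<^sub>L inverse y"

definition left_cell_eq :: "W \<Rightarrow> W \<Rightarrow> bool" (infix \<open>\<sim>\<^sub>L\<close> 50) where
  "x \<sim>\<^sub>L y \<longleftrightarrow> x \<le>\<^sub>L y \<and> y \<le>\<^sub>L x"

definition right_cell_eq :: "W \<Rightarrow> W \<Rightarrow> bool" (infix \<open>\<sim>\<^sub>R\<close> 50) where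
  "x \<sim>\<^sub>R y \<longleftrightarrow> x \<le>\<^sub>R y \<and> y \<le>\<^sub>R x"


section \<open>Lusztig's a-function\<close>

text \<open>
  \<open>kl_structure x y\<close> maps \<open>z\<close> to the structure constant \<open>h\<^sub>x\<^sub>,\<^sub>y\<^sub>,\<^sub>z\<close> of
  \<open>C\<^sub>x C\<^sub>y = (\<Sum>z. h\<^sub>x\<^sub>,\<^sub>y\<^sub>,\<^sub>z C\<^sub>z)\<close>.
\<close>

definition kl_structure :: "W \<Rightarrow> W \<Rightarrow> hecke" where
  "kl_structure x y = (THE h. hecke_mult (kl_basis x) (kl_basis y) =
     (\<Sum>z\<in>Poly_Mapping.keys h. scale (Poly_Mapping.lookup h z) (kl_basis z)))"

text \<open>
  \<open>a(z)\<close> is the least \<open>i\<close> such that \<open>q\<^sup>-\<^sup>i\<^sup>/\<^sup>2 h\<^sub>x\<^sub>,\<^sub>y\<^sub>,\<^sub>z\<close> is a polynomial in \<open>q\<^sup>-\<^sup>1\<^sup>/\<^sup>2\<close> for all \<open>x\<close>, \<open>y\<close>,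
  and infinity if there is no such \<open>i\<close>.
\<close>

definition a_fun :: "W \<Rightarrow> enat" where
  "a_fun z = Inf {enat i | i. \<forall>x y.
     Poly_Mapping.keys (half_q_pow (- int i) * Poly_Mapping.lookup (kl_structure x y) z) \<subseteq> {..0}}"

definition c2 :: "W set" where
  "c2 = {w. a_fun w = 2}"

end

theory Submission
  imports Defs "HOL-Library.Product_Plus"
begin

text \<open>
  If \<open>s\<close> is a left descent of \<open>w\<close> but not of \<open>u\<close>, then \<open>\<mu>(u,w) \<noteq> 0\<close> forces \<open>su = w\<close>; this settles (i).
  The left cell of \<open>u\<close> determines the right end \<open>v\<close> of \<open>u = u' rt(srt)\<^sup>m v\<close>, and two such elements
  lie in one right cell if their left ends agree. So in (ii) the left ends differ and the inclusion
  of descent sets leaves only \<open>u = rt(srt)\<^sup>k v\<close> and \<open>w = as rt(srt)\<^sup>m v\<close> with \<open>a \<in> {r,t}\<close>, where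
  the length difference is 5 iff \<open>m = k + 1\<close>.

  For \<open>v = e\<close> the coefficient is read off a module of rank four over the polynomials in \<open>X\<close>.
  Degree bounds for the standard basis elements (lattices preserved along reduced words) show
  that \<open>C\<^sub>w\<close> maps to a multiple of the Chebyshev polynomial \<open>U\<^sub>m(X)\<close> times a basis vector if \<open>w\<close>
  is such an element, and to zero if it is not but has \<open>r\<close> and \<open>t\<close> as left and right descents.
  Comparing the coefficients of \<open>C\<^sub>s C\<^sub>w\<close> then gives \<open>\<mu>\<close>, the index shift \<open>m = k + 1\<close> coming from
  the Chebyshev recursion. The associativity \<open>(C\<^sub>b C\<^sub>w) C\<^sub>c = C\<^sub>b (C\<^sub>w C\<^sub>c)\<close> transports the result
  to the other right ends \<open>v\<close>. Elements with a factor \<open>rsrs\<close> or \<open>stst\<close> in a reduced expression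
  have \<open>a\<close>-value at least 4 and do not occur in \<open>c\<^sub>2\<close>.
\<close>

section \<open>The Coxeter group and its geometric action\<close>

text \<open>Throughout, \<open>v\<close> denotes \<open>q^(1/2)\<close>. The condition
  \<open>a(w) = 2\<close> is used as one negative fact: no reduced expression of \<open>w\<close>
  contains \<open>rsrs\<close> or \<open>stst\<close>. The obstacle is to find \<mu> without
  computing Kazhdan-Lusztig polynomials of unbounded degree. The module is modelled on the expected
  answer: for \<open>{a, b} = {r, t}\<close> the product of \<open>C_b\<close> with the basis
  element of left end \<open>as\<close> and index \<open>m\<close> should contain, among those of
  left end \<open>e\<close>, exactly the indices \<open>m + 1\<close> and \<open>m - 1\<close>. This
  is \<open>X U_m = U_(m+1) + U_(m-1)\<close>, so one variable \<open>X\<close> replaces the index,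
  and the braid relations are a finite computation. Why the module sees enough: the normalised
  \<open>T_w\<close> send the first basis vector to vectors of degree at most 2 in \<open>v\<close>,
  and the other terms of \<open>C_w\<close> carry negative powers, so \<open>C_w\<close> and
  \<open>T_w\<close> have the same \<open>v^2\<close> part. If \<open>r\<close> and \<open>t\<close>
  are right descents, the factor \<open>(v + 1/v)^2\<close> splits off, and a bar invariant cofactor
  of degree at most 0 has integer coefficients. Linear independence of the \<open>U_k\<close> then
  turns a single identity into all the values of \<mu>.\<close>

lemma times_word: "word xs * word ys = word (xs @ ys)"
  by transfer simp

lemma word_Nil [simp]: "word [] = 1"
  by transfer simp

lemma word_Cons: "word (s # xs) = gen s * word xs"
  by (simp add: gen_def times_word)

lemma word_surj: "\<exists>xs. word xs = w"
  by transfer auto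

lemma W_induct [case_names one gen]:
  assumes "P 1" "\<And>s w. P w \<Longrightarrow> P (gen s * w)"
  shows "P (w :: W)"
proof -
  have "P (word xs)" for xs by (induction xs) (use assms in \<open>auto simp: word_Cons\<close>)
  then show ?thesis using word_surj by metis
qed

lemma coxeter_eqI: "(p, q) \<in> coxeter_relations \<Longrightarrow> word p = word q"
proof -
  assume "(p, q) \<in> coxeter_relations"
  then have "coxeter_step ([] @ p @ []) ([] @ q @ [])" unfolding coxeter_step_def by blast
  then show ?thesis by (simp add: word.abs_eq W.abs_eq_iff r_into_equivclp)
qed

lemma gen_gen [simp]: "gen s * gen s = 1"
  using coxeter_eqI[of "[s, s]" "[]"] by (cases s) (simp_all add: coxeter_relations_def word_Cons)

lemma gen_gen_left [simp]: "gen s * (gen s * w) = w"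
  by (simp add: mult.assoc[symmetric])

lemma gen_rt: "gen Sr * gen St = gen St * gen Sr"
  using coxeter_eqI[of "[Sr, St]" "[St, Sr]"] by (simp add: coxeter_relations_def word_Cons)

lemma gen_rt_left: "gen Sr * (gen St * w) = gen St * (gen Sr * w)"
  by (simp add: mult.assoc[symmetric] gen_rt)

lemma inverse_inverse_W [simp]: "inverse (inverse w) = (w :: W)"
  by transfer simp

lemma W_right_inverse: "(x :: W) * inverse x = 1"
  using W_left_inverse[of "inverse x"] by simp

lemma inverse_times_W [simp]: "inverse (x * y) = inverse y * inverse (x :: W)"
  by transfer simp

lemma inverse_one_W [simp]: "inverse (1 :: W) = 1"
  by transfer simp

lemma inverse_gen [simp]: "inverse (gen s) = gen s"
  unfolding gen_def by transfer simp

lemma inverse_word: "inverse (word xs) = word (rev xs)"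
  by transfer simp

lemma W_cancel_left [simp]: "x * (inverse x * y) = y" "inverse x * (x * y) = (y :: W)"
  by (simp_all add: mult.assoc[symmetric] W_left_inverse W_right_inverse)

lemma W_mult_eq_left_iff [simp]: "x * y = x * z \<longleftrightarrow> y = (z :: W)"
  by (metis W_cancel_left(2))

lemma W_mult_eq_right_iff [simp]: "y * x = z * x \<longleftrightarrow> y = (z :: W)"
  by (metis mult.assoc W_right_inverse mult_1_right)

lemma inverse_eq_iff_W [simp]: "inverse x = inverse y \<longleftrightarrow> x = (y :: W)"
  by (metis inverse_inverse_W)

lemma gen_mult_eq_iff: "gen s * x = y \<longleftrightarrow> x = gen s * y"
  by (metis gen_gen_left)

lemma gen_mult_right [simp]: "x * gen s * gen s = x"
  by (simp add: mult.assoc)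

lemma mult_gen_eq_iff: "x * gen s = y \<longleftrightarrow> x = y * gen s"
  by (metis gen_mult_right)

lemma gen_braid:
  assumes "s' \<noteq> Ss"
  shows "gen Ss * (gen s' * (gen Ss * (gen s' * w))) = gen s' * (gen Ss * (gen s' * (gen Ss * w)))"
proof -
  have rel: "gen a * (gen b * (gen a * (gen b * (gen a * (gen b * (gen a * gen b)))))) = 1"
    if "(a, b) = (Sr, Ss) \<or> (a, b) = (Ss, St)" for a b
    using coxeter_eqI[of "concat (replicate 4 [a, b])" "[]"] that
    by (auto simp: coxeter_relations_def word_Cons numeral_eq_Suc)
  have gen: "gen b * (gen a * (gen b * (gen a * w))) = gen a * (gen b * (gen a * (gen b * w)))"
    if "(a, b) = (Sr, Ss) \<or> (a, b) = (Ss, St)" for a b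
  proof -
    have "gen a * (gen b * (gen a * (gen b * (gen a * (gen b * (gen a * (gen b * 
            (gen b * (gen a * (gen b * (gen a * w))))))))))) = gen b * (gen a * (gen b * (gen a * w)))"
      using rel[OF that] by (metis mult.assoc mult_1_left)
    then show ?thesis by simp
  qed
  show ?thesis using gen[of Sr Ss] gen[of Ss St] assms by (cases s') simp_all
qed

text \<open>The coordinates are the values at a point of the affine functions attached to the walls
  \<open>s\<close>, \<open>t\<close>, \<open>r\<close>. The coefficients 1 and 2 come from the
  affine Cartan matrix, scaled so that the three functions have constant sum.\<close>

fun reflect :: "simple \<Rightarrow> int \<times> int \<times> int \<Rightarrow> int \<times> int \<times> int" where
  "reflect Ss (a, b, c) = (- a, b + a, c + a)"
| "reflect St (a, b, c) = (a + 2 * b, - b, c)"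
| "reflect Sr (a, b, c) = (a + 2 * c, b, - c)"

lemma foldr_reflect_step:
  assumes "coxeter_step xs ys"
  shows "foldr reflect xs p = foldr reflect ys p"
proof -
  have "foldr reflect l p = foldr reflect l' p" if "(l, l') \<in> coxeter_relations" for l l' p
    by (cases p) (use that in \<open>auto simp: coxeter_relations_def numeral_eq_Suc\<close>)
  then show ?thesis using assms unfolding coxeter_step_def by (metis foldr_append comp_apply)
qed

lift_definition pt :: "W \<Rightarrow> int \<times> int \<times> int" is "\<lambda>xs. foldr reflect xs (1, 1, 1)"
proof -
  fix xs ys assume "coxeter_eq xs ys"
  then show "foldr reflect xs (1, 1, 1) = foldr reflect ys (1, 1, 1)"
    by (induction rule: equivclp_induct) (auto dest: foldr_reflect_step[symmetric] foldr_reflect_step)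
qed

lemma pt_one [simp]: "pt 1 = (1, 1, 1)"
  by transfer simp

lemma pt_gen [simp]: "pt (gen s * w) = reflect s (pt w)"
  unfolding gen_def by transfer simp

text \<open>
  \<open>pt w\<close> is an interior point of the alcove of \<open>w\<close>, which lies on the positive side of the
  wall \<open>s\<close> iff \<open>height s (pt w) > 0\<close>.
\<close>

fun height :: "simple \<Rightarrow> int \<times> int \<times> int \<Rightarrow> int" where
  "height Ss (a, b, c) = a"
| "height St (a, b, c) = b"
| "height Sr (a, b, c) = c"

lemma height_reflect [simp]: "height s (reflect s p) = - height s p"
  by (cases p; cases s) auto

lemma pt_sum: "pt w = (a, b, c) \<Longrightarrow> a + b + c = 3"
proof (induction w arbitrary: a b c rule: W_induct)
  case one
  then show ?case by simp
next
  case (gen s w)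
  obtain a' b' c' where "pt w = (a', b', c')" by (metis prod_cases3)
  with gen show ?case by (cases s) auto
qed

lemma pt_sum_heights: "height Ss (pt w) + height St (pt w) + height Sr (pt w) = 3"
  using pt_sum[of w] by (cases "pt w") auto

subsection \<open>Length and descents\<close>

lemma len_word_le: "len (word xs) \<le> length xs"
  unfolding len_def by (rule Least_le) auto

lemma reduced_word_exists: "\<exists>xs. word xs = w \<and> length xs = len w"
proof -
  obtain xs where "word xs = w" using word_surj by blast
  then have "\<exists>n xs. word xs = w \<and> length xs = n" by blast
  then show ?thesis unfolding len_def by (rule LeastI_ex)
qed

lemma len_one [simp]: "len 1 = 0"
  using len_word_le[of "[]"] by simp

lemma len_eq_0_iff [simp]: "len w = 0 \<longleftrightarrow> w = 1"
  using reduced_word_exists[of w] by auto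

lemma len_times_le: "len (x * y) \<le> len x + len y"
proof -
  obtain xs ys where "word xs = x" "length xs = len x" "word ys = y" "length ys = len y"
    using reduced_word_exists by metis
  then show ?thesis using len_word_le[of "xs @ ys"] by (metis length_append times_word)
qed

lemma len_gen_le: "len (gen s) \<le> 1"
  using len_word_le[of "[s]"] by (simp add: word_Cons)

lemma len_inverse_le: "len (inverse w) \<le> len w"
proof -
  obtain xs where "word xs = w" "length xs = len w" using reduced_word_exists by metis
  then show ?thesis using len_word_le[of "rev xs"] by (metis inverse_word length_rev)
qed

lemma len_inverse [simp]: "len (inverse w) = len w"
  using len_inverse_le[of w] len_inverse_le[of "inverse w"] by simp

lift_definition parity :: "W \<Rightarrow> bool" is "\<lambda>xs. odd (length xs)"
proof -
  fix xs ys assume "coxeter_eq xs ys"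
  then show "odd (length xs) = odd (length ys)"
  proof (induction rule: equivclp_induct)
    case (step y z)
    have "odd (length l) = odd (length l')" if "coxeter_step l l'" for l l'
    proof -
      have "even (length p) = even (length q)" if "(p, q) \<in> coxeter_relations" for p q
        using that by (auto simp: coxeter_relations_def length_concat sum_list_replicate)
      with that show ?thesis unfolding coxeter_step_def by fastforce
    qed
    with step show ?case by blast
  qed simp
qed

lemma parity_word: "parity (word xs) = odd (length xs)"
  by transfer simp

lemma parity_len: "parity w = odd (len w)"
  using reduced_word_exists[of w] parity_word by metis

lemma parity_gen: "parity (gen s * w) = (\<not> parity w)"
  unfolding gen_def by transfer simp

lemma len_gen_cases: "len (gen s * w) = len w + 1 \<or> len w = len (gen s * w) + 1"
proof -
  have "len (gen s * w) \<le> len w + 1" using len_times_le[of "gen s" w] len_gen_le[of s] by simp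
  moreover have "len w \<le> len (gen s * w) + 1"
    using len_times_le[of "gen s" "gen s * w"] len_gen_le[of s] by simp
  moreover have "len (gen s * w) \<noteq> len w"
    using parity_gen[of s w] parity_len by metis
  ultimately show ?thesis by linarith
qed

definition desc :: "simple \<Rightarrow> W \<Rightarrow> bool" where
  "desc s w \<longleftrightarrow> len (gen s * w) < len w"

lemma len_desc: "desc s w \<Longrightarrow> len w = Suc (len (gen s * w))"
  and len_not_desc: "\<not> desc s w \<Longrightarrow> len (gen s * w) = Suc (len w)"
  using len_gen_cases[of s w] by (auto simp: desc_def)

lemma desc_gen [simp]: "desc s (gen s * w) \<longleftrightarrow> \<not> desc s w"
  using len_gen_cases[of s w] by (auto simp: desc_def)

lemma desc_exists: "w \<noteq> 1 \<Longrightarrow> \<exists>s. desc s w"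
proof -
  assume "w \<noteq> 1"
  obtain xs where xs: "word xs = w" "length xs = len w" using reduced_word_exists by metis
  with \<open>w \<noteq> 1\<close> obtain s ys where "xs = s # ys" by (cases xs) auto
  with xs have "gen s * w = word ys" "length ys < len w" by (auto simp: word_Cons)
  then have "desc s w" unfolding desc_def using len_word_le[of ys] by simp
  then show ?thesis by blast
qed

lemma not_desc_one [simp]: "\<not> desc s 1"
  by (simp add: desc_def)

text \<open>
  Stripping the letters of a rank two parabolic subgroup from the left stops after less than
  four steps, which reduces the claim to an element on the positive side of both walls.
\<close>

lemma not_desc_height: "\<not> desc s w \<Longrightarrow> height s (pt w) > 0"
proof (induction "len w" arbitrary: s w rule: less_induct)
  case less
  show ?case
  proof (cases "w = 1")
    case True
    then show ?thesis by (cases s) auto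
  next
    case False
    then obtain s' where s': "desc s' w" using desc_exists by blast
    with less.prems have ne: "s \<noteq> s'" by auto
    define w1 where "w1 = gen s' * w"
    define w2 where "w2 = gen s * w1"
    define w3 where "w3 = gen s' * w2"
    define w4 where "w4 = gen s * w3"
    have w: "w = gen s' * w1" by (simp add: w1_def)
    have l1: "len w = Suc (len w1)" unfolding w1_def by (rule len_desc[OF s'])
    have d1: "\<not> desc s' w1" using s' by (simp add: w1_def)
    have IH: "height z (pt u) > 0" if "\<not> desc z u" "len u < len w" for z u
      using less.hyps that by blast
    obtain a b c where p1: "pt w1 = (a, b, c)" by (metis prod_cases3)
    show ?thesis
    proof (cases "desc s w1")
      case False
      then have "height s (pt w1) > 0" "height s' (pt w1) > 0" using IH d1 l1 by auto
      then show ?thesis using ne p1 w by (cases s; cases s') auto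
    next
      case True
      then have l2: "len w1 = Suc (len w2)" unfolding w2_def by (rule len_desc)
      have d2: "\<not> desc s w2" using True by (simp add: w2_def)
      have w1: "w1 = gen s * w2" by (simp add: w2_def)
      obtain a b c where p2: "pt w2 = (a, b, c)" by (metis prod_cases3)
      show ?thesis
      proof (cases "desc s' w2")
        case False
        then have pos: "height s (pt w2) > 0" "height s' (pt w2) > 0" using IH d2 l1 l2 by auto
        show ?thesis
        proof (cases "Ss \<in> {s, s'}")
          case False
          then have "gen s' * (gen s * w2) = gen s * (gen s' * w2)"
            using ne gen_rt_left by (cases s; cases s') auto
          then have "gen s * w = gen s' * w2" by (simp add: w w1)
          then have "desc s w"
            using l1 l2 len_gen_cases[of s' w2] by (auto simp: desc_def)
          then show ?thesis using less.prems by blast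
        qed (use pos ne p2 w w1 in \<open>cases s; cases s'; auto\<close>)
      next
        case True
        then have l3: "len w2 = Suc (len w3)" unfolding w3_def by (rule len_desc)
        have d3: "\<not> desc s' w3" using True by (simp add: w3_def)
        have w2: "w2 = gen s' * w3" by (simp add: w3_def)
        have mem: "Ss \<in> {s, s'}"
        proof (rule ccontr)
          assume "Ss \<notin> {s, s'}"
          then have "w = gen s * w3"
            using ne gen_rt_left unfolding w w1 w2 by (cases s; cases s') auto
          then show False using l1 l2 l3 len_gen_cases[of s w3] by auto
        qed
        obtain a b c where p3: "pt w3 = (a, b, c)" by (metis prod_cases3)
        show ?thesis
        proof (cases "desc s w3")
          case False
          then have pos: "height s (pt w3) > 0" "height s' (pt w3) > 0" using IH d3 l1 l2 l3 by auto
          show ?thesis using mem pos ne p3 w w1 w2 by (cases s; cases s') auto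
        next
          case True
          then have l4: "len w3 = Suc (len w4)" unfolding w4_def by (rule len_desc)
          have w3: "w3 = gen s * w4" by (simp add: w4_def)
          have "w = gen s * (gen s' * (gen s * (gen s' * w4)))"
            using mem ne gen_braid[of s' w4] gen_braid[of s w4] unfolding w w1 w2 w3 by auto
          then have "gen s * w = word [s', s, s'] * w4" by (simp add: word_Cons mult.assoc)
          then have "len (gen s * w) \<le> 3 + len w4"
            using len_times_le[of "word [s', s, s']" w4] len_word_le[of "[s', s, s']"] by simp
          then have "desc s w" using l1 l2 l3 l4 by (simp add: desc_def)
          then show ?thesis using less.prems by blast
        qed
      qed
    qed
  qed
qed

text \<open>Descents become signs of integers, so whether an explicit product is reduced is a matter
  of arithmetic on \<open>pt\<close>.\<close>

lemma desc_iff_height: "desc s w \<longleftrightarrow> height s (pt w) < 0"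
  using not_desc_height[of s w] not_desc_height[of s "gen s * w"] by (cases "desc s w") auto

lemma not_all_desc: "\<not> (desc Sr w \<and> desc Ss w \<and> desc St w)"
  using pt_sum_heights[of w] by (auto simp: desc_iff_height)

text \<open>Two negative heights put the alcove into the chamber opposite to the positive one for
  the dihedral group of \<open>Ss\<close> and \<open>s'\<close>, so the longest element of that
  group, of length 4, can be stripped off.\<close>

lemma two_desc:
  assumes "s' \<noteq> Ss" "desc Ss w" "desc s' w"
  shows "len w = 4 + len (gen Ss * (gen s' * (gen Ss * (gen s' * w))))"
proof -
  obtain a b c where p: "pt w = (a, b, c)" by (metis prod_cases3)
  have h: "a < 0" "height s' (a, b, c) < 0" using assms p by (auto simp: desc_iff_height)
  have "desc Ss (gen s' * w)" "desc s' (gen Ss * (gen s' * w))"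
    "desc Ss (gen s' * (gen Ss * (gen s' * w)))"
    using h assms(1) p by (cases s'; auto simp: desc_iff_height)+
  then show ?thesis using len_desc assms by (metis add_Suc_right add_numeral_left
        numeral_plus_one numeral_One plus_1_eq_Suc Suc_numeral add_2_eq_Suc' add_Suc numeral_eq_Suc pred_numeral_simps BitM.simps add.commute)
qed

lemma two_desc_rt:
  assumes "desc Sr w" "desc St w"
  shows "len w = 2 + len (gen Sr * (gen St * w))"
proof -
  obtain a b c where p: "pt w = (a, b, c)" by (metis prod_cases3)
  then have "desc Sr (gen St * w)" using assms by (auto simp: desc_iff_height)
  then show ?thesis using assms(2) len_desc by fastforce
qed

subsection \<open>Strong exchange and the Bruhat order\<close>

text \<open>
  \<open>odd_refl xs t\<close> says that \<open>t\<close> occurs an odd number of times among the reflections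
  \<open>x\<^sub>1 \<dots> x\<^sub>i \<dots> x\<^sub>1\<close> of the word \<open>xs\<close>. This parity depends on \<open>word xs\<close> only.
\<close>

fun odd_refl :: "simple list \<Rightarrow> W \<Rightarrow> bool" where
  "odd_refl [] t = False"
| "odd_refl (s # xs) t = ((t = gen s) \<noteq> odd_refl xs (gen s * t * gen s))"

lemma odd_refl_append:
  "odd_refl (xs @ ys) t = (odd_refl xs t \<noteq> odd_refl ys (inverse (word xs) * t * word xs))"
proof (induction xs arbitrary: t)
  case (Cons s xs)
  then show ?case by (auto simp: word_Cons mult.assoc)
qed simp

text \<open>In \<open>(ab)^4\<close> the reflections at positions \<open>i\<close> and
  \<open>i + 4\<close> coincide, so each occurs an even number of times; for \<open>rt = tr\<close>
  the same two reflections occur on both sides.\<close>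

lemma odd_refl_relation:
  assumes "(p, q) \<in> coxeter_relations"
  shows "odd_refl p t = odd_refl q t"
proof -
  have 1: "odd_refl (concat (replicate 4 [a, b])) t = False"
    if "(a, b) = (Sr, Ss) \<or> (a, b) = (Ss, St)" for a b
  proof -
    have rel: "gen a * (gen b * (gen a * (gen b * (gen a * (gen b * (gen a * (gen b * x))))))) = x" for x
      using that gen_braid[of Sr] gen_braid[of St] by auto
    show ?thesis
      by (simp add: numeral_eq_Suc gen_mult_eq_iff mult_gen_eq_iff, simp add: mult.assoc rel) (smt (verit))
  qed
  have 2: "odd_refl [s, s] t = False" for s
    by (simp add: gen_mult_eq_iff mult_gen_eq_iff mult.assoc)
  have 3: "odd_refl [Sr, St] t = odd_refl [St, Sr] t"
  proof -
    have "gen Sr * t * gen Sr = gen St \<longleftrightarrow> t = gen St"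
      "gen St * t * gen St = gen Sr \<longleftrightarrow> t = gen Sr"
      by (simp_all add: gen_mult_eq_iff mult_gen_eq_iff mult.assoc gen_rt gen_rt_left)
    then show ?thesis by auto
  qed
  have 4: "odd_refl [] t = False" by simp
  show ?thesis using assms 1[of Sr Ss] 1[of Ss St] 2 3 4 unfolding coxeter_relations_def
    by (elim insertE) (simp_all del: odd_refl.simps)
qed

lemma odd_refl_step:
  assumes "coxeter_step xs ys"
  shows "odd_refl xs t = odd_refl ys t"
proof -
  from assms obtain us vs p q where *: "(p, q) \<in> coxeter_relations" "xs = us @ p @ vs" "ys = us @ q @ vs"
    unfolding coxeter_step_def by blast
  then show ?thesis using coxeter_eqI[OF *(1)] odd_refl_relation[OF *(1)]
    by (simp add: odd_refl_append)
qed

lift_definition inversion :: "W \<Rightarrow> W \<Rightarrow> bool" is odd_refl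
proof -
  fix xs ys assume "coxeter_eq xs ys"
  then show "odd_refl xs = odd_refl ys"
    by (induction rule: equivclp_induct) (auto dest: odd_refl_step)
qed

lemma inversion_word: "inversion (word xs) t = odd_refl xs t"
  by transfer simp

lemma inversion_times: "inversion (x * y) t = (inversion x t \<noteq> inversion y (inverse x * t * x))"
proof -
  obtain xs ys where "word xs = x" "word ys = y" using word_surj by metis
  then show ?thesis
    using odd_refl_append[of xs ys t] by (metis inversion_word times_word)
qed

lemma inversion_one [simp]: "\<not> inversion 1 t"
  using inversion_word[of "[]"] by simp

lemma inversion_gen: "inversion (gen s) t \<longleftrightarrow> t = gen s"
  using inversion_word[of "[s]" t] by (simp add: word_Cons)

text \<open>In \<open>x s x^(-1)\<close> the contributions of \<open>x\<close> and of its inverse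
  cancel modulo 2, and the middle letter contributes once.\<close>

lemma inversion_reflection:
  assumes "t \<in> reflections"
  shows "inversion t t"
proof -
  from assms obtain x s where t: "t = x * gen s * inverse x" by (auto simp: reflections_def)
  have "\<not> inversion (x * inverse x) t" by (simp add: W_right_inverse)
  then have "inversion x t = inversion (inverse x) (inverse x * t * x)"
    by (simp add: inversion_times)
  moreover have "inverse x * t * x = gen s" by (simp add: t mult.assoc W_left_inverse)
  moreover have "inverse (x * gen s) * t * (x * gen s) = gen s" by (simp add: t mult.assoc W_left_inverse)
  moreover have "inversion t t = (inversion (x * gen s) t \<noteq> inversion (inverse x) (inverse (x * gen s) * t * (x * gen s)))"
    unfolding t by (rule inversion_times)
  ultimately show ?thesis by (simp add: inversion_times[of x "gen s"] inversion_gen)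
qed

lemma reflection_involution: "t \<in> reflections \<Longrightarrow> t * (t * x) = x"
  by (auto simp: reflections_def mult.assoc)

lemma reflection_conj: "t \<in> reflections \<Longrightarrow> x * t * inverse x \<in> reflections"
proof -
  assume "t \<in> reflections"
  then obtain y s where "t = y * gen s * inverse y" by (auto simp: reflections_def)
  then have "x * t * inverse x = (x * y) * gen s * inverse (x * y)" by (simp add: mult.assoc)
  then show ?thesis unfolding reflections_def by blast
qed

lemma gen_reflection: "gen s \<in> reflections"
  unfolding reflections_def by (auto intro!: exI[of _ 1] exI[of _ s])

lemma inverse_reflection: "t \<in> reflections \<Longrightarrow> inverse t = t"
  by (auto simp: reflections_def mult.assoc)

lemma odd_refl_delete:
  "odd_refl xs t \<Longrightarrow> \<exists>us s vs. xs = us @ s # vs \<and> t * word xs = word (us @ vs)"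
proof (induction xs arbitrary: t)
  case (Cons s xs)
  show ?case
  proof (cases "t = gen s")
    case True
    then show ?thesis by (intro exI[of _ "[]"]) (simp add: word_Cons)
  next
    case False
    with Cons.prems have "odd_refl xs (gen s * t * gen s)" by simp
    from Cons.IH[OF this] obtain us s' vs where *: "xs = us @ s' # vs"
      "gen s * t * gen s * word xs = word (us @ vs)" by blast
    then have "t * word (s # xs) = word ((s # us) @ vs)"
      by (simp add: word_Cons) (metis gen_gen_left mult.assoc)
    then show ?thesis using *(1) by (intro exI[of _ "s # us"]) auto
  qed
qed simp

text \<open>A reflection \<open>t\<close> is an inversion of exactly one of \<open>w\<close> and
  \<open>t * w\<close>. If it were one of \<open>t * w\<close>, deleting a letter there would make
  \<open>w\<close> the shorter element.\<close>

lemma strong_exchange: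
  assumes "t \<in> reflections" "len (t * word xs) < len (word xs)"
  shows "\<exists>us s vs. xs = us @ s # vs \<and> t * word xs = word (us @ vs)"
proof (rule odd_refl_delete, rule ccontr)
  assume "\<not> odd_refl xs t"
  then have "inversion (t * word xs) t"
    using inversion_reflection[OF assms(1)] by (simp add: inversion_times inversion_word W_left_inverse)
  moreover obtain ys where ys: "word ys = t * word xs" "length ys = len (t * word xs)"
    using reduced_word_exists by metis
  ultimately have "odd_refl ys t" by (metis inversion_word)
  from odd_refl_delete[OF this] obtain us s vs
    where *: "ys = us @ s # vs" "t * word ys = word (us @ vs)" by blast
  then have "len (word xs) < len (t * word xs)"
    using ys len_word_le[of "us @ vs"] reflection_involution[OF assms(1), of "word xs"] by simp
  with assms(2) show False by simp
qed

lemma exchange: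
  assumes "desc s (word xs)"
  shows "\<exists>us s' vs. xs = us @ s' # vs \<and> gen s * word xs = word (us @ vs)"
  using strong_exchange[OF gen_reflection] assms unfolding desc_def by blast

lemma bruhat_step_left:
  assumes "t \<in> reflections" "len u < len (t * u)"
  shows "bruhat_step u (t * u)"
proof -
  have "t * u = u * (inverse u * t * u)" by (simp add: mult.assoc)
  moreover have "inverse u * t * u \<in> reflections" using reflection_conj[OF assms(1), of "inverse u"] by simp
  ultimately show ?thesis using assms unfolding bruhat_step_def by metis
qed

lemma bruhat_step_iff: "bruhat_step u w \<longleftrightarrow> len u < len w \<and> (\<exists>t\<in>reflections. w = t * u)"
proof
  assume "bruhat_step u w"
  then obtain t where t: "len u < len w" "t \<in> reflections" "w = u * t" by (auto simp: bruhat_step_def)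
  then have "w = (u * t * inverse u) * u" by (simp add: mult.assoc W_left_inverse)
  then show "len u < len w \<and> (\<exists>t\<in>reflections. w = t * u)" using t reflection_conj by blast
qed (auto intro: bruhat_step_left)

lemma bruhat_refl [simp]: "u \<le>\<^sub>B u"
  by (simp add: bruhat_le_def)

lemma bruhat_trans: "u \<le>\<^sub>B v \<Longrightarrow> v \<le>\<^sub>B w \<Longrightarrow> u \<le>\<^sub>B w"
  unfolding bruhat_le_def by (rule rtranclp_trans)

lemma bruhat_stepD: "bruhat_step u w \<Longrightarrow> u \<le>\<^sub>B w"
  unfolding bruhat_le_def by blast

lemma bruhat_le_len: "u \<le>\<^sub>B w \<Longrightarrow> u = w \<or> len u < len w"
  unfolding bruhat_le_def by (induction rule: rtranclp_induct) (auto simp: bruhat_step_def)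

lemma bruhat_up: "\<not> desc s u \<Longrightarrow> u \<le>\<^sub>B gen s * u"
  by (intro bruhat_stepD bruhat_step_left gen_reflection) (simp add: len_not_desc)

lemma bruhat_down: "desc s u \<Longrightarrow> gen s * u \<le>\<^sub>B u"
  using bruhat_up[of s "gen s * u"] by simp

text \<open>\<open>gen s * u\<close> and \<open>gen s * w\<close> again differ by a reflection, the
  conjugate \<open>t'\<close>. If their lengths come in the wrong order, the exchange condition
  forces \<open>gen s * u = w\<close>. The lifting property of the Bruhat order follows from
  this.\<close>

lemma bruhat_step_gen:
  assumes "bruhat_step u w"
  shows "gen s * u \<le>\<^sub>B w \<or> gen s * u \<le>\<^sub>B gen s * w"
proof -
  obtain t where t: "len u < len w" "t \<in> reflections" "w = t * u"
    using assms bruhat_step_iff by blast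
  define t' where "t' = gen s * t * gen s"
  have t': "t' \<in> reflections" using reflection_conj[OF t(2), of "gen s"] by (simp add: t'_def)
  have sw: "gen s * w = t' * (gen s * u)" by (simp add: t'_def t mult.assoc)
  show ?thesis
  proof (cases "len (gen s * u) < len (gen s * w)")
    case True
    then show ?thesis using bruhat_step_left[OF t'] bruhat_stepD sw by metis
  next
    case False
    have l: "len (gen s * u) \<le> Suc (len u)" "len w \<le> Suc (len (gen s * w))"
      using len_gen_cases[of s u] len_gen_cases[of s w] by auto
    \<comment> \<open>A reflection has odd parity, so the two lengths cannot agree.\<close>
    have ne: "len (gen s * w) \<noteq> len (gen s * u)"
    proof -
      have "parity (t * u) \<noteq> parity u"
      proof -
        from t(2) obtain x a where t0: "t = x * gen a * inverse x" by (auto simp: reflections_def)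
        obtain xs us where "word xs = x" "word us = u" using word_surj by metis
        then have "t * u = word (xs @ [a] @ rev xs @ us)"
          using t0 inverse_word[of xs] by (simp add: times_word[symmetric] word_Cons mult.assoc)
        then show ?thesis
          using \<open>word us = u\<close> parity_word[of "xs @ [a] @ rev xs @ us"] parity_word[of us] by auto
      qed
      then have "parity (gen s * w) \<noteq> parity (gen s * u)" using t(3) by (simp add: parity_gen)
      then show ?thesis by (auto simp: parity_len)
    qed
    have "gen s * u = w"
    proof (cases "desc s u")
      case True
      then show ?thesis using l t(1) False len_desc[OF True] ne by linarith
    next
      case nd: False
      obtain us where us: "word us = u" "length us = len u" using reduced_word_exists by metis
      have "len (t' * word (s # us)) < len (word (s # us))"
        using False ne us sw by (simp add: word_Cons)
      from strong_exchange[OF t' this] obtain as a bs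
        where *: "s # us = as @ a # bs" "t' * word (s # us) = word (as @ bs)" by blast
      \<comment> \<open>Deleting the leading \<open>s\<close> gives \<open>gen s * w = u\<close>;
        deleting a later letter would make \<open>w\<close> shorter than \<open>u\<close>.\<close>
      show ?thesis
      proof (cases as)
        case Nil
        then have "gen s * w = u" using * us sw by (simp add: word_Cons)
        then show ?thesis by auto
      next
        case (Cons s' as')
        then have "gen s * w = gen s * word (as' @ bs)" "us = as' @ a # bs"
          using * us sw by (auto simp: word_Cons)
        then have "len w < len u" using us len_word_le[of "as' @ bs"] by simp
        with t show ?thesis by simp
      qed
    qed
    then show ?thesis by simp
  qed
qed

lemma bruhat_gen:
  assumes "u \<le>\<^sub>B w"
  shows "gen s * u \<le>\<^sub>B w \<or> gen s * u \<le>\<^sub>B gen s * w"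
  using assms unfolding bruhat_le_def
proof (induction rule: converse_rtranclp_induct)
  case (step u v)
  then show ?case using bruhat_step_gen[OF step(1), of s]
    unfolding bruhat_le_def by (meson rtranclp_trans)
qed auto

lemma bruhat_lift:
  assumes "u \<le>\<^sub>B w" "desc s w"
  shows "gen s * u \<le>\<^sub>B w"
  using bruhat_gen[OF assms(1), of s] bruhat_down[OF assms(2)] bruhat_trans by blast

lemma bruhat_mono:
  assumes "u \<le>\<^sub>B w" "\<not> desc s w"
  shows "gen s * u \<le>\<^sub>B gen s * w"
  using bruhat_gen[OF assms(1), of s] bruhat_up[OF assms(2)] bruhat_trans by blast

lemma left_descents_desc: "left_descents w = {s. desc s w}"
proof -
  have "gen s * w <\<^sub>B w \<longleftrightarrow> desc s w" for s
  proof
    assume "gen s * w <\<^sub>B w"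
    then show "desc s w" using bruhat_le_len unfolding bruhat_less_def desc_def by blast
  next
    assume "desc s w"
    then show "gen s * w <\<^sub>B w" using bruhat_down unfolding bruhat_less_def desc_def by auto
  qed
  then show ?thesis by (simp add: left_descents_def)
qed

lemma bruhat_inverse:
  assumes "u \<le>\<^sub>B w"
  shows "inverse u \<le>\<^sub>B inverse w"
  using assms unfolding bruhat_le_def
proof (induction rule: rtranclp_induct)
  case (step v w)
  then obtain t where "len v < len w" "t \<in> reflections" "w = t * v"
    unfolding bruhat_step_iff by blast
  then have "bruhat_step (inverse v) (inverse w)"
    using len_inverse[of v] len_inverse[of w] by (auto simp: bruhat_step_def inverse_reflection simp del: len_inverse)
  with step show ?case by auto
qed auto

lemma finite_len_le: "finite {w. len w \<le> n}"
proof -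
  have "{w. len w \<le> n} \<subseteq> word ` {xs. set xs \<subseteq> {Sr, Ss, St} \<and> length xs \<le> n}"
  proof
    fix w assume "w \<in> {w. len w \<le> n}"
    moreover obtain xs where "word xs = w" "length xs = len w" using reduced_word_exists by metis
    moreover have "set xs \<subseteq> {Sr, Ss, St}" using simple.exhaust by blast
    ultimately show "w \<in> word ` {xs. set xs \<subseteq> {Sr, Ss, St} \<and> length xs \<le> n}" by auto
  qed
  moreover have "finite {xs. set xs \<subseteq> {Sr, Ss, St} \<and> length xs \<le> n}"
    by (rule finite_lists_length_le) simp
  ultimately show ?thesis by (rule finite_subset[OF _ finite_imageI])
qed

lemma finite_bruhat_le: "finite {u. u \<le>\<^sub>B w}"
  by (rule finite_subset[OF _ finite_len_le[of "len w"]]) (auto dest: bruhat_le_len)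

text \<open>If appending \<open>t\<close> turns \<open>s\<close> into a left descent, then the
  letter removed by the exchange condition must be that \<open>t\<close>, since otherwise
  \<open>s\<close> would already be a descent of \<open>w\<close>.\<close>

lemma desc_change:
  assumes "desc s w \<noteq> desc s (w * gen t)"
  shows "gen s * w = w * gen t"
proof -
  have main: "gen s * w = w * gen t" if nd: "\<not> desc s w" "desc s (w * gen t)" for w
  proof -
    obtain xs where xs: "word xs = w" "length xs = len w" using reduced_word_exists by metis
    have "word (xs @ [t]) = w * gen t" using xs by (simp add: times_word[symmetric] word_Cons)
    then obtain us a vs where *: "xs @ [t] = us @ a # vs" "gen s * (w * gen t) = word (us @ vs)"
      using exchange[of s "xs @ [t]"] nd(2) by auto
    show ?thesis
    proof (cases vs rule: rev_cases)
      case Nil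
      then have "gen s * (w * gen t) = w" using * xs by simp
      then show ?thesis by (simp add: gen_mult_eq_iff)
    next
      case (snoc vs' b)
      then have "gen s * w * gen t = word (us @ vs') * gen t" "xs = us @ a # vs'"
        using * by (auto simp: times_word[symmetric] word_Cons mult.assoc)
      then have "len (gen s * w) < len w" using xs len_word_le[of "us @ vs'"] by simp
      with nd show ?thesis by (simp add: desc_def)
    qed
  qed
  show ?thesis
  proof (cases "desc s w")
    case True
    then have "gen s * (w * gen t) = w" using assms main[of "w * gen t"] by simp
    then show ?thesis by (simp add: gen_mult_eq_iff)
  next
    case False
    then show ?thesis using assms main by blast
  qed
qed

section \<open>Laurent polynomials\<close>

lemma pm_induct [case_names zero single add]:
  fixes f :: "'a \<Rightarrow>\<^sub>0 'b::comm_monoid_add"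
  assumes "P 0" "\<And>k c. P (Poly_Mapping.single k c)" "\<And>f g. P f \<Longrightarrow> P g \<Longrightarrow> P (f + g)"
  shows "P f"
proof -
  have "P (\<Sum>k\<in>A. Poly_Mapping.single k (Poly_Mapping.lookup f k))" if "finite A" for A
    using that by (induction A) (auto intro: assms)
  moreover have "f = (\<Sum>k\<in>Poly_Mapping.keys f. Poly_Mapping.single k (Poly_Mapping.lookup f k))"
    by (rule poly_mapping_eqI)
      (auto simp: lookup_sum lookup_single when_def in_keys_iff)
  ultimately show ?thesis by (metis finite_keys)
qed

lemma half_q_pow_add: "half_q_pow a * half_q_pow b = half_q_pow (a + b)"
  by (simp add: half_q_pow_def mult_single)

lemma half_q_pow_add_left: "half_q_pow a * (half_q_pow b * f) = half_q_pow (a + b) * f"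
  by (simp add: half_q_pow_add mult.assoc[symmetric])

lemma half_q_pow_0 [simp]: "half_q_pow 0 = 1"
  by (simp add: half_q_pow_def)

lemma q_var_eq: "q_var = half_q_pow 2"
  by (simp add: q_var_def)

lemma lookup_single_mult:
  "Poly_Mapping.lookup (Poly_Mapping.single k c * f) n = c * Poly_Mapping.lookup f (n - k)"
  for f :: laurent
proof (induction f rule: pm_induct)
  case (single j d)
  then show ?case by (auto simp: mult_single lookup_single when_def)
qed (simp_all add: lookup_add algebra_simps)

lemma lookup_half_q_pow_mult [simp]:
  "Poly_Mapping.lookup (half_q_pow k * f) n = Poly_Mapping.lookup f (n - k)"
  by (simp add: half_q_pow_def lookup_single_mult)

lemma lookup_half_q_pow: "Poly_Mapping.lookup (half_q_pow k) n = (if n = k then 1 else 0)"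
  by (auto simp: half_q_pow_def lookup_single when_def)

lemma half_q_pow_mult_eq_iff [simp]: "half_q_pow k * f = half_q_pow k * g \<longleftrightarrow> f = g"
  by (metis half_q_pow_add_left add.commute diff_add_cancel diff_self half_q_pow_0 mult_1_left uminus_add_conv_diff)

lemma lookup_laurent_bar [simp]:
  "Poly_Mapping.lookup (laurent_bar f) n = Poly_Mapping.lookup f (- n)"
  by (simp add: laurent_bar_def map_key.rep_eq)

lemma laurent_bar_add: "laurent_bar (f + g) = laurent_bar f + laurent_bar g"
  by (rule poly_mapping_eqI) (simp add: lookup_add)

lemma laurent_bar_minus: "laurent_bar (f - g) = laurent_bar f - laurent_bar g"
  by (rule poly_mapping_eqI) (simp add: lookup_minus)

lemma laurent_bar_0 [simp]: "laurent_bar 0 = 0"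
  by (rule poly_mapping_eqI) simp

lemma laurent_bar_1 [simp]: "laurent_bar 1 = 1"
  by (rule poly_mapping_eqI) (auto simp: lookup_one when_def)

lemma laurent_bar_half_q_pow [simp]: "laurent_bar (half_q_pow k) = half_q_pow (- k)"
  by (rule poly_mapping_eqI) (auto simp: lookup_half_q_pow)

lemma laurent_bar_of_int [simp]: "laurent_bar (of_int c) = of_int c"
  by (rule poly_mapping_eqI) (auto simp: lookup_of_int when_def)

lemma laurent_bar_mult: "laurent_bar (f * g) = laurent_bar f * laurent_bar g"
proof (induction f rule: pm_induct)
  case (single k c)
  have "laurent_bar (Poly_Mapping.single k c) = Poly_Mapping.single (- k) c"
    by (rule poly_mapping_eqI) (auto simp: lookup_single when_def)
  then show ?case by (intro poly_mapping_eqI) (simp add: lookup_single_mult)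
qed (simp_all add: laurent_bar_add algebra_simps)

section \<open>The Hecke algebra\<close>

lemma lookup_scale [simp]: "Poly_Mapping.lookup (scale a h) w = a * Poly_Mapping.lookup h w"
  by (simp add: scale_def map.rep_eq when_def)

interpretation hecke: module scale
  by unfold_locales (rule poly_mapping_eqI, simp add: lookup_add algebra_simps)+

lemma single_eq_scale: "Poly_Mapping.single w a = scale a (T_basis w)"
  by (rule poly_mapping_eqI) (auto simp: T_basis_def lookup_single when_def)

lemma lookup_T_basis: "Poly_Mapping.lookup (T_basis w) u = (if u = w then 1 else 0)"
  by (auto simp: T_basis_def lookup_single when_def)

text \<open>One notion for linear maps, for the bar involution (\<sigma> is then
  \<open>laurent_bar\<close>) and for maps from the Hecke algebra into another module with scalar
  action \<open>sc\<close>.\<close>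

definition semilin :: "(laurent \<Rightarrow> laurent) \<Rightarrow> (laurent \<Rightarrow> 'b \<Rightarrow> 'b) \<Rightarrow> (hecke \<Rightarrow> 'b::ab_group_add) \<Rightarrow> bool" where
  "semilin \<sigma> sc F \<longleftrightarrow> (\<forall>g h. F (g + h) = F g + F h) \<and> (\<forall>a h. F (scale a h) = sc (\<sigma> a) (F h))"

abbreviation lin :: "(hecke \<Rightarrow> hecke) \<Rightarrow> bool" where
  "lin \<equiv> semilin (\<lambda>a. a) scale"

lemma semilinD:
  assumes "semilin \<sigma> sc F"
  shows "F (g + h) = F g + F h" "F (scale a h) = sc (\<sigma> a) (F h)" "F 0 = 0" "F (- h) = - F h"
    "F (g - h) = F g - F h" "F (sum f A) = (\<Sum>i\<in>A. F (f i))"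
proof -
  show *: "F (g + h) = F g + F h" "F (scale a h) = sc (\<sigma> a) (F h)" for g h a
    using assms by (auto simp: semilin_def)
  show 0: "F 0 = 0" using *(1)[of 0 0] by simp
  show m: "F (- h) = - F h" for h using *(1)[of h "- h"] 0 by (simp add: eq_neg_iff_add_eq_0 add.commute)
  show "F (g - h) = F g - F h" using *(1)[of g "- h"] m by simp
  show "F (sum f A) = (\<Sum>i\<in>A. F (f i))"
    by (induction A rule: infinite_finite_induct) (simp_all add: 0 *)
qed

lemma semilin_eqI:
  assumes "semilin \<sigma> sc F" "semilin \<sigma> sc G" "\<And>w. F (T_basis w) = G (T_basis w)"
  shows "F h = G h"
  by (induction h rule: pm_induct)
    (simp_all add: semilinD[OF assms(1)] semilinD[OF assms(2)] assms(3) single_eq_scale)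

lemma lin_comp: "semilin \<sigma> sc F \<Longrightarrow> lin G \<Longrightarrow> semilin \<sigma> sc (\<lambda>h. F (G h))"
  by (simp add: semilin_def)

lemma lin_comp_semilin: "lin F \<Longrightarrow> semilin \<sigma> scale G \<Longrightarrow> semilin \<sigma> scale (\<lambda>h. F (G h))"
  by (simp add: semilin_def)

lemma lin_id: "lin (\<lambda>h. h)"
  by (simp add: semilin_def)

text \<open>The sums over \<open>keys\<close> used in the definitions are extensions from the basis;
  additivity holds because both supports can be enlarged to a common finite set.\<close>

lemma semilin_ext:
  fixes sc :: "laurent \<Rightarrow> 'b \<Rightarrow> 'b::ab_group_add"
  assumes "module sc" "\<sigma> 0 = 0" "\<And>a b. \<sigma> (a + b) = \<sigma> a + \<sigma> b" "\<And>a b. \<sigma> (a * b) = \<sigma> a * \<sigma> b"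
  shows "semilin \<sigma> sc (\<lambda>h. \<Sum>w\<in>Poly_Mapping.keys h. sc (\<sigma> (Poly_Mapping.lookup h w)) (f w))"
proof -
  interpret module sc by fact
  have super: "(\<Sum>w\<in>Poly_Mapping.keys h. sc (\<sigma> (Poly_Mapping.lookup h w)) (f w)) =
      (\<Sum>w\<in>A. sc (\<sigma> (Poly_Mapping.lookup h w)) (f w))" if "finite A" "Poly_Mapping.keys h \<subseteq> A" for h A
    using that by (intro sum.mono_neutral_left) (auto simp: in_keys_iff assms)
  show ?thesis
  proof (unfold semilin_def, intro conjI allI)
    fix g h :: hecke
    define A where "A = Poly_Mapping.keys g \<union> Poly_Mapping.keys h"
    have A: "finite A" "Poly_Mapping.keys g \<subseteq> A" "Poly_Mapping.keys h \<subseteq> A" "Poly_Mapping.keys (g + h) \<subseteq> A"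
      using keys_add[of g h] by (auto simp: A_def)
    show "(\<Sum>w\<in>Poly_Mapping.keys (g + h). sc (\<sigma> (Poly_Mapping.lookup (g + h) w)) (f w)) =
      (\<Sum>w\<in>Poly_Mapping.keys g. sc (\<sigma> (Poly_Mapping.lookup g w)) (f w)) +
      (\<Sum>w\<in>Poly_Mapping.keys h. sc (\<sigma> (Poly_Mapping.lookup h w)) (f w))"
      unfolding super[OF A(1,2)] super[OF A(1,3)] super[OF A(1,4)]
      by (simp add: lookup_add assms scale_left_distrib sum.distrib)
  next
    fix a and h :: hecke
    have A: "Poly_Mapping.keys (scale a h) \<subseteq> Poly_Mapping.keys h" by (auto simp: in_keys_iff)
    show "(\<Sum>w\<in>Poly_Mapping.keys (scale a h). sc (\<sigma> (Poly_Mapping.lookup (scale a h) w)) (f w)) =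
      sc (\<sigma> a) (\<Sum>w\<in>Poly_Mapping.keys h. sc (\<sigma> (Poly_Mapping.lookup h w)) (f w))"
      unfolding super[OF finite_keys A] by (simp add: assms scale_sum_right)
  qed
qed

lemma semilin_ext_T_basis:
  assumes "module sc" "\<sigma> 1 = 1"
  shows "(\<Sum>w\<in>Poly_Mapping.keys (T_basis u). sc (\<sigma> (Poly_Mapping.lookup (T_basis u) w)) (f w)) = f u"
proof -
  interpret module sc by fact
  show ?thesis using assms(2) by (simp add: T_basis_def)
qed

lemma lin_gen_mult: "lin (gen_mult s)"
  unfolding gen_mult_def by (rule semilin_ext[OF hecke.module_axioms]) simp_all

lemmas gen_mult_simps = semilinD[OF lin_gen_mult]

lemma gen_mult_T: "gen_mult s (T_basis w) = (if desc s w
    then scale (q_var - 1) (T_basis w) + scale q_var (T_basis (gen s * w)) else T_basis (gen s * w))"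
proof -
  have "len w < len (gen s * w) \<longleftrightarrow> \<not> desc s w"
    using len_gen_cases[of s w] unfolding desc_def by linarith
  moreover have "gen_mult s (T_basis w) = (if len w < len (gen s * w) then T_basis (gen s * w)
    else scale (q_var - 1) (T_basis w) + scale q_var (T_basis (gen s * w)))"
    unfolding gen_mult_def by (rule semilin_ext_T_basis[OF hecke.module_axioms, of "\<lambda>a. a"]) simp
  ultimately show ?thesis by simp
qed

lemma gen_mult_neq [simp]: "gen s * x \<noteq> x" "x \<noteq> gen s * x"
  using len_gen_cases[of s x] by auto

lemma lookup_gen_mult: "Poly_Mapping.lookup (gen_mult s h) w = (if desc s w
    then Poly_Mapping.lookup h (gen s * w) + (q_var - 1) * Poly_Mapping.lookup h w
    else q_var * Poly_Mapping.lookup h (gen s * w))"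
proof (induction h rule: pm_induct)
  case (single x a)
  show ?case
    by (auto simp: single_eq_scale gen_mult_simps gen_mult_T lookup_add lookup_T_basis
        gen_mult_eq_iff algebra_simps lookup_minus)
qed (simp_all add: gen_mult_simps lookup_add algebra_simps)

lemma gen_mult_quadratic:
  "gen_mult s (gen_mult s h) = scale (q_var - 1) (gen_mult s h) + scale q_var h"
proof (rule poly_mapping_eqI)
  fix w
  show "Poly_Mapping.lookup (gen_mult s (gen_mult s h)) w =
    Poly_Mapping.lookup (scale (q_var - 1) (gen_mult s h) + scale q_var h) w"
    by (cases "desc s w") (simp_all add: lookup_gen_mult lookup_add ring_distribs)
qed

section \<open>Right multiplication and independence of the chosen reduced word\<close>

definition flat :: "hecke \<Rightarrow> hecke" where
  "flat = Poly_Mapping.map_key inverse"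

lemma lookup_flat [simp]: "Poly_Mapping.lookup (flat h) w = Poly_Mapping.lookup h (inverse w)"
  by (simp add: flat_def map_key.rep_eq inj_on_def)

lemma flat_flat [simp]: "flat (flat h) = h"
  by (rule poly_mapping_eqI) simp

lemma lin_flat: "lin flat"
  by (auto simp: semilin_def lookup_add intro!: poly_mapping_eqI)

lemma flat_T [simp]: "flat (T_basis w) = T_basis (inverse w)"
  by (rule poly_mapping_eqI) (auto simp: lookup_T_basis)

definition rgen_mult :: "simple \<Rightarrow> hecke \<Rightarrow> hecke" where
  "rgen_mult s h = flat (gen_mult s (flat h))"

lemma lookup_rgen_mult: "Poly_Mapping.lookup (rgen_mult s h) w = (if desc s (inverse w)
    then Poly_Mapping.lookup h (w * gen s) + (q_var - 1) * Poly_Mapping.lookup h w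
    else q_var * Poly_Mapping.lookup h (w * gen s))"
  by (simp add: rgen_mult_def lookup_gen_mult)

lemma rdesc_change:
  assumes "desc t (inverse w) \<noteq> desc t (inverse (gen s * w))"
  shows "gen s * w = w * gen t"
proof -
  have "gen t * inverse w = inverse w * gen s" using assms by (intro desc_change) simp
  then have "inverse (gen t * inverse w) = inverse (inverse w * gen s)" by simp
  then show ?thesis by simp
qed

text \<open>Descents on one side change under multiplication on the other only if
  \<open>s w = w t\<close>, so that is the one case in which the two case distinctions interact.
  Both associativity and independence of the reduced word rest on this commutation.\<close>

lemma gen_mult_rgen_mult: "gen_mult s (rgen_mult t h) = rgen_mult t (gen_mult s h)"
proof (rule poly_mapping_eqI)
  fix w
  show "Poly_Mapping.lookup (gen_mult s (rgen_mult t h)) w = Poly_Mapping.lookup (rgen_mult t (gen_mult s h)) w"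
  proof (cases "gen s * w = w * gen t")
    case False
    then have "desc s w = desc s (w * gen t)" "desc t (inverse w) = desc t (inverse (gen s * w))"
      using desc_change rdesc_change by blast+
    then show ?thesis by (simp add: lookup_gen_mult lookup_rgen_mult algebra_simps)
  next
    case True
    have "desc t (inverse (w * gen t)) = (\<not> desc t (inverse w))" by simp
    then have 1: "desc t (inverse (gen s * w)) = (\<not> desc t (inverse w))" using True by simp
    have "len (gen t * inverse w) = len (inverse (w * gen t))" by simp
    then have "len (gen t * inverse w) = len (gen s * w)" using True by (metis len_inverse)
    then have 3: "desc t (inverse w) = desc s w" unfolding desc_def by simp
    have 2: "gen s * (w * gen t) = w" using True by (metis gen_gen_left)
    have 4: "desc s (w * gen t) = (\<not> desc s w)" using True by (metis desc_gen)
    show ?thesis using 1 2 3 4 True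
      by (auto simp: lookup_gen_mult lookup_rgen_mult mult.assoc algebra_simps)
  qed
qed

abbreviation reduced :: "simple list \<Rightarrow> bool" where
  "reduced xs \<equiv> len (word xs) = length xs"

lemma reduced_wordE:
  obtains xs where "word xs = w" "reduced xs"
proof -
  obtain xs where xs: "word xs = w" "length xs = len w" using reduced_word_exists[of w] by blast
  have "reduced xs" unfolding xs ..
  with xs(1) show thesis by (rule that)
qed

lemma reduced_Cons: "reduced (s # xs) \<Longrightarrow> reduced xs \<and> \<not> desc s (word xs)"
  using len_word_le[of xs] len_gen_cases[of s "word xs"] unfolding word_Cons desc_def list.size by linarith

lemma reduced_ConsI: "reduced xs \<Longrightarrow> \<not> desc s (word xs) \<Longrightarrow> reduced (s # xs)"
  by (simp add: word_Cons len_not_desc)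

lemma reduced_rev: "reduced (rev xs) \<longleftrightarrow> reduced xs"
  by (simp add: inverse_word[symmetric])

lemma lin_foldr: "(\<And>s. lin (f s)) \<Longrightarrow> lin (foldr f xs)"
proof (induction xs)
  case Nil
  then show ?case using lin_id by (simp add: id_def)
next
  case (Cons s xs)
  then have "lin (\<lambda>h. f s (foldr f xs h))" using lin_comp[of _ _ "f s" "foldr f xs"] by blast
  then show ?case by (simp add: comp_def)
qed

lemma foldr_gen_mult_one: "reduced xs \<Longrightarrow> foldr gen_mult xs (T_basis 1) = T_basis (word xs)"
proof (induction xs)
  case (Cons s xs)
  then show ?case using reduced_Cons[of s xs] by (simp add: gen_mult_T word_Cons)
qed simp

definition right_op :: "simple list \<Rightarrow> hecke \<Rightarrow> hecke" where
  "right_op xs h = flat (foldr gen_mult xs (flat h))"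

lemma gen_mult_right_op: "gen_mult s (right_op xs h) = right_op xs (gen_mult s h)"
proof (induction xs)
  case (Cons t xs)
  have "gen_mult s (right_op (t # xs) h) = gen_mult s (rgen_mult t (right_op xs h))"
    by (simp add: rgen_mult_def right_op_def)
  also have "\<dots> = rgen_mult t (right_op xs (gen_mult s h))"
    by (simp add: gen_mult_rgen_mult Cons)
  finally show ?case by (simp add: rgen_mult_def right_op_def)
qed (simp add: right_op_def)

lemma foldr_gen_mult_right_op: "foldr gen_mult zs (right_op xs h) = right_op xs (foldr gen_mult zs h)"
  by (induction zs) (simp_all add: gen_mult_right_op)

lemma right_op_one: "reduced xs \<Longrightarrow> right_op xs (T_basis 1) = T_basis (inverse (word xs))"
  by (simp add: right_op_def foldr_gen_mult_one)

text \<open>Every \<open>T_y\<close> arises from \<open>T_1\<close> by right multiplications. These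
  commute with the two operators, which therefore agree everywhere once they agree at
  \<open>T_1\<close>.\<close>

lemma foldr_gen_mult_unique:
  assumes "reduced xs" "reduced ys" "word xs = word ys"
  shows "foldr gen_mult xs h = foldr gen_mult ys h"
proof (rule semilin_eqI[OF lin_foldr[OF lin_gen_mult] lin_foldr[OF lin_gen_mult]])
  fix y
  obtain zs where "word zs = inverse y" "reduced zs" by (rule reduced_wordE)
  then have "T_basis y = right_op zs (T_basis 1)" using right_op_one[of zs] by simp
  then show "foldr gen_mult xs (T_basis y) = foldr gen_mult ys (T_basis y)"
    using assms by (simp add: foldr_gen_mult_right_op foldr_gen_mult_one)
qed

lemma T_mult_eq: "reduced xs \<Longrightarrow> T_mult (word xs) h = foldr gen_mult xs h"
proof -
  assume xs: "reduced xs"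
  have "word (SOME ys. word ys = word xs \<and> length ys = len (word xs)) = word xs \<and>
    length (SOME ys. word ys = word xs \<and> length ys = len (word xs)) = len (word xs)"
    by (rule someI[of _ xs]) (use xs in simp)
  then show ?thesis unfolding T_mult_def by (intro foldr_gen_mult_unique) (use xs in auto)
qed

lemma lin_T_mult: "lin (T_mult w)"
  unfolding T_mult_def using lin_foldr[OF lin_gen_mult] by (simp add: semilin_def)

lemma T_mult_gen: "\<not> desc s w \<Longrightarrow> T_mult (gen s * w) h = gen_mult s (T_mult w h)"
proof -
  assume nd: "\<not> desc s w"
  obtain xs where xs: "word xs = w" "reduced xs" by (rule reduced_wordE)
  then show ?thesis using T_mult_eq[of xs h] T_mult_eq[OF reduced_ConsI, of xs s h] nd
    by (simp add: word_Cons)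
qed

lemma T_mult_one [simp]: "T_mult 1 h = h"
  using T_mult_eq[of "[]"] by simp

lemma T_mult_T_one: "T_mult w (T_basis 1) = T_basis w"
  by (rule reduced_wordE[of w]) (use T_mult_eq foldr_gen_mult_one in auto)

lemma lin_hecke_mult_left: "lin (\<lambda>h. hecke_mult h h')"
  unfolding hecke_mult_def by (rule semilin_ext[OF hecke.module_axioms]) simp_all

lemma lin_hecke_mult_right: "lin (hecke_mult h)"
  unfolding semilin_def hecke_mult_def
  by (simp add: semilinD[OF lin_T_mult] hecke.scale_right_distrib sum.distrib
      hecke.scale_sum_right mult.commute)

lemma hecke_mult_T: "hecke_mult (T_basis w) h = T_mult w h"
  unfolding hecke_mult_def
  by (rule semilin_ext_T_basis[OF hecke.module_axioms, of "\<lambda>a. a"]) simp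

lemma hecke_mult_gen_mult: "hecke_mult (gen_mult s h) h' = gen_mult s (hecke_mult h h')"
proof (rule semilin_eqI[OF lin_comp[OF lin_hecke_mult_left lin_gen_mult]
      lin_comp[OF lin_gen_mult lin_hecke_mult_left]])
  fix w
  show "hecke_mult (gen_mult s (T_basis w)) h' = gen_mult s (hecke_mult (T_basis w) h')"
  proof (cases "desc s w")
    case True
    then have "T_mult w h' = gen_mult s (T_mult (gen s * w) h')" using T_mult_gen[of s "gen s * w"] by simp
    then show ?thesis using True
      by (simp add: gen_mult_T semilinD[OF lin_hecke_mult_left] hecke_mult_T gen_mult_quadratic)
  next
    case False
    then show ?thesis by (simp add: gen_mult_T hecke_mult_T T_mult_gen)
  qed
qed

lemma hecke_mult_rgen_mult: "hecke_mult h (rgen_mult s h') = rgen_mult s (hecke_mult h h')"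
proof -
  have lin_r: "lin (rgen_mult s)"
    unfolding rgen_mult_def using lin_comp[OF lin_flat lin_comp[OF lin_gen_mult lin_flat]] .
  have *: "foldr gen_mult xs (rgen_mult s h') = rgen_mult s (foldr gen_mult xs h')" for xs
    by (induction xs) (simp_all add: gen_mult_rgen_mult)
  show ?thesis
  proof (rule semilin_eqI[OF lin_hecke_mult_left lin_comp[OF lin_r lin_hecke_mult_left]])
    fix w
    show "hecke_mult (T_basis w) (rgen_mult s h') = rgen_mult s (hecke_mult (T_basis w) h')"
      unfolding hecke_mult_T T_mult_def by (rule *)
  qed
qed

lemma hecke_mult_one_right [simp]: "hecke_mult h (T_basis 1) = h"
  by (rule semilin_eqI[OF lin_hecke_mult_left lin_id]) (simp add: hecke_mult_T T_mult_T_one)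

subsection \<open>The bar involution\<close>

text \<open>Left multiplication by \<open>T_s^(-1)\<close>, as obtained from the quadratic
  relation.\<close>

definition gen_inv :: "simple \<Rightarrow> hecke \<Rightarrow> hecke" where
  "gen_inv s h = scale (half_q_pow (-2)) (gen_mult s h) - scale (1 - half_q_pow (-2)) h"

lemma lin_gen_inv: "lin (gen_inv s)"
  unfolding semilin_def gen_inv_def
  by (simp add: gen_mult_simps hecke.scale_right_distrib hecke.scale_right_diff_distrib algebra_simps)

lemma gen_inv_gen_mult [simp]: "gen_inv s (gen_mult s h) = h" "gen_mult s (gen_inv s h) = h"
proof -
  have "scale (half_q_pow (-2)) (gen_mult s (gen_mult s h)) - scale (1 - half_q_pow (-2)) (gen_mult s h) = h"
    by (rule poly_mapping_eqI)
      (simp add: gen_mult_quadratic lookup_add lookup_minus q_var_eq algebra_simps half_q_pow_add_left half_q_pow_add)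
  then show "gen_inv s (gen_mult s h) = h" "gen_mult s (gen_inv s h) = h"
    by (simp_all add: gen_inv_def gen_mult_simps)
qed

lemma hecke_mult_gen_inv: "hecke_mult (gen_inv s h) h' = gen_inv s (hecke_mult h h')"
  by (metis gen_inv_gen_mult hecke_mult_gen_mult)

definition T_bar :: "W \<Rightarrow> hecke" where
  "T_bar w = T_inverse (inverse w)"

text \<open>The definite description in \<open>T_inverse\<close> needs existence and uniqueness: the
  product of the inverse letters is a two-sided inverse, and cancelling letter by letter shows that
  any right inverse equals it.\<close>

lemma T_bar_eq:
  assumes "reduced xs"
  shows "T_bar (word xs) = foldr gen_inv xs (T_basis 1)"
proof -
  define g where "g = foldr gen_inv xs (T_basis 1)"
  have r: "reduced (rev xs)" using assms reduced_rev by blast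
  have inv: "inverse (word xs) = word (rev xs)" by (rule inverse_word)
  have c1: "foldr gen_mult (rev ys) (foldr gen_inv ys h) = h" for ys h
    by (induction ys arbitrary: h) simp_all
  have c2: "foldr gen_inv ys (foldr gen_mult (rev ys) h) = h" for ys h
    by (induction ys arbitrary: h) simp_all
  have c3: "hecke_mult (foldr gen_inv ys h) h' = foldr gen_inv ys (hecke_mult h h')" for ys h h'
    by (induction ys) (simp_all add: hecke_mult_gen_inv)
  have 1: "hecke_mult (T_basis (word (rev xs))) h = foldr gen_mult (rev xs) h" for h
    by (simp add: hecke_mult_T T_mult_eq[OF r])
  have B: "hecke_mult g (T_basis (word (rev xs))) = T_basis 1"
    unfolding g_def c3 hecke_mult_T T_mult_one foldr_gen_mult_one[OF r, symmetric] c2 ..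
  have A: "hecke_mult (T_basis (word (rev xs))) g = T_basis 1" unfolding 1 g_def c1 ..
  have C: "h = g" if "hecke_mult (T_basis (word (rev xs))) h = T_basis 1" for h
    using c2[of xs h] that unfolding 1 g_def by (simp only:)
  show ?thesis unfolding T_bar_def T_inverse_def inv g_def[symmetric]
    by (rule the_equality, rule conjI[OF A B], rule C, erule conjunct1)
qed

lemma T_bar_gen: "\<not> desc s w \<Longrightarrow> T_bar (gen s * w) = gen_inv s (T_bar w)"
proof -
  assume nd: "\<not> desc s w"
  obtain xs where xs: "word xs = w" "reduced xs" by (rule reduced_wordE)
  then show ?thesis using T_bar_eq[of xs] T_bar_eq[OF reduced_ConsI, of xs s] nd
    by (simp add: word_Cons)
qed

lemma semilin_bar: "semilin laurent_bar scale hecke_bar"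
  unfolding hecke_bar_def
  by (rule semilin_ext[OF hecke.module_axioms]) (simp_all add: laurent_bar_add laurent_bar_mult)

lemma bar_T: "hecke_bar (T_basis w) = T_bar w"
  unfolding hecke_bar_def T_bar_def
  by (rule semilin_ext_T_basis[OF hecke.module_axioms, of laurent_bar]) simp

lemma bar_T_one [simp]: "hecke_bar (T_basis 1) = T_basis 1"
  using T_bar_eq[of "[]"] by (simp add: bar_T)

lemma gen_inv_quadratic:
  "gen_inv s (gen_inv s h) = scale (half_q_pow (-2) - 1) (gen_inv s h) + scale (half_q_pow (-2)) h"
  by (rule poly_mapping_eqI)
    (simp add: gen_inv_def gen_mult_simps gen_mult_quadratic lookup_add lookup_minus q_var_eq
      algebra_simps half_q_pow_add_left half_q_pow_add)

lemma bar_gen_mult: "hecke_bar (gen_mult s h) = gen_inv s (hecke_bar h)"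
proof (rule semilin_eqI[OF lin_comp[OF semilin_bar lin_gen_mult]
      lin_comp_semilin[OF lin_gen_inv semilin_bar]])
  fix w
  show "hecke_bar (gen_mult s (T_basis w)) = gen_inv s (hecke_bar (T_basis w))"
  proof (cases "desc s w")
    case True
    then have "T_bar w = gen_inv s (T_bar (gen s * w))" using T_bar_gen[of s "gen s * w"] by simp
    then show ?thesis using True
      by (simp add: gen_mult_T semilinD[OF semilin_bar] bar_T gen_inv_quadratic q_var_eq laurent_bar_minus)
  qed (simp add: gen_mult_T bar_T T_bar_gen)
qed

text \<open>Triangularity of the bar involution with respect to length: among the elements of length
  \<open>l(w)\<close> only \<open>w\<close> itself occurs. In this form it yields the uniqueness of
  the Kazhdan-Lusztig basis.\<close>

lemma lookup_T_bar:
  "len w < len u \<Longrightarrow> Poly_Mapping.lookup (T_bar w) u = 0"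
  "len w = len u \<Longrightarrow> Poly_Mapping.lookup (T_bar w) u = (if u = w then half_q_pow (- 2 * int (len w)) else 0)"
proof -
  have "(len w < len u \<longrightarrow> Poly_Mapping.lookup (T_bar w) u = 0) \<and>
    (len w = len u \<longrightarrow> Poly_Mapping.lookup (T_bar w) u = (if u = w then half_q_pow (- 2 * int (len w)) else 0))"
  proof (induction "len w" arbitrary: w u)
    case 0
    then have "w = 1" by simp
    moreover have "T_bar 1 = T_basis 1" using T_bar_eq[of "[]"] by simp
    ultimately show ?case by (auto simp: lookup_T_basis)
  next
    case (Suc n)
    then have "w \<noteq> 1" by auto
    then obtain s where s: "desc s w" using desc_exists by blast
    define y where "y = gen s * w"
    have w: "w = gen s * y" and nd: "\<not> desc s y" using s by (simp_all add: y_def)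
    have ly: "len w = Suc (len y)" using len_desc[OF s] by (simp add: y_def)
    with Suc have IH: "len y < len u \<Longrightarrow> Poly_Mapping.lookup (T_bar y) u = 0"
      "len y = len u \<Longrightarrow> Poly_Mapping.lookup (T_bar y) u = (if u = y then half_q_pow (- 2 * int (len y)) else 0)" for u
      by auto
    have lk: "Poly_Mapping.lookup (T_bar w) u = half_q_pow (-2) * Poly_Mapping.lookup (gen_mult s (T_bar y)) u
      - (1 - half_q_pow (-2)) * Poly_Mapping.lookup (T_bar y) u" for u
      using T_bar_gen[OF nd] by (simp add: w gen_inv_def lookup_minus)
    show ?case
    proof (intro conjI impI)
      assume "len w < len u"
      moreover from this have "len y < len (gen s * u)" using len_gen_cases[of s u] ly by linarith
      ultimately show "Poly_Mapping.lookup (T_bar w) u = 0"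
        using ly IH(1)[of u] IH(1)[of "gen s * u"] by (simp add: lk lookup_gen_mult)
    next
      assume lu: "len w = len u"
      show "Poly_Mapping.lookup (T_bar w) u = (if u = w then half_q_pow (- 2 * int (len w)) else 0)"
      proof (cases "desc s u")
        case True
        then have "len (gen s * u) = len y" using lu ly len_desc[OF True] by simp
        then have 1: "Poly_Mapping.lookup (T_bar y) (gen s * u) =
          (if gen s * u = y then half_q_pow (- 2 * int (len y)) else 0)" using IH(2) by simp
        have 2: "Poly_Mapping.lookup (T_bar y) u = 0" using IH(1) lu ly by simp
        have "Poly_Mapping.lookup (T_bar w) u = half_q_pow (-2) * Poly_Mapping.lookup (T_bar y) (gen s * u)"
          using True by (simp add: lk lookup_gen_mult 2)
        moreover have "gen s * u = y \<longleftrightarrow> u = w" by (simp add: w gen_mult_eq_iff)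
        ultimately show ?thesis by (simp add: 1 ly half_q_pow_add)
      next
        case False
        then have "u \<noteq> w" using s by auto
        then show ?thesis using False lu ly IH(1)[of u] IH(1)[of "gen s * u"] len_not_desc[OF False]
          by (simp add: lk lookup_gen_mult)
      qed
    qed
  qed
  then show "len w < len u \<Longrightarrow> Poly_Mapping.lookup (T_bar w) u = 0"
    "len w = len u \<Longrightarrow> Poly_Mapping.lookup (T_bar w) u = (if u = w then half_q_pow (- 2 * int (len w)) else 0)" by auto
qed

section \<open>The Kazhdan-Lusztig basis\<close>

text \<open>Left multiplication by \<open>C_s = v^(-1) (T_s + 1)\<close>. It satisfies
  \<open>C_s C_s = eta C_s\<close>, with \<open>eta = v + 1/v\<close> defined next.\<close>

definition cop :: "simple \<Rightarrow> hecke \<Rightarrow> hecke" where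
  "cop s h = scale (half_q_pow (-1)) (gen_mult s h + h)"

definition eta :: laurent where
  "eta = half_q_pow 1 + half_q_pow (-1)"

lemma lin_cop: "lin (cop s)"
  by (simp add: semilin_def cop_def gen_mult_simps hecke.scale_right_distrib mult.commute add_ac)

lemma bar_cop: "hecke_bar (cop s h) = cop s (hecke_bar h)"
  by (rule poly_mapping_eqI)
    (simp add: cop_def semilinD[OF semilin_bar] bar_gen_mult gen_inv_def lookup_add lookup_minus
      ring_distribs half_q_pow_add half_q_pow_add_left)

text \<open>The coefficient of \<open>h\<close> at the normalised basis element \<open>q\<^sup>-\<^sup>l\<^sup>/\<^sup>2 T\<^sub>u\<close>, \<open>l = l(u)\<close>.\<close>

definition co :: "hecke \<Rightarrow> W \<Rightarrow> laurent" where
  "co h u = half_q_pow (int (len u)) * Poly_Mapping.lookup h u"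

lemma co_simps [simp]:
  "co (g + h) u = co g u + co h u" "co (g - h) u = co g u - co h u" "co (- h) u = - co h u"
  "co (scale a h) u = a * co h u" "co 0 u = 0" "co (sum f A) u = (\<Sum>i\<in>A. co (f i) u)"
  by (simp_all add: co_def lookup_add lookup_minus lookup_sum sum_distrib_left algebra_simps)

lemma co_eq_0_iff: "co h u = 0 \<longleftrightarrow> Poly_Mapping.lookup h u = 0"
  unfolding co_def by (metis half_q_pow_mult_eq_iff mult_zero_right)

lemma half_q_pow_neq_0 [simp]: "half_q_pow k \<noteq> 0"
  using half_q_pow_mult_eq_iff[of k 0 1] by auto

lemma hecke_eqI: "(\<And>u. co g u = co h u) \<Longrightarrow> g = h"
  by (rule poly_mapping_eqI) (simp add: co_def)

lemma co_T_basis: "co (T_basis w) u = (if u = w then half_q_pow (int (len w)) else 0)"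
  by (simp add: co_def lookup_T_basis)

lemma co_flat [simp]: "co (flat h) u = co h (inverse u)"
  by (simp add: co_def)

lemma co_cop: "co (cop s h) u = co h (gen s * u) +
  (if desc s u then half_q_pow 1 else half_q_pow (-1)) * co h u"
proof (cases "desc s u")
  case True
  then show ?thesis using len_desc[OF True]
    by (simp add: co_def cop_def lookup_add lookup_gen_mult ring_distribs half_q_pow_add_left
        q_var_eq add_ac)
next
  case False
  then show ?thesis using len_not_desc[OF False]
    by (simp add: co_def cop_def lookup_add lookup_gen_mult ring_distribs half_q_pow_add_left
        q_var_eq add_ac)
qed

lemma cop_cop: "cop s (cop s h) = scale eta (cop s h)"
  by (rule hecke_eqI) (simp add: co_cop eta_def ring_distribs half_q_pow_add_left add_ac)

lemma lookup_q_poly: "Poly_Mapping.lookup (q_poly P) n =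
  (if 0 \<le> n \<and> even n then coeff P (nat (n div 2)) else 0)"
proof (induction P arbitrary: n)
  case 0
  then show ?case by (simp add: q_poly_def)
next
  case (pCons a P)
  have "q_poly (pCons a P) = of_int a + q_var * q_poly P"
    by (simp add: q_poly_def map_poly_pCons)
  then have *: "Poly_Mapping.lookup (q_poly (pCons a P)) n =
    (if n = 0 then a else 0) + Poly_Mapping.lookup (q_poly P) (n - 2)"
    by (simp add: lookup_add lookup_of_int q_var_eq when_def)
  show ?case
  proof (cases "n \<ge> 2")
    case True
    then have "n div 2 = (n - 2) div 2 + 1" "(n - 2) div 2 \<ge> 0" by auto
    then have "nat (n div 2) = Suc (nat ((n - 2) div 2))" by simp
    then show ?thesis using True by (simp add: * pCons.IH)
  next
    case False
    then consider "n < 0" | "n = 0" | "n = 1" by linarith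
    then show ?thesis unfolding * by cases (simp_all add: pCons.IH)
  qed
qed

lemma q_poly_eq_iff [simp]: "q_poly P = q_poly Q \<longleftrightarrow> P = Q"
proof
  assume eq: "q_poly P = q_poly Q"
  show "P = Q"
  proof (rule poly_eqI)
    fix n
    show "coeff P n = coeff Q n"
      using lookup_q_poly[of P "2 * int n"] lookup_q_poly[of Q "2 * int n"] eq by simp
  qed
qed simp

text \<open>Records at once a lower bound for the exponents of \<open>v\<close> and their common
  parity.\<close>

definition qpart :: "int \<Rightarrow> laurent \<Rightarrow> bool" where
  "qpart k f \<longleftrightarrow> (\<exists>P. f = half_q_pow k * q_poly P)"

lemma q_poly_simps:
  "q_poly (P + Q) = q_poly P + q_poly Q" "q_poly (P - Q) = q_poly P - q_poly Q"
  "q_poly (smult c P) = of_int c * q_poly P" "q_poly 0 = 0" "q_poly 1 = 1"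
  by (rule poly_mapping_eqI;
      auto simp: lookup_q_poly lookup_add lookup_minus lookup_single_mult lookup_one when_def
        coeff_1 nat_eq_iff single_of_int[symmetric])+

lemma qpart_add: "qpart k f \<Longrightarrow> qpart k g \<Longrightarrow> qpart k (f + g)"
  unfolding qpart_def by (metis distrib_left q_poly_simps(1))

lemma qpart_diff: "qpart k f \<Longrightarrow> qpart k g \<Longrightarrow> qpart k (f - g)"
  unfolding qpart_def by (metis right_diff_distrib q_poly_simps(2))

lemma qpart_0: "qpart k 0"
  unfolding qpart_def by (metis mult_zero_right q_poly_simps(4))

lemma qpart_1: "qpart 0 1"
  unfolding qpart_def by (metis half_q_pow_0 mult_1_left q_poly_simps(5))

lemma qpart_of_int: "qpart k f \<Longrightarrow> qpart k (of_int c * f)"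
  unfolding qpart_def by (metis mult.left_commute q_poly_simps(3))

lemma qpart_sum: "(\<And>i. i \<in> A \<Longrightarrow> qpart k (f i)) \<Longrightarrow> qpart k (sum f A)"
  by (induction A rule: infinite_finite_induct) (auto intro: qpart_0 qpart_add)

lemma qpart_shift: "qpart k f \<Longrightarrow> qpart (j + k) (half_q_pow j * f)"
  unfolding qpart_def by (metis half_q_pow_add_left)

lemma qpart_lower: "qpart (k + 2 * int n) f \<Longrightarrow> qpart k f"
proof (induction n)
  case (Suc n)
  from Suc.prems obtain P where P: "f = half_q_pow (k + 2 * int (Suc n)) * q_poly P"
    unfolding qpart_def by blast
  have "q_poly (pCons 0 P) = q_var * q_poly P" by (simp add: q_poly_def map_poly_pCons)
  then have "f = half_q_pow (k + 2 * int n) * q_poly (pCons 0 P)"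
    by (simp add: P q_var_eq half_q_pow_add_left add_ac)
  then have "qpart (k + 2 * int n) f" unfolding qpart_def by blast
  then show ?case by (rule Suc.IH)
qed simp

lemma qpart_lookup: "qpart k f \<Longrightarrow> Poly_Mapping.lookup f n \<noteq> 0 \<Longrightarrow> k \<le> n \<and> even (n - k)"
  unfolding qpart_def by (auto simp: lookup_q_poly split: if_splits)

text \<open>The characterisation of \<open>C_w\<close> by normalised coefficients: the degree bound
  on the polynomials becomes the absence of exponents \<open>n \<ge> 0\<close> below
  \<open>w\<close>. That the coefficients are polynomials in \<open>q\<close> up to a shift is
  treated separately, by \<open>co_q\<close>.\<close>

definition is_klh :: "W \<Rightarrow> hecke \<Rightarrow> bool" where
  "is_klh w h \<longleftrightarrow> hecke_bar h = h \<and> co h w = 1 \<and>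
    (\<forall>u. co h u \<noteq> 0 \<longrightarrow> u \<le>\<^sub>B w) \<and> (\<forall>u n. u \<noteq> w \<longrightarrow> 0 \<le> n \<longrightarrow> Poly_Mapping.lookup (co h u) n = 0)"

lemma lookup_hecke_bar_top:
  assumes "\<And>x. x \<in> Poly_Mapping.keys h \<Longrightarrow> len x \<le> len u"
  shows "Poly_Mapping.lookup (hecke_bar h) u =
    half_q_pow (- 2 * int (len u)) * laurent_bar (Poly_Mapping.lookup h u)"
proof -
  have "Poly_Mapping.lookup (hecke_bar h) u =
    (\<Sum>x\<in>Poly_Mapping.keys h. laurent_bar (Poly_Mapping.lookup h x) * Poly_Mapping.lookup (T_bar x) u)"
    by (simp add: hecke_bar_def lookup_sum T_bar_def)
  also have "\<dots> = (\<Sum>x\<in>Poly_Mapping.keys h. if x = u then half_q_pow (- 2 * int (len u)) * laurent_bar (Poly_Mapping.lookup h u) else 0)"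
  proof (rule sum.cong[OF refl])
    fix x assume "x \<in> Poly_Mapping.keys h"
    then have "len x < len u \<or> len x = len u" using assms[of x] by linarith
    then show "laurent_bar (Poly_Mapping.lookup h x) * Poly_Mapping.lookup (T_bar x) u =
      (if x = u then half_q_pow (- 2 * int (len u)) * laurent_bar (Poly_Mapping.lookup h u) else 0)"
      using lookup_T_bar[of x u] by (auto simp: mult.commute)
  qed
  also have "\<dots> = half_q_pow (- 2 * int (len u)) * laurent_bar (Poly_Mapping.lookup h u)"
    by (cases "u \<in> Poly_Mapping.keys h") (auto simp: in_keys_iff)
  finally show ?thesis .
qed

lemma finite_has_longest:
  assumes "finite A" "A \<noteq> {}"
  shows "\<exists>u\<in>A. \<forall>x\<in>A. len x \<le> len u"
proof -
  have "Max (len ` A) \<in> len ` A" using assms by (intro Max_in) auto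
  then show ?thesis using assms by (metis (no_types, lifting) Max_ge finite_imageI image_iff)
qed

text \<open>At a longest element of the support, triangularity makes the normalised coefficient
  symmetric under \<open>v \<mapsto> 1/v\<close>; having only negative exponents, it
  vanishes.\<close>

lemma bar_invariant_zero:
  assumes "hecke_bar D = D" "\<And>u n. 0 \<le> n \<Longrightarrow> Poly_Mapping.lookup (co D u) n = 0"
  shows "D = 0"
proof (rule ccontr)
  assume "D \<noteq> 0"
  then have ne: "Poly_Mapping.keys D \<noteq> {}" by simp
  obtain u where u: "u \<in> Poly_Mapping.keys D" "\<And>x. x \<in> Poly_Mapping.keys D \<Longrightarrow> len x \<le> len u"
    using finite_has_longest[OF finite_keys ne] by blast
  define c where "c = co D u"
  have "Poly_Mapping.lookup D u = half_q_pow (- 2 * int (len u)) * laurent_bar (Poly_Mapping.lookup D u)"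
    using lookup_hecke_bar_top[of D u] u(2) assms(1) by simp
  then have "c = half_q_pow (int (len u)) * (half_q_pow (- 2 * int (len u)) * laurent_bar (Poly_Mapping.lookup D u))"
    by (simp add: c_def co_def)
  also have "\<dots> = laurent_bar c"
    by (simp add: c_def co_def laurent_bar_mult half_q_pow_add_left)
  finally have cb: "c = laurent_bar c" .
  have "Poly_Mapping.lookup c n = 0" for n
  proof (cases "0 \<le> n")
    case True
    then show ?thesis using assms(2) by (simp add: c_def)
  next
    case False
    have "Poly_Mapping.lookup c n = Poly_Mapping.lookup c (- n)" by (subst cb) simp
    then show ?thesis using False assms(2)[of "- n" u] by (simp add: c_def)
  qed
  then have "c = 0" by (intro poly_mapping_eqI) simp
  then show False using u(1) by (simp add: c_def co_eq_0_iff in_keys_iff)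
qed

lemma is_klh_unique:
  assumes "is_klh w h" "is_klh w h'"
  shows "h = h'"
proof -
  have "h - h' = 0"
  proof (rule bar_invariant_zero)
    show "hecke_bar (h - h') = h - h'"
      using assms by (simp add: semilinD[OF semilin_bar] is_klh_def)
    fix u and n :: int assume "0 \<le> n"
    then show "Poly_Mapping.lookup (co (h - h') u) n = 0"
      using assms by (cases "u = w") (simp_all add: is_klh_def lookup_minus)
  qed
  then show ?thesis by simp
qed

text \<open>\<open>co_q w h\<close> says that the coefficients of \<open>h\<close> have the shape \<open>q\<^sup>(\<^sup>l\<^sup>(\<^sup>u\<^sup>)\<^sup>-\<^sup>l\<^sup>(\<^sup>w\<^sup>)\<^sup>)\<^sup>/\<^sup>2 P\<^sub>u(q)\<close>.\<close>

definition co_q :: "W \<Rightarrow> hecke \<Rightarrow> bool" where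
  "co_q w h \<longleftrightarrow> (\<forall>u. qpart (int (len u) - int (len w)) (co h u))"

lemma finite_bruhat_conj [simp]: "finite {z. z \<le>\<^sub>B y \<and> P z}"
  by (rule finite_subset[OF _ finite_bruhat_le[of y]]) auto

text \<open>The Kazhdan-Lusztig recursion. Multiplication by \<open>C_s\<close> creates constant
  terms only at those \<open>z\<close> below \<open>y\<close> with \<open>s\<close> as a descent,
  and subtracting multiples of \<open>C_z\<close> removes exactly these.\<close>

lemma is_klh_step:
  assumes nd: "\<not> desc s y" and y: "is_klh y Cy"
    and C: "\<And>z. z \<le>\<^sub>B y \<Longrightarrow> z \<noteq> y \<Longrightarrow> is_klh z (C z)"
  defines "h \<equiv> cop s Cy - (\<Sum>z\<in>{z. z \<le>\<^sub>B y \<and> z \<noteq> y \<and> desc s z}.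
    scale (of_int (Poly_Mapping.lookup (co Cy z) (-1))) (C z))"
  shows "is_klh (gen s * y) h"
proof -
  define m where "m z = Poly_Mapping.lookup (co Cy z) (-1)" for z
  define Z where "Z = {z. z \<le>\<^sub>B y \<and> z \<noteq> y \<and> desc s z}"
  have fin: "finite Z" by (simp add: Z_def)
  have hdef: "h = cop s Cy - (\<Sum>z\<in>Z. scale (of_int (m z)) (C z))"
    by (simp add: h_def Z_def m_def)
  have CZ: "is_klh z (C z)" if "z \<in> Z" for z using C that by (auto simp: Z_def)
  have coh: "co h u = co Cy (gen s * u) + (if desc s u then half_q_pow 1 else half_q_pow (-1)) * co Cy u
    - (\<Sum>z\<in>Z. of_int (m z) * co (C z) u)" for u
    by (simp add: hdef co_cop)
  have le: "y \<le>\<^sub>B gen s * y" by (rule bruhat_up[OF nd])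
  have lw: "len (gen s * y) = Suc (len y)" by (rule len_not_desc[OF nd])
  have bar: "hecke_bar h = h"
  proof -
    have "hecke_bar (scale (of_int (m z)) (C z)) = scale (of_int (m z)) (C z)" if "z \<in> Z" for z
      using CZ[OF that] by (simp add: semilinD[OF semilin_bar] is_klh_def)
    then have "(\<Sum>z\<in>Z. hecke_bar (scale (of_int (m z)) (C z))) = (\<Sum>z\<in>Z. scale (of_int (m z)) (C z))"
      by (rule sum.cong[OF refl])
    then show ?thesis using y
      by (simp only: hdef semilinD(5,6)[OF semilin_bar] bar_cop is_klh_def)
  qed
  have nle: "\<not> gen s * y \<le>\<^sub>B y" using bruhat_le_len[of "gen s * y" y] lw by auto
  have C0: "co (C z) u = 0" if "z \<in> Z" "\<not> u \<le>\<^sub>B y" for z u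
    using CZ[OF that(1)] that bruhat_trans[of u z y] by (auto simp: is_klh_def Z_def)
  then have S0: "(\<Sum>z\<in>Z. of_int (m z) * co (C z) u) = 0" if "\<not> u \<le>\<^sub>B y" for u
    using that by (intro sum.neutral) simp
  have y0: "co Cy u = 0" if "\<not> u \<le>\<^sub>B y" for u using y that by (auto simp: is_klh_def)
  have supp: "u \<le>\<^sub>B gen s * y" if ne: "co h u \<noteq> 0" for u
  proof (rule ccontr)
    assume *: "\<not> u \<le>\<^sub>B gen s * y"
    then have "\<not> u \<le>\<^sub>B y" using le bruhat_trans by blast
    moreover have "\<not> gen s * u \<le>\<^sub>B y" using bruhat_mono[OF _ nd, of "gen s * u"] * by auto
    ultimately have "co h u = 0" by (simp add: coh S0 y0)
    with ne show False ..
  qed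
  have top: "co h (gen s * y) = 1"
    using y by (simp add: coh S0[OF nle] y0[OF nle]) (simp add: is_klh_def)
  \<comment> \<open>If \<open>s\<close> is a descent of \<open>u\<close>, the factor
    \<open>v\<close> moves the coefficient at exponent -1 to exponent 0. There it is
    \<open>m u\<close> and cancels against the coefficient 1 of \<open>C u\<close> at
    \<open>u\<close>.\<close>
  have neg: "Poly_Mapping.lookup (co h u) n = 0" if ne: "u \<noteq> gen s * y" and n: "0 \<le> n" for u n
  proof -
    have 1: "Poly_Mapping.lookup (co Cy (gen s * u)) n = 0"
      using y ne n gen_mult_eq_iff by (auto simp: is_klh_def)
    have "Poly_Mapping.lookup (of_int (m z) * co (C z) u) n = (if z = u then (if n = 0 then m u else 0) else 0)"
      if "z \<in> Z" for z
      using CZ[OF that] n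
      by (auto simp: is_klh_def single_of_int[symmetric] lookup_single_mult lookup_one when_def)
    then have 2: "(\<Sum>z\<in>Z. Poly_Mapping.lookup (of_int (m z) * co (C z) u) n) =
      (\<Sum>z\<in>Z. if z = u then (if n = 0 then m u else 0) else 0)" by (rule sum.cong[OF refl])
    have 3: "Poly_Mapping.lookup (co h u) n =
      (if desc s u then Poly_Mapping.lookup (co Cy u) (n - 1) else Poly_Mapping.lookup (co Cy u) (n + 1))
       - (if u \<in> Z \<and> n = 0 then m u else 0)"
      using fin by (simp add: coh lookup_add lookup_minus lookup_sum 1 2)
    show ?thesis
    proof (cases "desc s u")
      case False
      then have "Poly_Mapping.lookup (co Cy u) (n + 1) = 0"
        using y n by (cases "u = y") (auto simp: is_klh_def lookup_one when_def)
      then show ?thesis using False by (simp add: 3 Z_def)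
    next
      case True
      then have uy: "u \<noteq> y" using nd by auto
      show ?thesis
      proof (cases "n = 0")
        case True
        then show ?thesis unfolding 3 using \<open>desc s u\<close> uy y0[of u] by (auto simp: Z_def m_def)
      next
        case False
        then show ?thesis using \<open>desc s u\<close> uy y n unfolding 3 by (auto simp: is_klh_def)
      qed
    qed
  qed
  show ?thesis unfolding is_klh_def by (rule conjI[OF bar conjI[OF top conjI]]; use supp neg in simp)
qed

lemma co_q_step:
  assumes nd: "\<not> desc s y" and y: "co_q y Cy"
    and C: "\<And>z. z \<le>\<^sub>B y \<Longrightarrow> z \<noteq> y \<Longrightarrow> co_q z (C z)"
  defines "h \<equiv> cop s Cy - (\<Sum>z\<in>{z. z \<le>\<^sub>B y \<and> z \<noteq> y \<and> desc s z}.
    scale (of_int (Poly_Mapping.lookup (co Cy z) (-1))) (C z))"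
  shows "co_q (gen s * y) h"
  unfolding co_q_def
proof
  fix u
  let ?k = "int (len u) - int (len (gen s * y))"
  have lw: "len (gen s * y) = Suc (len y)" by (rule len_not_desc[OF nd])
  have q: "qpart (int (len u) - int (len y)) (co Cy u)" for u using y by (simp add: co_q_def)
  have 1: "qpart ?k (co Cy (gen s * u))"
  proof (cases "desc s u")
    case True
    then show ?thesis using q[of "gen s * u"] len_desc[OF True] lw by simp
  next
    case False
    then show ?thesis using q[of "gen s * u"] len_not_desc[OF False] lw
      by - (rule qpart_lower[of _ 1], simp add: algebra_simps)
  qed
  have 2: "qpart ?k ((if desc s u then half_q_pow 1 else half_q_pow (-1)) * co Cy u)"
  proof (cases "desc s u")
    case True
    then show ?thesis using qpart_shift[OF q[of u], of 1] lw
      by - (rule qpart_lower[of _ 1], simp add: algebra_simps)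
  next
    case False
    then show ?thesis using qpart_shift[OF q[of u], of "-1"] lw by (simp add: algebra_simps)
  qed
  have 3: "qpart ?k (of_int (Poly_Mapping.lookup (co Cy z) (-1)) * co (C z) u)"
    if z: "z \<le>\<^sub>B y" "z \<noteq> y" for z
  proof (cases "Poly_Mapping.lookup (co Cy z) (-1) = 0")
    case True
    then show ?thesis by (simp add: qpart_0)
  next
    case False
    \<comment> \<open>The length difference between \<open>gen s * y\<close> and \<open>z\<close>. A
      nonzero coefficient at exponent -1 makes it even, so the shape relative to \<open>z\<close>
      implies the one relative to \<open>gen s * y\<close>.\<close>
    define d where "d = int (len y) + 1 - int (len z)"
    have "even (- 1 - (int (len z) - int (len y)))" using qpart_lookup[OF q[of z] False] by blast
    then have "even d" unfolding d_def by presburger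
    moreover have "0 \<le> d" using bruhat_le_len[OF z(1)] z(2) by (simp add: d_def)
    ultimately have n: "int (len y) + 1 - int (len z) = 2 * int (nat (d div 2))" unfolding d_def by simp
    define n where "n = nat (d div 2)"
    note n = n[folded n_def]
    have "qpart (?k + 2 * int n) (co (C z) u)"
      using C[OF z] n lw by (simp add: co_q_def algebra_simps)
    then show ?thesis by (intro qpart_of_int) (rule qpart_lower)
  qed
  show "qpart ?k (co h u)" unfolding h_def co_simps co_cop
    by (rule qpart_diff[OF qpart_add[OF 1 2] qpart_sum]) (simp add: 3)
qed

lemma klh_exists: "\<exists>h. is_klh w h \<and> co_q w h"
proof (induction "len w" arbitrary: w rule: less_induct)
  case less
  show ?case
  proof (cases "w = 1")
    case True
    have "is_klh 1 (T_basis 1)" by (auto simp: is_klh_def co_T_basis)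
    moreover have "co_q 1 (T_basis 1)"
      by (auto simp: co_q_def co_T_basis intro: qpart_0 qpart_1)
    ultimately show ?thesis using True by blast
  next
    case False
    then obtain s where s: "desc s w" using desc_exists by blast
    define y where "y = gen s * w"
    have w: "w = gen s * y" and nd: "\<not> desc s y" using s by (simp_all add: y_def)
    define C where "C z = (SOME h. is_klh z h \<and> co_q z h)" for z
    have C: "is_klh z (C z) \<and> co_q z (C z)" if "z \<le>\<^sub>B y" for z
    proof -
      have "len z < len w" using bruhat_le_len[OF that] len_not_desc[OF nd] w by auto
      then show ?thesis unfolding C_def using less by (metis (mono_tags, lifting) someI_ex)
    qed
    have "is_klh y (C y)" "\<And>z. z \<le>\<^sub>B y \<Longrightarrow> z \<noteq> y \<Longrightarrow> is_klh z (C z)"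
      "co_q y (C y)" "\<And>z. z \<le>\<^sub>B y \<Longrightarrow> z \<noteq> y \<Longrightarrow> co_q z (C z)"
      using C bruhat_refl by blast+
    then show ?thesis unfolding w
      using is_klh_step[OF nd, of "C y" C] co_q_step[OF nd, of "C y" C] by blast
  qed
qed

lemma lookup_kl_sum: "Poly_Mapping.lookup (kl_sum w P) u =
  (if u \<le>\<^sub>B w then half_q_pow (- int (len w)) * q_poly (P u) else 0)"
proof -
  have "Poly_Mapping.lookup (\<Sum>u\<in>{u. u \<le>\<^sub>B w}. scale (q_poly (P u)) (T_basis u)) u =
    (\<Sum>x\<in>{u. u \<le>\<^sub>B w}. if x = u then q_poly (P u) else 0)"
    unfolding lookup_sum by (rule sum.cong) (auto simp: lookup_T_basis)
  then show ?thesis by (simp add: kl_sum_def finite_bruhat_le)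
qed

lemma co_kl_sum: "co (kl_sum w P) u =
  (if u \<le>\<^sub>B w then half_q_pow (int (len u) - int (len w)) * q_poly (P u) else 0)"
  by (simp add: co_def lookup_kl_sum half_q_pow_add_left)

lemma is_klh_kl_sum:
  assumes "is_kl_family w P"
  shows "is_klh w (kl_sum w P)"
proof -
  have "Poly_Mapping.lookup (co (kl_sum w P) u) n = 0" if "u \<noteq> w" "0 \<le> n" for u n
  proof (cases "u \<le>\<^sub>B w")
    case True
    then have "u <\<^sub>B w" "len u < len w" using that(1) bruhat_le_len by (auto simp: bruhat_less_def)
    then have "2 * Polynomial.degree (P u) + 1 \<le> len w - len u" using assms by (simp add: is_kl_family_def)
    then have *: "2 * int (Polynomial.degree (P u)) + 1 \<le> n - (int (len u) - int (len w))"
      using that \<open>len u < len w\<close> by linarith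
    have "coeff (P u) (nat ((n - (int (len u) - int (len w))) div 2)) = 0"
      if "even (n - (int (len u) - int (len w)))"
    proof (rule coeff_eq_0)
      have "d < x div 2" if "2 * d + 1 \<le> x" "even x" for d x :: int using that by presburger
      from this[OF * that] have "int (Polynomial.degree (P u)) < (n - (int (len u) - int (len w))) div 2" .
      then show "Polynomial.degree (P u) < nat ((n - (int (len u) - int (len w))) div 2)" by linarith
    qed
    then show ?thesis by (simp add: co_kl_sum lookup_q_poly)
  qed (simp add: co_kl_sum)
  moreover have "u \<le>\<^sub>B w" if "co (kl_sum w P) u \<noteq> 0" for u
    using that by (auto simp: co_kl_sum split: if_splits)
  moreover have "co (kl_sum w P) w = 1"
    using assms by (simp add: co_kl_sum is_kl_family_def q_poly_simps)
  ultimately show ?thesis using assms by (auto simp: is_klh_def is_kl_family_def)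
qed

lemma kl_family_exists: "\<exists>P. is_kl_family w P"
proof -
  obtain h where h: "is_klh w h" "co_q w h" using klh_exists by blast
  define P where "P u = (SOME P. co h u = half_q_pow (int (len u) - int (len w)) * q_poly P)" for u
  have P: "co h u = half_q_pow (int (len u) - int (len w)) * q_poly (P u)" for u
    using h(2) unfolding co_q_def qpart_def P_def by (metis (mono_tags, lifting) someI_ex)
  have P0: "P u = 0" if "\<not> u \<le>\<^sub>B w" for u
  proof -
    have "co h u = 0" using h(1) that by (auto simp: is_klh_def)
    then have "q_poly (P u) = q_poly 0" using P[of u] by (simp add: q_poly_simps)
    then show ?thesis by simp
  qed
  have "kl_sum w P = h"
    by (rule hecke_eqI) (auto simp: co_kl_sum P P0 q_poly_simps)
  then have bar: "hecke_bar (kl_sum w P) = kl_sum w P" using h(1) by (simp add: is_klh_def)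
  have "q_poly (P w) = q_poly 1" using P[of w] h(1) by (simp add: is_klh_def q_poly_simps)
  then have Pw: "P w = 1" by simp
  have deg: "2 * Polynomial.degree (P u) + 1 \<le> len w - len u" if "u <\<^sub>B w" for u
  proof (cases "P u = 0")
    case True
    have "len u < len w" using bruhat_le_len that by (auto simp: bruhat_less_def)
    then show ?thesis using True by simp
  next
    case False
    let ?d = "Polynomial.degree (P u)"
    have "Poly_Mapping.lookup (co h u) (int (len u) - int (len w) + 2 * int ?d) = coeff (P u) ?d"
      by (simp add: P lookup_q_poly)
    also have "\<dots> \<noteq> 0" using False by simp
    finally have "\<not> 0 \<le> int (len u) - int (len w) + 2 * int ?d"
      using h(1) that unfolding is_klh_def bruhat_less_def by metis
    then show ?thesis by linarith
  qed
  show ?thesis unfolding is_kl_family_def using bar Pw deg P0 by blast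
qed

text \<open>The sum determines the polynomials below \<open>w\<close>, and the vanishing clause
  fixes the rest, so the family is unique as a function and the definite description is
  justified.\<close>

lemma is_kl_family_kl_poly: "is_kl_family w (\<lambda>u. kl_poly u w)"
proof -
  obtain P where P: "is_kl_family w P" using kl_family_exists by blast
  have "P' = P" if P': "is_kl_family w P'" for P'
  proof
    fix u
    have "kl_sum w P' = kl_sum w P" using is_klh_unique is_klh_kl_sum P P' by blast
    then have "co (kl_sum w P') u = co (kl_sum w P) u" by simp
    then show "P' u = P u"
      using P P' by (cases "u \<le>\<^sub>B w") (auto simp: co_kl_sum is_kl_family_def)
  qed
  with P have "(THE P. is_kl_family w P) = P" by blast
  then show ?thesis using P by (simp add: kl_poly_def)
qed

lemma is_klh_kl_basis: "is_klh w (kl_basis w)"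
  unfolding kl_basis_def by (rule is_klh_kl_sum[OF is_kl_family_kl_poly])

text \<open>For \<open>u \<le> w\<close> this is \<open>v^(l(u) - l(w)) P_{u,w}\<close>, a Laurent
  polynomial with negative exponents unless \<open>u = w\<close>.\<close>

definition pc :: "W \<Rightarrow> W \<Rightarrow> laurent" where
  "pc u w = co (kl_basis w) u"

lemma bar_kl_basis: "hecke_bar (kl_basis w) = kl_basis w"
  and pc_self [simp]: "pc w w = 1"
  and pc_le: "pc u w \<noteq> 0 \<Longrightarrow> u \<le>\<^sub>B w"
  and pc_neg: "u \<noteq> w \<Longrightarrow> 0 \<le> n \<Longrightarrow> Poly_Mapping.lookup (pc u w) n = 0"
  using is_klh_kl_basis[of w] by (auto simp: is_klh_def pc_def)

text \<open>After normalisation the exponent \<open>(l(w) - l(u) - 1)/2\<close> of \<open>q\<close>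
  is the exponent -1 of \<open>v\<close>, and an even length difference gives zero automatically. If
  \<open>u\<close> is not below \<open>w\<close>, the truncated difference in \<open>mu\<close>
  meets the zero polynomial.\<close>

lemma mu_eq: "mu u w = Poly_Mapping.lookup (pc u w) (-1)"
proof -
  have fam: "is_kl_family w (\<lambda>u. kl_poly u w)" by (rule is_kl_family_kl_poly)
  consider "u = w" | "\<not> u \<le>\<^sub>B w" | "u \<le>\<^sub>B w" "len u < len w" using bruhat_le_len by blast
  then show ?thesis
  proof cases
    case 1
    then show ?thesis by (simp add: mu_def lookup_one)
  next
    case 2
    then have "pc u w = 0" using pc_le by blast
    then show ?thesis using fam 2 by (simp add: mu_def is_kl_family_def)
  next
    case 3
    define d where "d = len w - len u"
    have d: "int (len w) = int (len u) + int d" "d > 0" using 3(2) by (simp_all add: d_def)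
    have "Poly_Mapping.lookup (pc u w) (-1) = Poly_Mapping.lookup (q_poly (kl_poly u w)) (int d - 1)"
      using 3(1) d(1) by (simp add: pc_def kl_basis_def co_kl_sum algebra_simps)
    also have "\<dots> = (if odd d then coeff (kl_poly u w) ((d - 1) div 2) else 0)"
    proof (cases "odd d")
      case True
      then obtain k where "d = 2 * k + 1" by (elim oddE)
      then show ?thesis by (simp add: lookup_q_poly)
    next
      case False
      then show ?thesis by (simp add: lookup_q_poly)
    qed
    finally show ?thesis by (simp add: mu_def d_def)
  qed
qed

lemma mu_nonzero_less: "mu u w \<noteq> 0 \<Longrightarrow> u \<le>\<^sub>B w \<and> len u < len w"
proof -
  assume "mu u w \<noteq> 0"
  then have "u \<noteq> w" "pc u w \<noteq> 0" by (auto simp: mu_eq lookup_one)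
  then show ?thesis using pc_le bruhat_le_len by blast
qed

lemma cop_kl_up:
  assumes "\<not> desc s y"
  shows "cop s (kl_basis y) = kl_basis (gen s * y) +
    (\<Sum>z\<in>{z. z \<le>\<^sub>B y \<and> z \<noteq> y \<and> desc s z}. scale (of_int (mu z y)) (kl_basis z))"
proof -
  have "is_klh (gen s * y) (cop s (kl_basis y) -
    (\<Sum>z\<in>{z. z \<le>\<^sub>B y \<and> z \<noteq> y \<and> desc s z}. scale (of_int (mu z y)) (kl_basis z)))"
    unfolding mu_eq pc_def by (rule is_klh_step[OF assms is_klh_kl_basis is_klh_kl_basis])
  from is_klh_unique[OF this is_klh_kl_basis] show ?thesis by (simp add: algebra_simps)
qed

text \<open>Every term of the recursion for \<open>C_w\<close> is an eigenvector:
  \<open>C_s C_y\<close> because of \<open>C_s C_s = eta C_s\<close>, the corrections by induction,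
  since they have \<open>s\<close> as a descent.\<close>

lemma cop_kl_down: "desc s w \<Longrightarrow> cop s (kl_basis w) = scale eta (kl_basis w)"
proof (induction "len w" arbitrary: w rule: less_induct)
  case less
  define y where "y = gen s * w"
  have w: "w = gen s * y" and nd: "\<not> desc s y" using less.prems by (simp_all add: y_def)
  let ?Z = "{z. z \<le>\<^sub>B y \<and> z \<noteq> y \<and> desc s z}"
  have C: "kl_basis w = cop s (kl_basis y) - (\<Sum>z\<in>?Z. scale (of_int (mu z y)) (kl_basis z))"
    using cop_kl_up[OF nd] by (simp add: w)
  have "cop s (scale (of_int (mu z y)) (kl_basis z)) = scale eta (scale (of_int (mu z y)) (kl_basis z))"
    if "z \<in> ?Z" for z
  proof -
    have "len z < len w" using that bruhat_le_len[of z y] len_not_desc[OF nd] w by auto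
    then show ?thesis using less.hyps[of z] that by (simp add: semilinD[OF lin_cop] mult.commute)
  qed
  then have "(\<Sum>z\<in>?Z. cop s (scale (of_int (mu z y)) (kl_basis z))) =
    (\<Sum>z\<in>?Z. scale eta (scale (of_int (mu z y)) (kl_basis z)))" by (rule sum.cong[OF refl])
  then show ?case unfolding C
    by (simp only: semilinD(5,6)[OF lin_cop] cop_cop hecke.scale_right_diff_distrib hecke.scale_sum_right)
qed

lemma pc_desc:
  assumes "desc s w" "\<not> desc s u"
  shows "pc u w = half_q_pow (-1) * pc (gen s * u) w"
proof -
  have "co (cop s (kl_basis w)) u = eta * co (kl_basis w) u" using cop_kl_down[OF assms(1)] by simp
  then have "pc (gen s * u) w = half_q_pow 1 * pc u w"
    using assms(2) by (simp add: co_cop pc_def eta_def ring_distribs)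
  then show ?thesis by (simp add: half_q_pow_add_left)
qed

text \<open>By \<open>pc_desc\<close> the coefficient at exponent -1 is the constant term of
  \<open>pc (gen s * u) w\<close>, which is nonzero only on the diagonal.\<close>

lemma mu_desc:
  assumes "desc s w" "\<not> desc s u"
  shows "mu u w = (if gen s * u = w then 1 else 0)"
  using pc_neg[of "gen s * u" w 0] by (auto simp: mu_eq pc_desc[OF assms])

lemma mu_gen: "\<not> desc s u \<Longrightarrow> mu u (gen s * u) = 1"
  using mu_desc[of s "gen s * u" u] by simp

subsection \<open>Inversion symmetry\<close>

lemma flat_gen_inv_flat_commute: "gen_inv s (flat (gen_inv t (flat h))) = flat (gen_inv t (flat (gen_inv s h)))"
proof -
  have 1: "gen_inv s (rgen_mult t g) = rgen_mult t (gen_inv s g)" for g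
    by (metis gen_inv_gen_mult gen_mult_rgen_mult)
  have 2: "rgen_mult t (flat (gen_inv t (flat g))) = g" "flat (gen_inv t (flat (rgen_mult t g))) = g" for g
    by (simp_all add: rgen_mult_def)
  show ?thesis by (metis 1 2)
qed

lemma T_bar_inverse: "T_bar (inverse w) = flat (T_bar w)"
proof -
  obtain xs where xs: "word xs = w" "reduced xs" by (rule reduced_wordE)
  define R where "R s h = flat (gen_inv s (flat h))" for s h
  have R1: "R s (T_basis 1) = gen_inv s (T_basis 1)" for s
    by (simp add: R_def gen_inv_def semilinD[OF lin_flat] gen_mult_T)
  have RC: "foldr gen_inv zs (R s h) = R s (foldr gen_inv zs h)" for zs s h
    by (induction zs) (simp_all add: R_def flat_gen_inv_flat_commute)
  have "flat (foldr gen_inv ys (T_basis 1)) = foldr gen_inv (rev ys) (T_basis 1)" for ys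
  proof (induction ys)
    case (Cons s ys)
    have "flat (foldr gen_inv (s # ys) (T_basis 1)) = R s (flat (foldr gen_inv ys (T_basis 1)))"
      by (simp add: R_def)
    also have "\<dots> = foldr gen_inv (rev ys) (gen_inv s (T_basis 1))"
      by (simp only: Cons RC[symmetric] R1)
    finally show ?case by simp
  qed simp
  moreover have "reduced (rev xs)" using xs(2) reduced_rev by blast
  ultimately show ?thesis using T_bar_eq[OF xs(2)] T_bar_eq[of "rev xs"] inverse_word[of xs] xs(1) by simp
qed

lemma bar_flat: "hecke_bar (flat h) = flat (hecke_bar h)"
  by (rule semilin_eqI[OF lin_comp[OF semilin_bar lin_flat] lin_comp_semilin[OF lin_flat semilin_bar]])
    (simp add: bar_T T_bar_inverse)

lemma flat_kl_basis: "flat (kl_basis w) = kl_basis (inverse w)"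
proof -
  have "u \<le>\<^sub>B inverse w" if "pc (inverse u) w \<noteq> 0" for u
    using bruhat_inverse[OF pc_le[OF that]] by simp
  moreover have "Poly_Mapping.lookup (pc (inverse u) w) n = 0" if "u \<noteq> inverse w" "0 \<le> n" for u n
    using that by (intro pc_neg) auto
  ultimately have "is_klh (inverse w) (flat (kl_basis w))"
    unfolding is_klh_def by (simp add: bar_flat bar_kl_basis pc_def[symmetric])
  then show ?thesis using is_klh_unique is_klh_kl_basis by blast
qed

lemma pc_inverse: "pc (inverse u) (inverse w) = pc u w"
  by (simp add: pc_def flat_kl_basis[symmetric])

lemma mu_inverse: "mu (inverse u) (inverse w) = mu u w"
  by (simp add: mu_eq pc_inverse)

section \<open>Right descents and right multiplication by \<open>C_s\<close>\<close>

abbreviation rdesc :: "simple \<Rightarrow> W \<Rightarrow> bool" where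
  "rdesc s w \<equiv> desc s (inverse w)"

lemma rdesc_def: "rdesc s w \<longleftrightarrow> len (w * gen s) < len w"
proof -
  have "len (gen s * inverse w) = len (w * gen s)" using len_inverse[of "w * gen s"] by simp
  then show ?thesis by (simp add: desc_def)
qed

lemma len_gen_right_cases: "len (w * gen s) = len w + 1 \<or> len w = len (w * gen s) + 1"
  using len_gen_cases[of s "inverse w"] len_inverse[of "w * gen s"] by simp

lemma mu_rdesc:
  assumes "rdesc s w" "\<not> rdesc s u"
  shows "mu u w = (if u * gen s = w then 1 else 0)"
proof -
  have "gen s * inverse u = inverse w \<longleftrightarrow> u * gen s = w"
    by (metis inverse_eq_iff_W inverse_gen inverse_inverse_W inverse_times_W)
  then show ?thesis using mu_desc[OF assms] mu_inverse by simp
qed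

definition rop :: "simple \<Rightarrow> hecke \<Rightarrow> hecke" where
  "rop s h = flat (cop s (flat h))"

lemma lin_rop: "lin (rop s)"
  unfolding rop_def using lin_comp[OF lin_flat lin_comp[OF lin_cop lin_flat]] .

lemma rop_eq: "rop s h = scale (half_q_pow (-1)) (rgen_mult s h + h)"
  by (simp add: rop_def cop_def rgen_mult_def semilinD[OF lin_flat])

lemma lin_rgen_mult: "lin (rgen_mult s)"
  unfolding rgen_mult_def using lin_comp[OF lin_flat lin_comp[OF lin_gen_mult lin_flat]] .

lemma cop_rop: "cop s (rop t h) = rop t (cop s h)"
  by (simp add: rop_eq cop_def gen_mult_simps semilinD[OF lin_rgen_mult] gen_mult_rgen_mult
      hecke.scale_right_distrib add_ac)

lemma rop_kl_down: "rdesc s w \<Longrightarrow> rop s (kl_basis w) = scale eta (kl_basis w)"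
  by (simp add: rop_def flat_kl_basis cop_kl_down semilinD[OF lin_flat])

subsection \<open>Coordinates with respect to the Kazhdan-Lusztig basis\<close>

lemma hecke_eq_sum: "(\<Sum>w\<in>Poly_Mapping.keys h. scale (Poly_Mapping.lookup h w) (T_basis w)) = h"
  unfolding single_eq_scale[symmetric]
  by (rule poly_mapping_eqI) (auto simp: lookup_sum lookup_single when_def in_keys_iff)

definition kl_comb :: "hecke \<Rightarrow> hecke" where
  "kl_comb h = (\<Sum>z\<in>Poly_Mapping.keys h. scale (Poly_Mapping.lookup h z) (kl_basis z))"

lemma lin_kl_comb: "lin kl_comb"
proof -
  have "lin (\<lambda>h. kl_comb h)"
    unfolding kl_comb_def by (rule semilin_ext[OF hecke.module_axioms]) simp_all
  then show ?thesis .
qed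

lemma kl_comb_T_basis: "kl_comb (T_basis w) = kl_basis w"
  unfolding kl_comb_def by (rule semilin_ext_T_basis[OF hecke.module_axioms, of "\<lambda>a. a"]) simp

lemma lookup_kl_basis: "Poly_Mapping.lookup (kl_basis w) u = half_q_pow (- int (len u)) * pc u w"
  by (simp add: pc_def co_def half_q_pow_add_left)

lemma lookup_kl_comb_longest:
  assumes "\<And>x. x \<in> Poly_Mapping.keys h \<Longrightarrow> len x \<le> len w"
  shows "Poly_Mapping.lookup (kl_comb h) w = half_q_pow (- int (len w)) * Poly_Mapping.lookup h w"
proof -
  have "Poly_Mapping.lookup (kl_comb h) w =
    (\<Sum>z\<in>Poly_Mapping.keys h. Poly_Mapping.lookup h z * Poly_Mapping.lookup (kl_basis z) w)"
    by (simp add: kl_comb_def lookup_sum)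
  also have "\<dots> = (\<Sum>z\<in>Poly_Mapping.keys h. if z = w then half_q_pow (- int (len w)) * Poly_Mapping.lookup h w else 0)"
  proof (rule sum.cong[OF refl])
    fix z assume z: "z \<in> Poly_Mapping.keys h"
    show "Poly_Mapping.lookup h z * Poly_Mapping.lookup (kl_basis z) w =
      (if z = w then half_q_pow (- int (len w)) * Poly_Mapping.lookup h w else 0)"
    proof (cases "z = w")
      case False
      then have "pc w z = 0" using pc_le[of w z] bruhat_le_len[of w z] assms[OF z] by auto
      then show ?thesis using False by (simp add: lookup_kl_basis)
    qed (simp add: lookup_kl_basis)
  qed
  also have "\<dots> = half_q_pow (- int (len w)) * Poly_Mapping.lookup h w"
    by (cases "w \<in> Poly_Mapping.keys h") (auto simp: in_keys_iff)
  finally show ?thesis .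
qed

text \<open>The change of basis is triangular with respect to length and has powers of
  \<open>v\<close> on the diagonal: a longest element of the support proves injectivity, induction
  on length surjectivity.\<close>

lemma kl_comb_bij: "bij kl_comb"
proof (rule bijI)
  show "inj kl_comb"
  proof (rule injI)
    fix g h assume "kl_comb g = kl_comb h"
    define D where "D = g - h"
    have 0: "kl_comb D = 0" using \<open>kl_comb g = kl_comb h\<close> by (simp add: D_def semilinD[OF lin_kl_comb])
    have "D = 0"
    proof (rule ccontr)
      assume "D \<noteq> 0"
      then have "Poly_Mapping.keys D \<noteq> {}" by simp
      then obtain w where w: "w \<in> Poly_Mapping.keys D" "\<forall>x\<in>Poly_Mapping.keys D. len x \<le> len w"
        using finite_has_longest[OF finite_keys] by blast
      then have "Poly_Mapping.lookup D w = 0" using lookup_kl_comb_longest[of D w] 0 by simp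
      then show False using w(1) by (simp add: in_keys_iff)
    qed
    then have "g - h = 0" by (simp add: D_def)
    then show "g = h" by simp
  qed
  have T: "\<exists>g. kl_comb g = T_basis w" for w
  proof (induction "len w" arbitrary: w rule: less_induct)
    case less
    define D where "D = T_basis w - scale (half_q_pow (int (len w))) (kl_basis w)"
    have len: "len u < len w" if "u \<in> Poly_Mapping.keys D" for u
    proof -
      have "Poly_Mapping.lookup D w = 0"
        by (simp add: D_def lookup_minus lookup_T_basis lookup_kl_basis half_q_pow_add)
      then have "u \<noteq> w" using that by (metis in_keys_iff)
      then have "pc u w \<noteq> 0"
        using that by (simp add: D_def in_keys_iff lookup_minus lookup_T_basis lookup_kl_basis)
      then show ?thesis using pc_le bruhat_le_len \<open>u \<noteq> w\<close> by blast
    qed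
    then have "\<forall>u\<in>Poly_Mapping.keys D. \<exists>g. kl_comb g = T_basis u" using less by blast
    then obtain G where G: "\<And>u. u \<in> Poly_Mapping.keys D \<Longrightarrow> kl_comb (G u) = T_basis u" by metis
    have "kl_comb (\<Sum>u\<in>Poly_Mapping.keys D. scale (Poly_Mapping.lookup D u) (G u)) =
      (\<Sum>u\<in>Poly_Mapping.keys D. scale (Poly_Mapping.lookup D u) (T_basis u))"
      unfolding semilinD[OF lin_kl_comb] by (rule sum.cong) (simp_all add: G semilinD[OF lin_kl_comb])
    also have "\<dots> = D"
      by (rule hecke_eq_sum)
    finally have "kl_comb ((\<Sum>u\<in>Poly_Mapping.keys D. scale (Poly_Mapping.lookup D u) (G u)) +
      scale (half_q_pow (int (len w))) (T_basis w)) = T_basis w"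
      by (simp add: semilinD(1,2)[OF lin_kl_comb] kl_comb_T_basis D_def)
    then show ?case by blast
  qed
  show "surj kl_comb"
  proof (rule surjI)
    show "kl_comb (\<Sum>w\<in>Poly_Mapping.keys h. scale (Poly_Mapping.lookup h w) (SOME g. kl_comb g = T_basis w)) = h" for h
    proof -
      have *: "kl_comb (SOME g. kl_comb g = T_basis w) = T_basis w" for w
        using T by (rule someI_ex)
      show ?thesis unfolding semilinD[OF lin_kl_comb] *
        by (rule hecke_eq_sum)
    qed
  qed
qed

definition kc :: "hecke \<Rightarrow> hecke" where
  "kc = inv kl_comb"

lemma kl_comb_kc [simp]: "kl_comb (kc h) = h"
  and kc_kl_comb [simp]: "kc (kl_comb h) = h"
  using kl_comb_bij unfolding kc_def by (simp_all add: bij_is_surj surj_f_inv_f bij_is_inj)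

lemma lin_kc: "lin kc"
  unfolding semilin_def by (metis kc_kl_comb kl_comb_kc semilinD(1,2)[OF lin_kl_comb])

lemma kc_kl_basis [simp]: "kc (kl_basis w) = T_basis w"
  by (metis kc_kl_comb kl_comb_T_basis)

lemmas kc_simps = semilinD[OF lin_kc]

text \<open>The product rule as a function on all of \<open>W\<close>: the summation over a Bruhat
  interval disappears because \<open>mu z y\<close> vanishes outside it.\<close>

lemma lookup_kc_cop_kl:
  "Poly_Mapping.lookup (kc (cop s (kl_basis y))) z =
    (if desc s y then (if z = y then eta else 0)
     else (if z = gen s * y then 1 else 0) + (if desc s z then of_int (mu z y) else 0))"
proof (cases "desc s y")
  case True
  then show ?thesis by (simp add: cop_kl_down kc_simps lookup_T_basis)
next
  case False
  have "(\<Sum>x\<in>{z. z \<le>\<^sub>B y \<and> z \<noteq> y \<and> desc s z}. (of_int (mu x y) :: laurent) * (if z = x then 1 else 0)) =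
    (if z \<in> {z. z \<le>\<^sub>B y \<and> z \<noteq> y \<and> desc s z} then of_int (mu z y) else 0)"
    by (simp add: if_distrib cong: if_cong)
  also have "\<dots> = (if desc s z then of_int (mu z y) else 0)"
    using mu_nonzero_less[of z y] by (cases "mu z y = 0") auto
  finally show ?thesis using False
    by (simp add: cop_kl_up kc_simps lookup_add lookup_sum lookup_T_basis)
qed

lemma lookup_kc_flat: "Poly_Mapping.lookup (kc (flat h)) z = Poly_Mapping.lookup (kc h) (inverse z)"
proof -
  have "kc (flat h) = flat (kc h)"
  proof -
    have "kl_comb (flat g) = flat (kl_comb g)" for g
      by (rule semilin_eqI[OF lin_comp[OF lin_kl_comb lin_flat] lin_comp[OF lin_flat lin_kl_comb]])
        (simp add: kl_comb_T_basis flat_kl_basis)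
    then show ?thesis by (metis kc_kl_comb kl_comb_kc)
  qed
  then show ?thesis by simp
qed

lemma lookup_kc_rop_kl:
  "Poly_Mapping.lookup (kc (rop s (kl_basis y))) z =
    (if rdesc s y then (if z = y then eta else 0)
     else (if z = y * gen s then 1 else 0) + (if rdesc s z then of_int (mu z y) else 0))"
proof -
  have "inverse z = gen s * inverse y \<longleftrightarrow> z = y * gen s"
    by (metis inverse_eq_iff_W inverse_gen inverse_inverse_W inverse_times_W)
  then show ?thesis by (simp add: rop_def lookup_kc_flat flat_kl_basis lookup_kc_cop_kl mu_inverse)
qed

lemma lookup_kc_lin:
  assumes "lin F"
  shows "Poly_Mapping.lookup (kc (F h)) x =
    (\<Sum>z\<in>Poly_Mapping.keys (kc h). Poly_Mapping.lookup (kc h) z * Poly_Mapping.lookup (kc (F (kl_basis z))) x)"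
proof -
  have "F h = F (kl_comb (kc h))" by simp
  also have "\<dots> = (\<Sum>z\<in>Poly_Mapping.keys (kc h). scale (Poly_Mapping.lookup (kc h) z) (F (kl_basis z)))"
    unfolding kl_comb_def[of "kc h"] semilinD[OF assms] ..
  finally show ?thesis by (simp add: kc_simps lookup_sum)
qed

subsection \<open>The $a$-function on elements with a long braid factor\<close>

definition braid4 :: "simple \<Rightarrow> W \<Rightarrow> W" where
  "braid4 s y = gen Ss * (gen s * (gen Ss * (gen s * y)))"

text \<open>Elements with a reduced expression through the longest element, of length four, of the
  group generated by \<open>s\<close> and \<open>Ss\<close>. The name alludes to the lowest
  two-sided cell.\<close>

definition lowest :: "W set" where
  "lowest = {w. \<exists>x s y. s \<noteq> Ss \<and> w = x * braid4 s y \<and> len w = len x + 4 + len y}"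

lemma kl_structure_eq: "kl_structure x y = kc (hecke_mult (kl_basis x) (kl_basis y))"
proof -
  have "(THE h. hecke_mult (kl_basis x) (kl_basis y) = kl_comb h) = kc (hecke_mult (kl_basis x) (kl_basis y))"
    by (rule the_equality) (metis kl_comb_kc, metis kc_kl_comb)
  then show ?thesis by (simp add: kl_structure_def kl_comb_def)
qed

lemma hecke_mult_assoc_gen: "hecke_mult h (gen_mult s h') = hecke_mult (rgen_mult s h) h'"
proof -
  have T1: "gen_mult s (T_basis 1) = rgen_mult s (T_basis 1)"
    by (simp add: rgen_mult_def gen_mult_T)
  have r: "hecke_mult g (right_op ys g') = right_op ys (hecke_mult g g')" for g ys g'
  proof (induction ys)
    case (Cons t ys)
    have "hecke_mult g (rgen_mult t (right_op ys g')) = rgen_mult t (right_op ys (hecke_mult g g'))"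
      by (simp add: hecke_mult_rgen_mult Cons)
    then show ?case by (simp add: rgen_mult_def right_op_def)
  qed (simp add: right_op_def)
  show ?thesis
  proof (rule semilin_eqI[OF lin_comp[OF lin_hecke_mult_right lin_gen_mult] lin_hecke_mult_right])
    fix y
    obtain zs where "word zs = inverse y" "reduced zs" by (rule reduced_wordE)
    then have y: "T_basis y = right_op zs (T_basis 1)" using right_op_one[of zs] by simp
    show "hecke_mult h (gen_mult s (T_basis y)) = hecke_mult (rgen_mult s h) (T_basis y)"
      unfolding y gen_mult_right_op r T1 hecke_mult_rgen_mult by simp
  qed
qed

lemma rgen_mult_kl: "rdesc s w \<Longrightarrow> rgen_mult s (kl_basis w) = scale (half_q_pow 2) (kl_basis w)"
proof -
  assume "rdesc s w"
  then have "scale (half_q_pow (-1)) (rgen_mult s (kl_basis w) + kl_basis w) = scale eta (kl_basis w)"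
    using rop_kl_down rop_eq by metis
  then have "scale (half_q_pow 1) (scale (half_q_pow (-1)) (rgen_mult s (kl_basis w) + kl_basis w)) =
    scale (half_q_pow 1) (scale eta (kl_basis w))" by simp
  then have "rgen_mult s (kl_basis w) + kl_basis w = scale (half_q_pow 2 + 1) (kl_basis w)"
    by (simp add: half_q_pow_add eta_def ring_distribs del: hecke.scale_left_distrib)
  then show ?thesis by (simp add: hecke.scale_left_distrib)
qed

lemma hecke_mult_kl_gen:
  assumes "rdesc s x" "desc s c"
  shows "hecke_mult (kl_basis x) (T_basis c) = scale (half_q_pow 2) (hecke_mult (kl_basis x) (T_basis (gen s * c)))"
proof -
  have "T_basis c = gen_mult s (T_basis (gen s * c))" using assms(2) by (simp add: gen_mult_T)
  then show ?thesis
    by (simp add: hecke_mult_assoc_gen rgen_mult_kl[OF assms(1)] semilinD[OF lin_hecke_mult_left])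
qed

lemma len_braid4_up:
  assumes "s \<noteq> Ss" "\<not> desc Ss c" "\<not> desc s c"
  shows "len (braid4 s c) = 4 + len c"
proof -
  obtain a b d where p: "pt c = (a, b, d)" by (metis prod_cases3)
  have ne: "height Ss (pt c) > 0" "height s (pt c) > 0" using assms not_desc_height by blast+
  have "\<not> desc Ss (gen s * c)" "\<not> desc s (gen Ss * (gen s * c))"
    "\<not> desc Ss (gen s * (gen Ss * (gen s * c)))"
    using ne assms(1) p by (cases s; auto simp: desc_iff_height)+
  then show ?thesis using assms(3) by (simp add: braid4_def len_not_desc)
qed

text \<open>Since \<open>C_x T_a = q C_x\<close> for both letters \<open>a\<close>, the part of
  \<open>c\<close> in the dihedral group comes out as a power of \<open>q\<close>. The last clause
  holds because by the lifting property stripping such a letter stays below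
  \<open>w\<close>.\<close>

lemma hecke_mult_kl_strip:
  assumes "s \<noteq> Ss" "rdesc Ss x" "rdesc s x"
  shows "\<exists>c' k. len c = k + len c' \<and> \<not> desc Ss c' \<and> \<not> desc s c' \<and>
    hecke_mult (kl_basis x) (T_basis c) = scale (half_q_pow (2 * int k)) (hecke_mult (kl_basis x) (T_basis c')) \<and>
    (\<forall>w. desc Ss w \<longrightarrow> desc s w \<longrightarrow> c \<le>\<^sub>B w \<longrightarrow> c' \<le>\<^sub>B w)"
proof (induction "len c" arbitrary: c rule: less_induct)
  case less
  show ?case
  proof (cases "desc Ss c \<or> desc s c")
    case False
    then show ?thesis by (intro exI[of _ c] exI[of _ 0]) simp
  next
    case True
    then obtain a where a: "desc a c" "a \<in> {Ss, s}" by blast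
    have l: "len c = Suc (len (gen a * c))" by (rule len_desc[OF a(1)])
    obtain c' k where IH: "len (gen a * c) = k + len c'" "\<not> desc Ss c'" "\<not> desc s c'"
      "hecke_mult (kl_basis x) (T_basis (gen a * c)) = scale (half_q_pow (2 * int k)) (hecke_mult (kl_basis x) (T_basis c'))"
      "\<And>w. desc Ss w \<Longrightarrow> desc s w \<Longrightarrow> gen a * c \<le>\<^sub>B w \<Longrightarrow> c' \<le>\<^sub>B w"
      using less[of "gen a * c"] l by auto
    have "hecke_mult (kl_basis x) (T_basis c) =
      scale (half_q_pow (2 * int (Suc k))) (hecke_mult (kl_basis x) (T_basis c'))"
      using hecke_mult_kl_gen[of a x c] a assms IH(4) by (auto simp: half_q_pow_add)
    moreover have "c' \<le>\<^sub>B w" if "desc Ss w" "desc s w" "c \<le>\<^sub>B w" for w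
      using that a IH(5)[of w] bruhat_lift[of c w a] by auto
    ultimately show ?thesis using IH l by (intro exI[of _ c'] exI[of _ "Suc k"]) auto
  qed
qed

definition supported_le :: "hecke \<Rightarrow> nat \<Rightarrow> W \<Rightarrow> bool" where
  "supported_le g m w \<longleftrightarrow> (\<forall>u. Poly_Mapping.lookup g u \<noteq> 0 \<longrightarrow> len u < m \<or> (len u = m \<and> u = w))"

lemma supported_le_rgen_mult:
  assumes "supported_le g m w"
  shows "supported_le (rgen_mult s g) (Suc m) (w * gen s)"
  unfolding supported_le_def
proof (intro allI impI)
  fix u assume ne: "Poly_Mapping.lookup (rgen_mult s g) u \<noteq> 0"
  have g0: "Poly_Mapping.lookup g x = 0" if "m < len x \<or> (len x = m \<and> x \<noteq> w)" for x
    using assms that unfolding supported_le_def by force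
  have l: "len (u * gen s) + 1 = len u \<or> len (u * gen s) = len u + 1"
    using len_gen_right_cases[of u s] by auto
  have eq: "u * gen s = w \<longleftrightarrow> u = w * gen s" by (rule mult_gen_eq_iff)
  show "len u < Suc m \<or> (len u = Suc m \<and> u = w * gen s)"
  proof (rule ccontr)
    assume *: "\<not> (len u < Suc m \<or> (len u = Suc m \<and> u = w * gen s))"
    then have "Poly_Mapping.lookup g u = 0" by (intro g0) auto
    moreover have "Poly_Mapping.lookup g (u * gen s) = 0" using * l eq by (intro g0) auto
    ultimately show False using ne by (simp add: lookup_rgen_mult split: if_splits)
  qed
qed

text \<open>Each right multiplication by a \<open>T_s\<close> raises lengths by at most one, and it
  preserves the top coefficient as long as the product is reduced.\<close>

lemma hecke_mult_T_word:
  assumes "supported_le g m w" "len w = m" "reduced xs"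
  shows "supported_le (hecke_mult g (T_basis (inverse (word xs)))) (m + length xs) (w * inverse (word xs)) \<and>
    (len (w * inverse (word xs)) = m + length xs \<longrightarrow>
      Poly_Mapping.lookup (hecke_mult g (T_basis (inverse (word xs)))) (w * inverse (word xs)) = Poly_Mapping.lookup g w)"
  using assms(3)
proof (induction xs)
  case Nil
  then show ?case using assms(1) by simp
next
  case (Cons s xs)
  have r: "reduced xs" "\<not> desc s (word xs)" using reduced_Cons[OF Cons.prems] by auto
  let ?y = "inverse (word xs)"
  have "T_basis (inverse (word (s # xs))) = rgen_mult s (T_basis ?y)"
    using r(2) by (simp add: rgen_mult_def gen_mult_T word_Cons)
  then have eq: "hecke_mult g (T_basis (inverse (word (s # xs)))) = rgen_mult s (hecke_mult g (T_basis ?y))"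
    by (simp add: hecke_mult_rgen_mult)
  have w: "w * inverse (word (s # xs)) = w * ?y * gen s" by (simp add: word_Cons mult.assoc)
  have IH: "supported_le (hecke_mult g (T_basis ?y)) (m + length xs) (w * ?y)"
    "len (w * ?y) = m + length xs \<Longrightarrow> Poly_Mapping.lookup (hecke_mult g (T_basis ?y)) (w * ?y) = Poly_Mapping.lookup g w"
    using Cons.IH[OF r(1)] by auto
  have "Poly_Mapping.lookup (rgen_mult s (hecke_mult g (T_basis ?y))) (w * ?y * gen s) = Poly_Mapping.lookup g w"
    if l: "len (w * ?y * gen s) = m + length (s # xs)"
  proof (cases "rdesc s (w * ?y * gen s)")
    case True
    then have "len (w * ?y) = m + length xs"
      using l True len_gen_right_cases[of "w * ?y" s] by (simp add: rdesc_def del: inverse_times_W)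
    moreover from this have "Poly_Mapping.lookup (hecke_mult g (T_basis ?y)) (w * ?y * gen s) = 0"
      using IH(1) l unfolding supported_le_def by fastforce
    ultimately show ?thesis using True IH(2) by (simp add: lookup_rgen_mult del: inverse_times_W)
  next
    case False
    then have "len (w * ?y * gen s) \<le> len (w * ?y)" by (simp add: rdesc_def not_less del: inverse_times_W)
    moreover have "len (w * ?y) \<le> m + length xs" using len_times_le[of w ?y] assms(2) r(1) by simp
    ultimately show ?thesis using l by simp
  qed
  then show ?case unfolding eq w using supported_le_rgen_mult[OF IH(1), of s] by simp
qed

lemma Inf_enat_mem: "Inf (A :: enat set) \<noteq> \<infinity> \<Longrightarrow> Inf A \<in> A"
  unfolding Inf_enat_def by (cases "A = {}") (auto intro: LeastI)

lemma a_fun_attained: "a_fun z = enat i \<Longrightarrow> Poly_Mapping.keys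
    (half_q_pow (- int i) * Poly_Mapping.lookup (kl_structure x y) z) \<subseteq> {..0}"
proof -
  assume a: "a_fun z = enat i"
  let ?S = "{enat i | i. \<forall>x y. Poly_Mapping.keys
    (half_q_pow (- int i) * Poly_Mapping.lookup (kl_structure x y) z) \<subseteq> {..0}}"
  have "Inf ?S = enat i" using a unfolding a_fun_def .
  then have "enat i \<in> ?S" using Inf_enat_mem[of ?S] by simp
  then show ?thesis by auto
qed

text \<open>Write \<open>z = x w_J y\<close> with \<open>w_J\<close> the longest element of the
  dihedral group, \<open>X = x w_J\<close> and \<open>Y = w_J y\<close>. Since
  \<open>C_X T_Y = q^4 C_X T_y\<close>, the coefficient of \<open>C_z\<close> in
  \<open>C_X C_Y\<close> contains \<open>v^4\<close>, so \<open>a(z)\<close> cannot be 2.\<close>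

theorem a_fun_lowest:
  assumes "z \<in> lowest"
  shows "a_fun z \<noteq> 2"
proof
  assume a2: "a_fun z = 2"
  obtain x s y where s: "s \<noteq> Ss" and z: "z = x * braid4 s y" and lz: "len z = len x + 4 + len y"
    using assms by (auto simp: lowest_def)
  define X where "X = x * braid4 s 1"
  define Y where "Y = braid4 s y"
  have zX: "z = X * y" by (simp add: z X_def braid4_def mult.assoc)
  have zY: "z = x * Y" by (simp add: z Y_def)
  have b4: "braid4 s u = word [Ss, s, Ss, s] * u" for u by (simp add: braid4_def word_Cons mult.assoc)
  have b4': "braid4 s u = word [s, Ss, s, Ss] * u" for u
    using gen_braid[OF s, of u] by (simp add: braid4_def word_Cons mult.assoc)
  have l4: "len (braid4 s u) \<le> 4 + len u" for u
    unfolding b4 using len_times_le[of "word [Ss, s, Ss, s]" u] len_word_le[of "[Ss, s, Ss, s]"] by simp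
  have lX: "len X = len x + 4"
  proof (rule antisym)
    show "len X \<le> len x + 4" unfolding X_def using len_times_le[of x "braid4 s 1"] l4[of 1] by simp
    show "len x + 4 \<le> len X" using len_times_le[of X y] lz zX by simp
  qed
  have lY: "len Y = 4 + len y"
  proof (rule antisym)
    show "len Y \<le> 4 + len y" unfolding Y_def by (rule l4)
    show "4 + len y \<le> len Y" using len_times_le[of x Y] lz zY by simp
  qed
  have rX: "rdesc Ss X" "rdesc s X"
  proof -
    have "X * gen s = x * word [Ss, s, Ss]" by (simp add: X_def b4 word_Cons mult.assoc)
    then show "rdesc s X" unfolding rdesc_def
      using len_times_le[of x "word [Ss, s, Ss]"] len_word_le[of "[Ss, s, Ss]"] lX by simp
    have "X * gen Ss = x * word [s, Ss, s]" by (simp add: X_def b4' word_Cons mult.assoc)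
    then show "rdesc Ss X" unfolding rdesc_def
      using len_times_le[of x "word [s, Ss, s]"] len_word_le[of "[s, Ss, s]"] lX by simp
  qed
  have dY: "desc Ss Y" "desc s Y"
  proof -
    have "gen Ss * Y = word [s, Ss, s] * y" by (simp add: Y_def b4 word_Cons mult.assoc)
    then show "desc Ss Y" unfolding desc_def
      using len_times_le[of "word [s, Ss, s]" y] len_word_le[of "[s, Ss, s]"] lY by simp
    have "gen s * Y = word [Ss, s, Ss] * y" by (simp add: Y_def b4' word_Cons mult.assoc)
    then show "desc s Y" unfolding desc_def
      using len_times_le[of "word [Ss, s, Ss]" y] len_word_le[of "[Ss, s, Ss]"] lY by simp
  qed
  define G where "G c = hecke_mult (kl_basis X) (T_basis c)" for c
  have suppX: "supported_le (kl_basis X) (len X) X"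
    unfolding supported_le_def lookup_kl_basis using pc_le bruhat_le_len by fastforce
  have G1: "supported_le (G c) (len X + len c) (X * c)" for c
  proof -
    obtain xs where "word xs = inverse c" "reduced xs" by (rule reduced_wordE)
    then show ?thesis using hecke_mult_T_word[OF suppX refl, of xs] by (simp add: G_def)
  qed
  have G2: "Poly_Mapping.lookup (G y) z = half_q_pow (- int (len X))"
  proof -
    obtain xs where "word xs = inverse y" "reduced xs" by (rule reduced_wordE)
    then show ?thesis using hecke_mult_T_word[OF suppX refl, of xs] zX lX lz
      by (simp add: G_def lookup_kl_basis)
  qed
  text \<open>\<open>c'\<close> is the shortest element of the coset \<open>W\<^sub>J c\<close>, where \<open>J\<close> consists of \<open>Ss\<close> and \<open>s\<close>.\<close>
  have strip: "\<exists>c' k. len c = k + len c' \<and> G c = scale (half_q_pow (2 * int k)) (G c') \<and>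
      (len c' < len y \<or> c' = y)" if "c \<le>\<^sub>B Y" for c
  proof -
    from hecke_mult_kl_strip[OF s rX, of c] obtain c' k where c': "len c = k + len c'"
      "\<not> desc Ss c'" "\<not> desc s c'"
      "hecke_mult (kl_basis X) (T_basis c) = scale (half_q_pow (2 * int k)) (hecke_mult (kl_basis X) (T_basis c'))"
      and le: "\<forall>w. desc Ss w \<longrightarrow> desc s w \<longrightarrow> c \<le>\<^sub>B w \<longrightarrow> c' \<le>\<^sub>B w"
      by (elim exE conjE)
    have "c' \<le>\<^sub>B Y" using le dY that by blast
    note c' = c'(1-3) c'(4)[folded G_def] this
    have "braid4 s c' \<le>\<^sub>B Y" unfolding braid4_def by (intro bruhat_lift c' dY)
    moreover have "len (braid4 s c') = 4 + len c'" using len_braid4_up[OF s] c' by blast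
    moreover have "braid4 s c' = Y \<Longrightarrow> c' = y" unfolding Y_def braid4_def by simp
    ultimately have "len c' < len y \<or> c' = y" using bruhat_le_len lY by fastforce
    then show ?thesis using c' by blast
  qed
  have topY: "G Y = scale (half_q_pow 8) (G y)"
  proof -
    let ?y1 = "gen s * y" let ?y2 = "gen Ss * ?y1" let ?y3 = "gen s * ?y2"
    have "len Y \<le> len ?y3 + 1" "len ?y3 \<le> len ?y2 + 1" "len ?y2 \<le> len ?y1 + 1" "len ?y1 \<le> len y + 1"
      unfolding Y_def braid4_def
      using len_gen_cases[of Ss ?y3] len_gen_cases[of s ?y2] len_gen_cases[of Ss ?y1] len_gen_cases[of s y]
      by linarith+
    then have d: "desc s ?y1" "desc Ss ?y2" "desc s ?y3"
      using lY by (simp_all add: desc_def)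
    show ?thesis
      using hecke_mult_kl_gen[OF rX(1) dY(1)] hecke_mult_kl_gen[OF rX(2) d(3)]
        hecke_mult_kl_gen[OF rX(1) d(2)] hecke_mult_kl_gen[OF rX(2) d(1)]
      by (simp add: G_def Y_def braid4_def half_q_pow_add)
  qed
  define P where "P = hecke_mult (kl_basis X) (kl_basis Y)"
  let ?K = "Poly_Mapping.keys (kl_basis Y)"
  have Psum: "P = (\<Sum>c\<in>?K. scale (Poly_Mapping.lookup (kl_basis Y) c) (G c))"
  proof -
    have "P = hecke_mult (kl_basis X) (\<Sum>c\<in>?K. scale (Poly_Mapping.lookup (kl_basis Y) c) (T_basis c))"
      unfolding P_def hecke_eq_sum ..
    then show ?thesis by (simp only: semilinD[OF lin_hecke_mult_right] G_def)
  qed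
  have KY: "c \<le>\<^sub>B Y" if "c \<in> ?K" for c
    using that pc_le[of c Y] by (auto simp: in_keys_iff lookup_kl_basis)
  have lzX: "len z = len X + len y" using lz lX by simp
  have supp: "supported_le P (len z) z"
    unfolding supported_le_def
  proof (intro allI impI)
    fix u assume "Poly_Mapping.lookup P u \<noteq> 0"
    then obtain c where c: "c \<in> ?K" "Poly_Mapping.lookup (G c) u \<noteq> 0"
      unfolding Psum lookup_sum by (auto elim!: sum.not_neutral_contains_not_neutral)
    obtain c' k where c': "G c = scale (half_q_pow (2 * int k)) (G c')" "len c' < len y \<or> c' = y"
      using strip[OF KY[OF c(1)]] by blast
    then have "Poly_Mapping.lookup (G c') u \<noteq> 0" using c(2) by auto
    then have "len u < len X + len c' \<or> (len u = len X + len c' \<and> u = X * c')"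
      using G1[of c'] unfolding supported_le_def by blast
    then show "len u < len z \<or> (len u = len z \<and> u = z)" using c'(2) lzX zX by auto
  qed
  \<comment> \<open>If \<open>c\<close> strips to \<open>y\<close> after \<open>k \<le> 4\<close>
    letters, its contribution is \<open>v^k\<close> times \<open>pc c Y\<close>, and for
    \<open>c \<noteq> Y\<close> the negative exponents of the latter keep it below
    \<open>v^4\<close>. If \<open>c\<close> strips to a shorter element, lengths exclude
    \<open>z\<close>.\<close>
  have summand: "Poly_Mapping.lookup (half_q_pow (int (len z)) *
      (Poly_Mapping.lookup (kl_basis Y) c * Poly_Mapping.lookup (G c) z)) 4 = (if c = Y then 1 else 0)"
    if c: "c \<in> ?K" for c
  proof (cases "c = Y")
    case True
    then show ?thesis
      by (simp add: topY G2 lookup_kl_basis half_q_pow_add half_q_pow_add_left lzX lY lookup_half_q_pow)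
  next
    case False
    obtain c' k where c': "len c = k + len c'" "G c = scale (half_q_pow (2 * int k)) (G c')"
      "len c' < len y \<or> c' = y"
      using strip[OF KY[OF c]] by blast
    show ?thesis
    proof (cases "c' = y")
      case True
      have "k \<le> 4" using bruhat_le_len[OF KY[OF c]] c'(1) True lY by auto
      have "half_q_pow (int (len z)) * (Poly_Mapping.lookup (kl_basis Y) c * Poly_Mapping.lookup (G c) z)
        = half_q_pow (int (len z)) * (half_q_pow (- int (len c)) * (half_q_pow (2 * int k) *
          (half_q_pow (- int (len X)) * pc c Y)))"
        by (simp add: c'(2) True G2 lookup_kl_basis mult_ac)
      also have "\<dots> = half_q_pow (int k) * pc c Y"
        by (simp add: half_q_pow_add_left lzX c'(1) True)
      finally show ?thesis using pc_neg[OF False, of "4 - int k"] \<open>k \<le> 4\<close> False by simp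
    next
      case nc: False
      then have l: "len c' < len y" using c'(3) by blast
      have "Poly_Mapping.lookup (G c') z = 0"
        using G1[of c'] l lzX unfolding supported_le_def by force
      then show ?thesis using False by (simp add: c'(2))
    qed
  qed
  have coefficient: "Poly_Mapping.lookup (half_q_pow (int (len z)) * Poly_Mapping.lookup P z) 4 = 1"
  proof -
    have "half_q_pow (int (len z)) * Poly_Mapping.lookup P z = (\<Sum>c\<in>?K. half_q_pow (int (len z)) *
      (Poly_Mapping.lookup (kl_basis Y) c * Poly_Mapping.lookup (G c) z))"
      by (simp add: Psum lookup_sum sum_distrib_left)
    then have "Poly_Mapping.lookup (half_q_pow (int (len z)) * Poly_Mapping.lookup P z) 4 =
      (\<Sum>c\<in>?K. if c = Y then 1 else 0)"
      by (simp only: lookup_sum) (rule sum.cong[OF refl summand])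
    moreover have "Y \<in> ?K" by (simp add: in_keys_iff lookup_kl_basis)
    ultimately show ?thesis by simp
  qed
  \<comment> \<open>No element longer than \<open>z\<close> occurs, so the coordinate at
    \<open>C_z\<close> can be read off the standard coefficient at \<open>z\<close>.\<close>
  have keys: "len x \<le> len z" if x: "x \<in> Poly_Mapping.keys (kc P)" for x
  proof -
    obtain w where w: "w \<in> Poly_Mapping.keys (kc P)" "\<forall>x\<in>Poly_Mapping.keys (kc P). len x \<le> len w"
      using finite_has_longest[OF finite_keys] x by blast
    then have "Poly_Mapping.lookup P w \<noteq> 0"
      using lookup_kl_comb_longest[of "kc P" w] by (simp add: in_keys_iff)
    then have "len w \<le> len z" using supp unfolding supported_le_def by force
    then show ?thesis using w(2) x by force
  qed
  have "Poly_Mapping.lookup P z = half_q_pow (- int (len z)) * Poly_Mapping.lookup (kc P) z"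
    using lookup_kl_comb_longest[of "kc P" z] keys by simp
  then have "Poly_Mapping.lookup (Poly_Mapping.lookup (kc P) z) 4 = 1"
    using coefficient by (simp add: half_q_pow_add_left)
  \<comment> \<open>The value tested is \<open>i = 2\<close>: the shift turns \<open>v^4\<close>
    into \<open>v^2\<close>, still a positive exponent.\<close>
  then have "2 \<in> Poly_Mapping.keys (half_q_pow (- int 2) * Poly_Mapping.lookup (kl_structure X Y) z)"
    by (simp add: kl_structure_eq P_def in_keys_iff)
  moreover have "a_fun z = enat 2" using a2 by (simp add: numeral_eq_enat)
  ultimately show False using a_fun_attained[of z 2 X Y] by auto
qed

section \<open>Cells and the elements with $a$-value two\<close>

lemma left_step_iff: "left_step x y \<longleftrightarrow> (mu x y \<noteq> 0 \<or> mu y x \<noteq> 0) \<and> (\<exists>s. desc s x \<and> \<not> desc s y)"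
  unfolding left_step_def joined_def left_descents_desc using mu_nonzero_less by blast

lemma left_stepE:
  assumes "left_step x y"
  obtains s where "desc s x" "\<not> desc s y" "x = gen s * y"
  | s where "desc s x" "\<not> desc s y" "mu x y \<noteq> 0"
proof -
  obtain s where s: "desc s x" "\<not> desc s y" "mu x y \<noteq> 0 \<or> mu y x \<noteq> 0"
    using assms unfolding left_step_iff by blast
  show thesis
  proof (cases "mu x y \<noteq> 0")
    case True
    then show ?thesis using s that(2) by blast
  next
    case False
    then have "gen s * y = x" using s mu_desc[OF s(1,2)] by (auto split: if_splits)
    then show ?thesis using s that(1) by blast
  qed
qed

lemma left_step_down: "\<not> desc s u \<Longrightarrow> left_step (gen s * u) u"
  unfolding left_step_iff using mu_gen[of s u] by (auto intro!: exI[of _ s])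

lemma left_step_up: "\<not> desc s u \<Longrightarrow> desc s' u \<Longrightarrow> \<not> desc s' (gen s * u) \<Longrightarrow> left_step u (gen s * u)"
  unfolding left_step_iff using mu_gen[of s u] by auto

lemma left_le_step: "left_step x y \<Longrightarrow> x \<le>\<^sub>L y"
  unfolding left_le_def by blast

lemma left_le_refl [simp]: "x \<le>\<^sub>L x"
  by (simp add: left_le_def)

lemma left_le_trans: "x \<le>\<^sub>L y \<Longrightarrow> y \<le>\<^sub>L z \<Longrightarrow> x \<le>\<^sub>L z"
  unfolding left_le_def by (rule rtranclp_trans)

lemma desc_extend_right: "desc s x \<Longrightarrow> len (x * y) = len x + len y \<Longrightarrow> desc s (x * y)"
  using len_times_le[of "gen s * x" y] by (simp add: desc_def mult.assoc)

text \<open>A left step by a generator lengthens the element and keeps right descents. In the other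
  case \<open>mu x y \<noteq> 0\<close>, and losing \<open>s\<close> would force
  \<open>y = x s\<close>; but then the left descents of \<open>x\<close> would persist in
  \<open>y\<close>.\<close>

lemma left_step_rdesc:
  assumes "left_step x y" "rdesc s y"
  shows "rdesc s x"
  using assms(1)
proof (cases rule: left_stepE)
  case (1 a)
  have "len (x * gen s) \<le> len (y * gen s) + 1"
    using len_gen_cases[of a "y * gen s"] unfolding 1(3) mult.assoc by linarith
  moreover have "len x = Suc (len y)" unfolding 1(3) by (rule len_not_desc[OF 1(2)])
  ultimately show ?thesis using assms(2) unfolding rdesc_def by linarith
next
  case (2 a)
  show ?thesis
  proof (rule ccontr)
    assume nd: "\<not> rdesc s x"
    then have y: "y = x * gen s" using mu_rdesc[OF assms(2) nd] 2(3) by (auto split: if_splits)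
    have "len (gen a * y) \<le> len (gen a * x) + 1"
      using len_gen_right_cases[of "gen a * x" s] unfolding y mult.assoc by linarith
    moreover have "len y = len x + 1" using nd len_gen_right_cases[of x s] unfolding y rdesc_def by linarith
    ultimately show False using 2(1,2) by (simp add: desc_def)
  qed
qed

lemma left_le_rdesc: "x \<le>\<^sub>L y \<Longrightarrow> rdesc s y \<Longrightarrow> rdesc s x"
  unfolding left_le_def by (induction rule: converse_rtranclp_induct) (auto dest: left_step_rdesc)

lemma left_cell_rdesc: "x \<sim>\<^sub>L y \<Longrightarrow> rdesc s x \<longleftrightarrow> rdesc s y"
  unfolding left_cell_eq_def using left_le_rdesc by blast

subsection \<open>Elements with a unique reduced expression\<close>

text \<open>Formulated through final segments of reduced expressions, so that the property passes to
  them directly; it says that at no point is there a choice of the next letter.\<close>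

definition single :: "W \<Rightarrow> bool" where
  "single w \<longleftrightarrow> (\<forall>x z s s'. w = x * z \<longrightarrow> len w = len x + len z \<longrightarrow> desc s z \<longrightarrow> desc s' z \<longrightarrow> s = s')"

lemma not_singleI:
  "w = x * z \<Longrightarrow> len w = len x + len z \<Longrightarrow> desc s z \<Longrightarrow> desc s' z \<Longrightarrow> s \<noteq> s' \<Longrightarrow> \<not> single w"
  unfolding single_def by blast

lemma single_desc: "single w \<Longrightarrow> desc s w \<Longrightarrow> desc s' w \<Longrightarrow> s = s'"
  unfolding single_def by (metis add_0 len_one mult_1_left)

lemma single_suffix: "single (x * z) \<Longrightarrow> len (x * z) = len x + len z \<Longrightarrow> single z"
  unfolding single_def
proof (intro allI impI)
  fix a b s s'
  assume *: "\<forall>xa za s s'. x * z = xa * za \<longrightarrow> len (x * z) = len xa + len za \<longrightarrow> desc s za \<longrightarrow> desc s' za \<longrightarrow> s = s'"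
    and l: "len (x * z) = len x + len z" "z = a * b" "len z = len a + len b" and d: "desc s b" "desc s' b"
  have "len (x * a) + len b \<ge> len (x * z)" using len_times_le[of "x * a" b] l(2) by (simp add: mult.assoc)
  moreover have "len (x * a) \<le> len x + len a" by (rule len_times_le)
  ultimately have "len (x * z) = len (x * a) + len b" using l by linarith
  moreover have "x * z = (x * a) * b" using l(2) by (simp add: mult.assoc)
  ultimately show "s = s'" using * d by blast
qed

lemma single_gen_suffix: "single (gen s * z) \<Longrightarrow> \<not> desc s z \<Longrightarrow> single z"
proof -
  assume *: "single (gen s * z)" "\<not> desc s z"
  have "len (gen s) = 1" using len_not_desc[of s 1] by simp
  then have "len (gen s * z) = len (gen s) + len z" using len_not_desc[OF *(2)] by simp
  then show ?thesis using *(1) single_suffix by blast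
qed

lemma gen_eq_iff [simp]: "gen a = gen b \<longleftrightarrow> a = b"
proof
  assume "gen a = gen b"
  then have "reflect a (pt 1) = reflect b (pt 1)" by (metis pt_gen)
  then show "a = b" by (cases a; cases b) auto
qed simp

text \<open>If \<open>mu x y \<noteq> 0\<close>, a left descent \<open>a\<close> of \<open>y\<close>
  is not the unique left descent of \<open>x\<close>, so \<open>y = a x\<close> by
  \<open>mu_desc\<close>. Hence \<open>y\<close> has at most one left descent, and its proper final
  segments are final segments of \<open>x\<close>.\<close>

lemma left_step_single:
  assumes "left_step x y" "single x"
  shows "single y"
  using assms(1)
proof (cases rule: left_stepE)
  case (1 s)
  then show ?thesis using single_gen_suffix assms(2) by blast
next
  case (2 s)
  have desc_y: "y = gen a * x \<and> \<not> desc a x" if "desc a y" for a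
  proof -
    have "a \<noteq> s" using that 2(2) by auto
    then have nd: "\<not> desc a x" using single_desc[OF assms(2) 2(1)] by blast
    then show ?thesis using mu_desc[OF that nd] 2(3) by (auto split: if_splits)
  qed
  show ?thesis unfolding single_def
  proof (intro allI impI)
    fix a b s1 s2
    assume y: "y = a * b" "len y = len a + len b" and d: "desc s1 b" "desc s2 b"
    show "s1 = s2"
    proof (cases "a = 1")
      case True
      then have "gen s1 * x = gen s2 * x" using desc_y d y by force
      then show ?thesis by simp
    next
      case False
      then obtain s3 where s3: "desc s3 a" using desc_exists by blast
      then have "desc s3 y" using desc_extend_right y by simp
      then have y3: "y = gen s3 * x" "\<not> desc s3 x" using desc_y by auto
      then have x: "x = (gen s3 * a) * b" using y(1) by (metis gen_gen_left mult.assoc)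
      have "len y = Suc (len x)" unfolding y3(1) by (rule len_not_desc[OF y3(2)])
      then have "len x = len (gen s3 * a) + len b" using y(2) len_desc[OF s3] by simp
      then show ?thesis using assms(2) x d unfolding single_def by blast
    qed
  qed
qed

lemma left_le_single: "x \<le>\<^sub>L y \<Longrightarrow> single x \<Longrightarrow> single y"
  unfolding left_le_def by (induction rule: rtranclp_induct) (auto dest: left_step_single)

text \<open>Letters are stripped from the left until one generator remains. If
  \<open>w = a w'\<close> and \<open>b\<close> is a descent of \<open>w'\<close>, then
  \<open>b\<close> is no descent of \<open>w\<close>, so there are left steps in both
  directions.\<close>

lemma single_left_cell_gen:
  assumes "single w" "w \<noteq> 1" "rdesc s w"
  shows "w \<sim>\<^sub>L gen s"
  using assms
proof (induction "len w" arbitrary: w rule: less_induct)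
  case less
  obtain a where a: "desc a w" using less.prems desc_exists by blast
  define w' where "w' = gen a * w"
  have w: "w = gen a * w'" and nd: "\<not> desc a w'" using a by (simp_all add: w'_def)
  show ?case
  proof (cases "w' = 1")
    case True
    then have "rdesc s (gen a)" using less.prems(3) w by simp
    then have "len (gen a * gen s) < 1" using len_gen_le[of a] unfolding rdesc_def by linarith
    then have "gen a * gen s = 1" by simp
    then have "gen s = gen a" using gen_mult_eq_iff[of a "gen s" 1] by simp
    then show ?thesis using True w by (simp add: left_cell_eq_def)
  next
    case False
    then obtain b where b: "desc b w'" using desc_exists by blast
    have "a \<noteq> b" using b nd by auto
    then have nb: "\<not> desc b w" using single_desc[OF less.prems(1) a] by blast
    \<comment> \<open>Otherwise \<open>w = w' s\<close>, and the descent \<open>b\<close> of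
      \<open>w'\<close> would survive in \<open>w\<close>.\<close>
    have rd: "rdesc s w'"
    proof (rule ccontr)
      assume n: "\<not> rdesc s w'"
      have eq: "w = w' * gen s"
        unfolding w by (rule rdesc_change, fold w) (use n less.prems(3) in blast)
      have "len w = len w' + 1" using len_not_desc[OF nd] w by simp
      moreover have "len (gen b * w) \<le> len (gen b * w') + 1"
        using len_gen_right_cases[of "gen b * w'" s] unfolding eq mult.assoc by linarith
      ultimately have "desc b w" using b by (simp add: desc_def)
      then show False using nb by simp
    qed
    have "single w'" using less.prems(1) single_gen_suffix nd w by blast
    moreover have "len w' < len w" using len_not_desc[OF nd] w by simp
    ultimately have IH: "w' \<sim>\<^sub>L gen s" using less.hyps False rd by blast
    have "left_step w w'" using left_step_down[OF nd] w by simp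
    moreover have "left_step w' w" using left_step_up[OF nd b] nb w by simp
    ultimately show ?thesis using IH left_le_trans left_le_step unfolding left_cell_eq_def by blast
  qed
qed

definition rt_type :: "W set" where
  "rt_type = {w. \<exists>x y. w = x * (gen Sr * (gen St * y)) \<and> len w = len x + 2 + len y}"

lemma braid4_word: "braid4 s y = word [Ss, s, Ss, s] * y"
  by (simp add: braid4_def word_Cons mult.assoc)

lemma braid4_word': "s \<noteq> Ss \<Longrightarrow> braid4 s y = word [s, Ss, s, Ss] * y"
  using gen_braid[of s y] by (simp add: braid4_def word_Cons mult.assoc)

lemma len_word_times_le: "len (word xs * y) \<le> length xs + len y"
  using len_times_le[of "word xs" y] len_word_le[of xs] by linarith

lemma two_desc_braid4:
  assumes "s \<noteq> Ss" "desc Ss z" "desc s z"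
  shows "\<exists>y. z = braid4 s y \<and> len z = 4 + len y"
proof -
  define y where "y = gen Ss * (gen s * (gen Ss * (gen s * z)))"
  have "braid4 s y = z" unfolding braid4_def gen_braid[OF assms(1)] by (simp add: y_def)
  moreover have "len z = 4 + len y" unfolding y_def by (rule two_desc[OF assms])
  ultimately show ?thesis by blast
qed

lemma lowestI:
  assumes "s \<noteq> Ss" "desc Ss z" "desc s z" "len (x * z) = len x + len z"
  shows "x * z \<in> lowest"
proof -
  obtain y where y: "z = braid4 s y" "len z = 4 + len y" using two_desc_braid4[OF assms(1-3)] by blast
  have "x * z = x * braid4 s y" unfolding y(1) ..
  moreover have "len (x * z) = len x + 4 + len y" unfolding assms(4) y(2) by simp
  ultimately show ?thesis using assms(1) unfolding lowest_def by blast
qed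

text \<open>Two left descents of a final segment generate a finite dihedral group whose longest
  element begins the segment: it has length four if \<open>Ss\<close> is one of them and is
  \<open>rt\<close> otherwise.\<close>

lemma not_single_cases:
  assumes "\<not> single w"
  shows "w \<in> lowest \<or> w \<in> rt_type"
proof -
  obtain x z s s' where w: "w = x * z" "len w = len x + len z" and d: "desc s z" "desc s' z" "s \<noteq> s'"
    using assms unfolding single_def by blast
  show ?thesis
  proof (cases "Ss \<in> {s, s'}")
    case True
    then show ?thesis using lowestI[of s z x] lowestI[of s' z x] d w by (cases "s = Ss") auto
  next
    case False
    then have "desc Sr z" "desc St z" using d by (cases s; cases s'; auto)+
    then have "len z = 2 + len (gen Sr * (gen St * z))" by (rule two_desc_rt)
    moreover define y where "y = gen Sr * (gen St * z)"
    ultimately have "w = x * (gen Sr * (gen St * y))" "len w = len x + 2 + len y"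
      using w by (simp_all add: gen_rt_left)
    then show ?thesis unfolding rt_type_def by blast
  qed
qed

lemma lowest_not_single: "w \<in> lowest \<Longrightarrow> \<not> single w"
proof -
  assume "w \<in> lowest"
  then obtain x s y where s: "s \<noteq> Ss" and w: "w = x * braid4 s y" "len w = len x + 4 + len y"
    by (auto simp: lowest_def)
  have l: "len (braid4 s y) = 4 + len y"
    using len_times_le[of x "braid4 s y"] len_word_times_le[of "[Ss, s, Ss, s]" y] w
    by (simp add: braid4_word)
  have "gen Ss * braid4 s y = word [s, Ss, s] * y" by (simp add: braid4_def word_Cons mult.assoc)
  then have d1: "desc Ss (braid4 s y)"
    using len_word_times_le[of "[s, Ss, s]" y] l by (simp add: desc_def)
  have "gen s * braid4 s y = word [Ss, s, Ss] * y" by (simp add: braid4_word'[OF s] word_Cons mult.assoc)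
  then have d2: "desc s (braid4 s y)"
    using len_word_times_le[of "[Ss, s, Ss]" y] l by (simp add: desc_def)
  show ?thesis using not_singleI[OF w(1) _ d1 d2] w(2) l s by simp
qed

lemma rt_type_not_single: "w \<in> rt_type \<Longrightarrow> \<not> single w"
proof -
  assume "w \<in> rt_type"
  then obtain x y where w: "w = x * (gen Sr * (gen St * y))" "len w = len x + 2 + len y"
    by (auto simp: rt_type_def)
  let ?z = "gen Sr * (gen St * y)"
  have l: "len ?z = 2 + len y"
    using len_times_le[of x ?z] len_word_times_le[of "[Sr, St]" y] w by (simp add: word_Cons mult.assoc)
  have "desc Sr ?z" using l len_gen_cases[of St y] by (auto simp: desc_def)
  moreover have "desc St ?z" using l len_gen_cases[of Sr y] by (auto simp: desc_def gen_rt_left)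
  ultimately show ?thesis using not_singleI[OF w(1), of Sr St] w(2) l by (simp del: desc_gen)
qed

lemma lowest_inverse: "w \<in> lowest \<Longrightarrow> inverse w \<in> lowest"
proof -
  assume "w \<in> lowest"
  then obtain x s y where s: "s \<noteq> Ss" and w: "w = x * braid4 s y" "len w = len x + 4 + len y"
    by (auto simp: lowest_def)
  have "word [Ss, s, Ss, s] = word [s, Ss, s, Ss]"
    using braid4_word[of s 1] braid4_word'[OF s, of 1] by simp
  then have "inverse w = inverse y * braid4 s (inverse x)"
    by (simp add: w(1) braid4_word inverse_word mult.assoc)
  moreover have "len (inverse w) = len (inverse y) + 4 + len (inverse x)" using w(2) by simp
  ultimately show ?thesis using s unfolding lowest_def by blast
qed

lemma rt_type_inverse: "w \<in> rt_type \<Longrightarrow> inverse w \<in> rt_type"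
proof -
  assume "w \<in> rt_type"
  then obtain x y where w: "w = x * (gen Sr * (gen St * y))" "len w = len x + 2 + len y"
    by (auto simp: rt_type_def)
  have "inverse w = inverse y * (gen Sr * (gen St * inverse x))"
    by (simp add: w(1) mult.assoc gen_rt_left)
  moreover have "len (inverse w) = len (inverse y) + 2 + len (inverse x)" using w(2) by simp
  ultimately show ?thesis unfolding rt_type_def by blast
qed

text \<open>The complement consists of \<open>lowest\<close> and \<open>rt_type\<close>, and both
  have visibly symmetric descriptions.\<close>

lemma single_inverse: "single w \<Longrightarrow> single (inverse w)"
  using not_single_cases[of "inverse w"] lowest_inverse[of "inverse w"] rt_type_inverse[of "inverse w"]
    lowest_not_single rt_type_not_single by auto

lemma single_right_cell:
  assumes "single u" "single w" "desc s u" "desc s w"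
  shows "u \<sim>\<^sub>R w"
proof -
  have "u \<noteq> 1" "w \<noteq> 1" using assms(3,4) by auto
  then have "inverse u \<noteq> 1" "inverse w \<noteq> 1" by (metis inverse_inverse_W inverse_one_W)+
  then have "inverse u \<sim>\<^sub>L gen s" "inverse w \<sim>\<^sub>L gen s"
    using assms single_inverse by (auto intro!: single_left_cell_gen)
  then show ?thesis unfolding right_cell_eq_def right_le_def left_cell_eq_def using left_le_trans by blast
qed

lemma lowest_extend: "z \<in> lowest \<Longrightarrow> len (x * z) = len x + len z \<Longrightarrow> x * z \<in> lowest"
proof -
  assume "z \<in> lowest" and l: "len (x * z) = len x + len z"
  then obtain a s y where s: "s \<noteq> Ss" and z: "z = a * braid4 s y" "len z = len a + 4 + len y"
    by (auto simp: lowest_def)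
  have "len (x * z) \<le> len (x * a) + len (braid4 s y)"
    using len_times_le[of "x * a" "braid4 s y"] by (simp add: z mult.assoc)
  moreover have "len (braid4 s y) \<le> 4 + len y"
    using len_word_times_le[of "[Ss, s, Ss, s]" y] by (simp add: braid4_word)
  ultimately have "len (x * z) = len (x * a) + 4 + len y" using len_times_le[of x a] l z(2) by linarith
  then show ?thesis using s unfolding lowest_def
    by (intro CollectI exI[of _ "x * a"] exI[of _ s] exI[of _ y]) (simp add: z(1) mult.assoc)
qed

subsection \<open>The elements $u\, rt(srt)^m\, v$\<close>

fun core :: "nat \<Rightarrow> W \<Rightarrow> W" where
  "core 0 v = gen Sr * (gen St * v)"
| "core (Suc m) v = gen Sr * (gen St * (gen Ss * core m v))"

definition ends :: "simple list set" where
  "ends = {[], [Ss], [St, Ss], [Sr, Ss]}"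

text \<open>The right end is recorded by its inverse: one set \<open>ends\<close> serves both sides,
  and inversion exchanges \<alpha> and \<beta>.\<close>

definition fam :: "simple list \<Rightarrow> nat \<Rightarrow> simple list \<Rightarrow> W" where
  "fam \<alpha> m \<beta> = word \<alpha> * core m (inverse (word \<beta>))"

lemma core_eq: "core m v = core m 1 * v"
  by (induction m) (simp_all add: mult.assoc)

lemma pt_gen_one: "pt (gen s) = reflect s (1, 1, 1)"
  using pt_gen[of s 1] by simp

lemma ends_cases:
  assumes "\<beta> \<in> ends"
  obtains "\<beta> = []" | "\<beta> = [Ss]" | "\<beta> = [St, Ss]" | "\<beta> = [Sr, Ss]"
  using assms by (auto simp: ends_def)

text \<open>These alcoves stay close to a diagonal. The bound 2 keeps \<open>3 + b - c\<close> and
  \<open>3 + c - b\<close> positive; these are the heights at \<open>s\<close> after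
  \<open>ts\<close> and \<open>rs\<close>, so \<open>s\<close> is no descent there.\<close>

lemma pt_core:
  assumes "\<beta> \<in> ends"
  shows "\<exists>b c. pt (core m (inverse (word \<beta>))) = (3 - b - c, b, c) \<and> b < 0 \<and> c < 0 \<and> \<bar>b - c\<bar> \<le> 2"
proof (induction m)
  case 0
  from assms show ?case by (cases rule: ends_cases) (simp_all add: word_Cons pt_gen_one)
next
  case (Suc m)
  then obtain b c where *: "pt (core m (inverse (word \<beta>))) = (3 - b - c, b, c)"
    "b < 0" "c < 0" "\<bar>b - c\<bar> \<le> 2" by blast
  show ?case by (rule exI[of _ "c - 3"], rule exI[of _ "b - 3"]) (use * in auto)
qed

lemma desc_fam:
  assumes "\<alpha> \<in> ends" "\<beta> \<in> ends"
  shows "desc s (fam \<alpha> m \<beta>) \<longleftrightarrow> s \<in> (case \<alpha> of [] \<Rightarrow> {Sr, St} | a # _ \<Rightarrow> {a})"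
proof -
  obtain b c where *: "pt (core m (inverse (word \<beta>))) = (3 - b - c, b, c)"
    "b < 0" "c < 0" "\<bar>b - c\<bar> \<le> 2" using pt_core[OF assms(2)] by blast
  from assms(1) show ?thesis
    by (cases rule: ends_cases; cases s) (use * in \<open>auto simp: desc_iff_height fam_def word_Cons mult.assoc\<close>)
qed

lemma fam_Nil: "fam [] m \<beta> = core m (inverse (word \<beta>))"
  by (simp add: fam_def)

lemma fam_Cons: "fam (a # \<alpha>) m \<beta> = gen a * fam \<alpha> m \<beta>"
  by (simp add: fam_def word_Cons mult.assoc)

lemma fam_Suc: "fam [] (Suc m) \<beta> = gen Sr * fam [St, Ss] m \<beta>" "fam [] (Suc m) \<beta> = gen St * fam [Sr, Ss] m \<beta>"
  by (simp_all add: fam_Nil fam_Cons gen_rt_left)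

lemma ends_simps [simp]: "[] \<in> ends" "[Ss] \<in> ends" "[St, Ss] \<in> ends" "[Sr, Ss] \<in> ends"
  by (simp_all add: ends_def)

lemma len_word_end: "\<beta> \<in> ends \<Longrightarrow> len (word \<beta>) = length \<beta>"
proof -
  have 1: "len (gen Ss) = 1" using len_not_desc[of Ss 1] by simp
  have 2: "len (gen a * gen Ss) = 2" if "a \<noteq> Ss" for a
  proof -
    have "\<not> desc a (gen Ss)" using that by (cases a) (auto simp: desc_iff_height pt_gen_one)
    from len_not_desc[OF this] show ?thesis using 1 by simp
  qed
  assume "\<beta> \<in> ends"
  then show ?thesis by (cases rule: ends_cases) (simp_all add: word_Cons 1 2)
qed

lemma len_core: "\<beta> \<in> ends \<Longrightarrow> len (fam [] m \<beta>) = 2 + 3 * m + length \<beta>"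
proof (induction m)
  case 0
  have "\<not> desc St (inverse (word \<beta>))" "\<not> desc Sr (gen St * inverse (word \<beta>))"
    using 0 by (cases rule: ends_cases; auto simp: word_Cons desc_iff_height pt_gen_one)+
  then show ?case using len_word_end[OF 0] by (simp add: fam_Nil len_not_desc)
next
  case (Suc m)
  have "\<not> desc Ss (fam [] m \<beta>)" "\<not> desc St (fam [Ss] m \<beta>)" "\<not> desc Sr (fam [St, Ss] m \<beta>)"
    using Suc.prems by (simp_all add: desc_fam)
  then have "len (fam [] (Suc m) \<beta>) = len (fam [] m \<beta>) + 3"
    by (simp add: fam_Suc(1) fam_Cons len_not_desc del: desc_gen)
  then show ?case using Suc by simp
qed

lemma len_fam: "\<alpha> \<in> ends \<Longrightarrow> \<beta> \<in> ends \<Longrightarrow> len (fam \<alpha> m \<beta>) = length \<alpha> + 2 + 3 * m + length \<beta>"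
proof -
  assume b: "\<beta> \<in> ends"
  have 1: "len (fam [Ss] m \<beta>) = len (fam [] m \<beta>) + 1"
    using len_not_desc[of Ss "fam [] m \<beta>"] desc_fam[OF ends_simps(1) b] by (simp add: fam_Cons)
  have 2: "len (fam [a, Ss] m \<beta>) = len (fam [Ss] m \<beta>) + 1" if "a \<noteq> Ss" for a
    using len_not_desc[of a "fam [Ss] m \<beta>"] desc_fam[OF ends_simps(2) b] that
    by (simp add: fam_Cons[of a])
  assume "\<alpha> \<in> ends"
  then show ?thesis by (cases rule: ends_cases) (use 1 2 len_core[OF b, of m] in simp_all)
qed

text \<open>A lengthening letter either continues the pattern or is an \<open>s\<close> in front of
  \<open>as\<close>. In the latter case the core can be written with \<open>a\<close> first, because
  \<open>r\<close> and \<open>t\<close> commute, and the product begins with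
  \<open>sasa\<close>.\<close>

lemma fam_gen:
  assumes "\<alpha> \<in> ends" "\<beta> \<in> ends" "\<not> desc s (fam \<alpha> m \<beta>)" "gen s * fam \<alpha> m \<beta> \<notin> lowest"
  shows "\<exists>\<alpha>'\<in>ends. \<exists>m'. gen s * fam \<alpha> m \<beta> = fam \<alpha>' m' \<beta>"
proof -
  have low: "gen Ss * fam [a, Ss] m \<beta> \<in> lowest" if ab: "{a, b} = {Sr, St}" for a b
  proof -
    have c: "fam [] m \<beta> = gen a * (gen b * X)" if "X = gen Sr * (gen St * fam [] m \<beta>)" for X
      using ab that by (auto simp: doubleton_eq_iff gen_rt_left)
    define X where "X = gen Sr * (gen St * fam [] m \<beta>)"
    have eq: "gen Ss * fam [a, Ss] m \<beta> = braid4 a (gen b * X)"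
      using c[OF X_def] by (simp add: fam_Cons braid4_def)
    have nd: "\<not> desc Ss (fam [a, Ss] m \<beta>)" using ab assms(2) desc_fam[of "[a, Ss]" \<beta>]
      by (auto simp: doubleton_eq_iff)
    have d: "desc a (fam [] m \<beta>)" using ab assms(2) desc_fam[of "[]" \<beta>] by (auto simp: doubleton_eq_iff)
    have ga: "gen a * fam [] m \<beta> = gen b * X" using c[OF X_def] by simp
    have "[a, Ss] \<in> ends" using ab by (auto simp: doubleton_eq_iff)
    then have "len (gen Ss * fam [a, Ss] m \<beta>) = 3 + len (fam [] m \<beta>)"
      using len_not_desc[OF nd] len_fam[of "[a, Ss]" \<beta> m] len_fam[of "[]" \<beta> m] assms(2) by simp
    also have "len (fam [] m \<beta>) = Suc (len (gen b * X))" using len_desc[OF d] ga by simp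
    finally have l: "len (gen Ss * fam [a, Ss] m \<beta>) = len 1 + 4 + len (gen b * X)" by simp
    moreover have "gen Ss * fam [a, Ss] m \<beta> = 1 * braid4 a (gen b * X)" using eq by simp
    moreover have "a \<noteq> Ss" using ab by (auto simp: doubleton_eq_iff)
    ultimately show ?thesis unfolding lowest_def by blast
  qed
  have s: "s \<notin> (case \<alpha> of [] \<Rightarrow> {Sr, St} | a # _ \<Rightarrow> {a})" using assms(3) desc_fam[OF assms(1,2)] by blast
  from assms(1) show ?thesis
  proof (cases rule: ends_cases)
    case 1
    then have "gen s * fam \<alpha> m \<beta> = fam [Ss] m \<beta>" using s by (cases s) (auto simp: fam_Cons)
    then show ?thesis using ends_simps by blast
  next
    case 2
    then have "gen s * fam \<alpha> m \<beta> = fam [s, Ss] m \<beta>" "[s, Ss] \<in> ends" using s by (cases s; auto simp: fam_Cons)+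
    then show ?thesis by blast
  next
    case 3
    then have "s = Sr" using s low[of St Sr] assms(4) by (cases s) auto
    then have "gen s * fam \<alpha> m \<beta> = fam [] (Suc m) \<beta>" using 3 fam_Suc by simp
    then show ?thesis using ends_simps by blast
  next
    case 4
    then have "s = St" using s low[of Sr St] assms(4) by (cases s) auto
    then have "gen s * fam \<alpha> m \<beta> = fam [] (Suc m) \<beta>" using 4 fam_Suc by simp
    then show ?thesis using ends_simps by blast
  qed
qed

lemma fam_extend:
  assumes "\<alpha> \<in> ends" "\<beta> \<in> ends" "len (x * fam \<alpha> m \<beta>) = len x + len (fam \<alpha> m \<beta>)" "x * fam \<alpha> m \<beta> \<notin> lowest"
  shows "\<exists>\<alpha>'\<in>ends. \<exists>m'. x * fam \<alpha> m \<beta> = fam \<alpha>' m' \<beta>"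
  using assms(3,4)
proof (induction "len x" arbitrary: x)
  case 0
  then show ?case using assms(1) by auto
next
  case (Suc n)
  then have "x \<noteq> 1" by auto
  then obtain s where s: "desc s x" using desc_exists by blast
  define y where "y = gen s * x"
  have x: "x = gen s * y" and nd: "\<not> desc s y" using s by (simp_all add: y_def)
  have lx: "len x = Suc (len y)" using len_desc[OF s] by (simp add: y_def)
  let ?f = "fam \<alpha> m \<beta>"
  have xf: "x * ?f = gen s * (y * ?f)" by (simp add: x mult.assoc)
  have l: "len (y * ?f) = len y + len ?f"
    using Suc.prems(1) len_times_le[of y ?f] len_gen_cases[of s "y * ?f"] lx xf by simp
  then have nd': "\<not> desc s (y * ?f)" using Suc.prems(1) lx xf by (simp add: desc_def)
  have "y * ?f \<notin> lowest"
  proof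
    assume "y * ?f \<in> lowest"
    moreover have "len (gen s * (y * ?f)) = len (gen s) + len (y * ?f)"
      using len_not_desc[OF nd'] len_not_desc[of s 1] by simp
    ultimately have "gen s * (y * ?f) \<in> lowest" by (rule lowest_extend)
    then show False using Suc.prems(2) xf by simp
  qed
  then obtain \<alpha>' m' where *: "\<alpha>' \<in> ends" "y * ?f = fam \<alpha>' m' \<beta>" using Suc l lx by fastforce
  then show ?case using fam_gen[OF *(1) assms(2), of s m'] nd' Suc.prems(2) xf by simp
qed

text \<open>Moves a factor \<open>rts\<close> through the core, which makes the core equal to its
  own inverse.\<close>

lemma core_swap: "gen Sr * (gen St * (gen Ss * core m 1)) = core m 1 * (gen Ss * (gen Sr * gen St))"
proof (induction m)
  case 0
  show ?case by (simp add: mult.assoc gen_rt gen_rt_left)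
next
  case (Suc m)
  then show ?case by (metis core.simps(2) mult.assoc)
qed

lemma inverse_core: "inverse (core m 1) = core m 1"
proof (induction m)
  case 0
  show ?case by (simp add: gen_rt)
next
  case (Suc m)
  have "inverse (core (Suc m) 1) = core m 1 * (gen Ss * (gen Sr * gen St))"
    by (simp add: Suc mult.assoc gen_rt)
  then show ?case by (simp add: core_swap)
qed

lemma inverse_fam: "inverse (fam \<alpha> m \<beta>) = fam \<beta> m \<alpha>"
  unfolding fam_def core_eq[of m "inverse _"] by (simp add: inverse_core mult.assoc)

text \<open>The family grows on the left, so it is extended twice: first from \<open>rt\<close>
  through the inverse of the right factor, then, after inverting, through the left factor.\<close>

theorem fam_exists:
  assumes "w \<in> rt_type" "w \<notin> lowest"
  shows "\<exists>\<alpha>\<in>ends. \<exists>\<beta>\<in>ends. \<exists>m. w = fam \<alpha> m \<beta>"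
proof -
  obtain x y where w: "w = x * (gen Sr * (gen St * y))" "len w = len x + 2 + len y"
    using assms(1) by (auto simp: rt_type_def)
  define z where "z = gen Sr * (gen St * y)"
  have lz: "len z = 2 + len y"
    using len_times_le[of x z] len_word_times_le[of "[Sr, St]" y] w
    by (simp add: z_def word_Cons mult.assoc)
  have wz: "w = x * z" "len w = len x + len z" using w lz by (simp_all add: z_def)
  have "z \<notin> lowest" using lowest_extend[of z x] wz assms(2) by auto
  then have iz: "inverse z \<notin> lowest" using lowest_inverse[of "inverse z"] by auto
  have zi: "inverse z = inverse y * fam [] 0 []"
    by (simp add: z_def fam_def mult.assoc gen_rt)
  have "len (inverse y * fam [] 0 []) = len (inverse y) + len (fam [] 0 [])"
    using zi lz len_inverse[of z] len_fam[of "[]" "[]" 0] by simp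
  then obtain \<alpha> m where *: "\<alpha> \<in> ends" "inverse z = fam \<alpha> m []"
    using fam_extend[of "[]" "[]" "inverse y" 0] iz zi by auto
  then have "z = fam [] m \<alpha>" using inverse_fam[of \<alpha> m "[]"] by (metis inverse_inverse_W)
  then show ?thesis using fam_extend[of "[]" \<alpha> x m] wz assms(2) *(1) by auto
qed

text \<open>Multiplication by generators supplies every link except the one from index
  \<open>m\<close> up to \<open>m + 1\<close>. That link is the edge with nonzero \<mu>, taken as a
  hypothesis because its value is found only later.\<close>

lemma fam_left_le:
  assumes "\<beta> \<in> ends" "\<alpha> \<in> ends" "\<alpha>' \<in> ends"
    and mu: "\<And>m. mu (fam [] m \<beta>) (fam [St, Ss] (Suc m) \<beta>) \<noteq> 0"
  shows "fam \<alpha> m \<beta> \<le>\<^sub>L fam \<alpha>' m' \<beta>"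
proof -
  let ?x = "\<lambda>m. fam [] m \<beta>" and ?y = "\<lambda>m. fam [Ss] m \<beta>" and ?p = "\<lambda>a m. fam [a, Ss] m \<beta>"
  note d = desc_fam[OF _ assms(1)]
  have xy: "?y m \<le>\<^sub>L ?x m" "?x m \<le>\<^sub>L ?y m" for m
    using left_step_down[of Ss "?x m"] left_step_up[of Ss "?x m" Sr]
    by (auto simp: d fam_Cons[symmetric] intro!: left_le_step)
  have yp: "?p a m \<le>\<^sub>L ?y m" "?y m \<le>\<^sub>L ?p a m" if "a \<in> {Sr, St}" for a m
    using left_step_down[of a "?y m"] left_step_up[of a "?y m" Ss] that
    by (auto simp: d fam_Cons[of a "[Ss]", symmetric] intro!: left_le_step)
  have px: "?x (Suc m) \<le>\<^sub>L ?p St m" for m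
    using left_step_down[of Sr "?p St m"] by (auto simp: d fam_Suc intro!: left_le_step)
  have xp: "?x m \<le>\<^sub>L ?p St (Suc m)" for m
    unfolding left_le_def by (rule r_into_rtranclp) (use mu in \<open>auto simp: left_step_iff d\<close>)
  have px': "?p a m \<le>\<^sub>L ?x m" and xp': "?x m \<le>\<^sub>L ?p a m" if "a \<in> {Sr, St}" for a m
    by (rule left_le_trans[OF yp(1)[OF that] xy(1)], rule left_le_trans[OF xy(2) yp(2)[OF that]])
  have up: "?x m \<le>\<^sub>L ?x (Suc m)" for m
    by (rule left_le_trans[OF xp px']) simp
  have down: "?x (Suc m) \<le>\<^sub>L ?x m" for m
    by (rule left_le_trans[OF px px']) simp
  have 0: "?x m \<le>\<^sub>L ?x 0 \<and> ?x 0 \<le>\<^sub>L ?x m" for m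
  proof (induction m)
    case (Suc m)
    then show ?case using left_le_trans[OF down] left_le_trans[OF _ up] by blast
  qed simp
  have 1: "fam \<gamma> m \<beta> \<le>\<^sub>L ?x m \<and> ?x m \<le>\<^sub>L fam \<gamma> m \<beta>" if "\<gamma> \<in> ends" for \<gamma> m
    using that by (cases rule: ends_cases) (simp_all add: xy px' xp')
  have "?x m \<le>\<^sub>L ?x m'" using left_le_trans[of "?x m" "?x 0" "?x m'"] 0 by blast
  then show ?thesis
    using left_le_trans[of "fam \<alpha> m \<beta>" "?x m" "?x m'"] left_le_trans[of "fam \<alpha> m \<beta>" "?x m'" "fam \<alpha>' m' \<beta>"]
      1[OF assms(2)] 1[OF assms(3)] by blast
qed

lemma fam_right_cell:
  assumes "\<alpha> \<in> ends" "\<beta> \<in> ends" "\<beta>' \<in> ends"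
    and mu: "\<And>m. mu (fam [] m \<alpha>) (fam [St, Ss] (Suc m) \<alpha>) \<noteq> 0"
  shows "fam \<alpha> m \<beta> \<sim>\<^sub>R fam \<alpha> m' \<beta>'"
  unfolding right_cell_eq_def right_le_def inverse_fam using fam_left_le[OF assms(1)] assms(2,3) mu by blast

section \<open>A module of rank four\<close>

definition V :: "laurent poly" where "V = [:half_q_pow 1:]"
definition Vi :: "laurent poly" where "Vi = [:half_q_pow (-1):]"
definition X :: "laurent poly" where "X = [:0, 1:]"

type_synonym vec = "laurent poly \<times> laurent poly \<times> laurent poly \<times> laurent poly"

fun vscale :: "laurent \<Rightarrow> vec \<Rightarrow> vec" where
  "vscale a (x, y, p, q) = (smult a x, smult a y, smult a p, smult a q)"

text \<open>
  The basis vectors stand for the left ends \<open>e\<close>, \<open>s\<close>, \<open>ts\<close>, \<open>rs\<close> of the elements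
  \<open>u rt(srt)\<^sup>m\<close>, with \<open>m\<close> recorded by the degree in \<open>X\<close>; \<open>cact s\<close> is the action of \<open>C\<^sub>s\<close>.
\<close>

fun cact :: "simple \<Rightarrow> vec \<Rightarrow> vec" where
  "cact Sr (x, y, p, q) = ((V + Vi) * x + y + X * p, 0, 0, (V + Vi) * q + y)"
| "cact St (x, y, p, q) = ((V + Vi) * x + y + X * q, 0, (V + Vi) * p + y, 0)"
| "cact Ss (x, y, p, q) = (0, x + p + q + (V + Vi) * y, 0, 0)"

text \<open>The action of the normalised element \<open>v^(-1) T_s = C_s - v^(-1)\<close>.\<close>

definition nact :: "simple \<Rightarrow> vec \<Rightarrow> vec" where
  "nact s n = cact s n - vscale (half_q_pow (-1)) n"

definition tact :: "simple \<Rightarrow> vec \<Rightarrow> vec" where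
  "tact s n = vscale (half_q_pow 1) (nact s n)"

lemma V_Vi [simp]: "V * Vi = 1" "Vi * V = 1" "V * (Vi * f) = f" "Vi * (V * f) = f"
proof -
  show *: "V * Vi = 1" "Vi * V = 1" by (simp_all add: V_def Vi_def half_q_pow_add one_pCons)
  show "V * (Vi * f) = f" "Vi * (V * f) = f" unfolding mult.assoc[symmetric] * by simp_all
qed

lemma smult_V: "smult (half_q_pow 1) f = V * f" "smult (half_q_pow (-1)) f = Vi * f"
  by (simp_all add: V_def Vi_def)

lemma nact_simps:
  "nact Sr (x, y, p, q) = (V * x + y + X * p, - (Vi * y), - (Vi * p), V * q + y)"
  "nact St (x, y, p, q) = (V * x + y + X * q, - (Vi * y), V * p + y, - (Vi * q))"
  "nact Ss (x, y, p, q) = (- (Vi * x), x + p + q + V * y, - (Vi * p), - (Vi * q))"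
  unfolding nact_def cact.simps vscale.simps smult_V by (simp_all only: diff_Pair ring_distribs) (simp_all add: algebra_simps)

interpretation vec: module vscale
proof
  fix a b and n m :: vec
  show "vscale a (n + m) = vscale a n + vscale a m" by (cases n; cases m) (simp add: smult_add_right)
  show "vscale (a + b) n = vscale a n + vscale b n" by (cases n) (simp add: smult_add_left)
  show "vscale a (vscale b n) = vscale (a * b) n" by (cases n) simp
  show "vscale 1 n = n" by (cases n) simp
qed

lemma cact_add: "cact s (n + m) = cact s n + cact s m"
  by (cases n; cases m; cases s) (simp_all only: cact.simps add_Pair ring_distribs add_ac add_0)

lemma cact_scale: "cact s (vscale a n) = vscale a (cact s n)"
  by (cases n; cases s)
    (simp_all only: cact.simps vscale.simps smult_add_right mult_smult_right smult_0_right)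

lemma cact_cact: "cact s (cact s n) = vscale eta (cact s n)"
proof -
  have e: "smult eta f = (V + Vi) * f" for f :: "laurent poly"
    unfolding eta_def smult_add_left smult_V ring_distribs ..
  show ?thesis by (cases n; cases s) (simp_all only: cact.simps vscale.simps e mult_zero_right add_0_right add_0)
qed

lemma nact_rt: "nact Sr (nact St n) = nact St (nact Sr n)"
proof -
  obtain x y p q where n: "n = (x, y, p, q)" by (metis prod_cases4)
  show ?thesis unfolding n nact_simps by (simp add: algebra_simps)
qed

lemma nact_braid:
  assumes "s \<noteq> Ss"
  shows "nact Ss (nact s (nact Ss (nact s n))) = nact s (nact Ss (nact s (nact Ss n)))"
proof -
  obtain x y p q where n: "n = (x, y, p, q)" by (metis prod_cases4)
  show ?thesis using assms unfolding n by (cases s) (simp_all add: nact_simps algebra_simps)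
qed

lemma nact_scale: "nact s (vscale a n) = vscale a (nact s n)"
  by (simp add: nact_def cact_scale vec.scale_right_diff_distrib mult.commute)

text \<open>Matsumoto's theorem for operators with the braid relations. Reduced words with different
  first letters \<open>a\<close>, \<open>b\<close> are compared through a third one that begins with
  the longest element of the group generated by \<open>a\<close> and \<open>b\<close>.\<close>

lemma foldr_reduced_unique:
  fixes f :: "simple \<Rightarrow> 'a \<Rightarrow> 'a"
  assumes rt: "\<And>n. f Sr (f St n) = f St (f Sr n)"
    and braid: "\<And>s n. s \<noteq> Ss \<Longrightarrow> f Ss (f s (f Ss (f s n))) = f s (f Ss (f s (f Ss n)))"
  shows "reduced xs \<Longrightarrow> reduced ys \<Longrightarrow> word xs = word ys \<Longrightarrow> foldr f xs n = foldr f ys n"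
proof (induction "length xs" arbitrary: xs ys rule: less_induct)
  case less
  define w where "w = word xs"
  have wl: "len w = length xs" "len w = length ys" "word ys = w"
    using less.prems by (simp_all add: w_def)
  show ?case
  proof (cases xs)
    case Nil
    then show ?thesis using wl by simp
  next
    case (Cons a xs')
    then obtain b ys' where Cons': "ys = b # ys'" using wl by (cases ys) auto
    have rx: "reduced xs'" "\<not> desc a (word xs')" using less.prems reduced_Cons[of a xs'] Cons by auto
    have ry: "reduced ys'" "\<not> desc b (word ys')" using less.prems(2) reduced_Cons[of b ys'] Cons' by auto
    have wx: "w = gen a * word xs'" using Cons by (simp add: w_def word_Cons)
    have wy: "w = gen b * word ys'" using Cons' wl by (simp add: word_Cons)
    have IHx: "foldr f xs' n = foldr f zs n" if "reduced zs" "word zs = gen a * w" for zs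
    proof (rule less.hyps[OF _ rx(1) that(1)])
      show "length xs' < length xs" using Cons by simp
      show "word xs' = word zs" unfolding that(2) wx by simp
    qed
    have IHy: "foldr f ys' n = foldr f zs n" if "reduced zs" "word zs = gen b * w" for zs
    proof (rule less.hyps[OF _ ry(1) that(1)])
      show "length ys' < length xs" using Cons' wl(1,2) by simp
      show "word ys' = word zs" unfolding that(2) wy by simp
    qed
    show ?thesis
    proof (cases "a = b")
      case True
      then have "foldr f xs' n = foldr f ys' n" using IHx ry(1) wy by simp
      then show ?thesis using Cons Cons' True by simp
    next
      case ne: False
      have "desc a (gen a * word xs')" "desc b (gen b * word ys')" using rx(2) ry(2) by simp_all
      then have da: "desc a w" "desc b w" by (simp_all only: wx[symmetric] wy[symmetric])
      show ?thesis
      proof (cases "Ss \<in> {a, b}")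
        case False
        define u where "u = gen Sr * (gen St * w)"
        have ab: "a = Sr \<and> b = St \<or> a = St \<and> b = Sr" using ne False by (cases a; cases b) auto
        then have d: "desc Sr w" "desc St w" using da by blast+
        have lu: "len w = 2 + len u" unfolding u_def by (rule two_desc_rt[OF d])
        obtain zs where zs: "word zs = u" "reduced zs" by (rule reduced_wordE)
        have w: "gen Sr * w = gen St * u" "gen St * w = gen Sr * u"
          by (simp_all add: u_def gen_rt_left)
        have r: "reduced (St # zs)" "reduced (Sr # zs)"
          using len_desc[OF d(1)] len_desc[OF d(2)] lu zs(2) unfolding w word_Cons zs(1) by simp_all
        have wz: "word (St # zs) = gen Sr * w" "word (Sr # zs) = gen St * w"
          using w zs(1) by (simp_all add: word_Cons)
        from ab show ?thesis
        proof (elim disjE conjE)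
          assume ab: "a = Sr" "b = St"
          show ?thesis using IHx[OF r(1)] IHy[OF r(2)] wz ab Cons Cons' rt by simp
        next
          assume ab: "a = St" "b = Sr"
          show ?thesis using IHx[OF r(2)] IHy[OF r(1)] wz ab Cons Cons' rt by simp
        qed
      next
        case True
        define s where "s = (if a = Ss then b else a)"
        have s: "s \<noteq> Ss" and ab: "a = Ss \<and> b = s \<or> a = s \<and> b = Ss"
          using True ne by (auto simp: s_def)
        have d: "desc Ss w" "desc s w" using da ab by auto
        obtain u where u: "w = braid4 s u" "len w = 4 + len u" using two_desc_braid4[OF s d] by blast
        obtain zs where zs: "word zs = u" "reduced zs" by (rule reduced_wordE)
        have w: "gen Ss * w = word (s # Ss # s # zs)" "gen s * w = word (Ss # s # Ss # zs)"
          unfolding u(1) by (simp_all add: zs braid4_def word_Cons gen_braid[OF s])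
        have r: "reduced (s # Ss # s # zs)" "reduced (Ss # s # Ss # zs)"
          using len_desc[OF d(1)] len_desc[OF d(2)] u(2) zs unfolding w by simp_all
        from ab show ?thesis
        proof (elim disjE conjE)
          assume ab: "a = Ss" "b = s"
          have "foldr f xs' n = foldr f (s # Ss # s # zs) n" "foldr f ys' n = foldr f (Ss # s # Ss # zs) n"
            using IHx[OF r(1)] IHy[OF r(2)] w ab by simp_all
          then show ?thesis using Cons Cons' ab braid[OF s] by simp
        next
          assume ab: "a = s" "b = Ss"
          have "foldr f xs' n = foldr f (Ss # s # Ss # zs) n" "foldr f ys' n = foldr f (s # Ss # s # zs) n"
            using IHx[OF r(2)] IHy[OF r(1)] w ab by simp_all
          then show ?thesis using Cons Cons' ab braid[OF s] by simp
        qed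
      qed
    qed
  qed
qed

text \<open>The normalised element \<open>v^(-l(w)) T_w\<close> applied to the first basis vector.
  Choosing a reduced word is harmless, since \<open>nact\<close> satisfies the braid
  relations.\<close>

definition wact :: "W \<Rightarrow> vec" where
  "wact w = foldr nact (SOME xs. word xs = w \<and> reduced xs) (1, 0, 0, 0)"

lemma wact_word: "reduced xs \<Longrightarrow> wact (word xs) = foldr nact xs (1, 0, 0, 0)"
proof -
  assume xs: "reduced xs"
  let ?ys = "SOME ys. word ys = word xs \<and> reduced ys"
  have "word ?ys = word xs \<and> reduced ?ys" by (rule someI[of _ xs]) (use xs in simp)
  then have "reduced ?ys" "word ?ys = word xs" by blast+
  from this(1) xs this(2) show ?thesis unfolding wact_def
    by (rule foldr_reduced_unique[of nact, OF nact_rt, rotated 1]) (rule nact_braid)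
qed

lemma wact_gen: "\<not> desc s w \<Longrightarrow> wact (gen s * w) = nact s (wact w)"
proof -
  assume nd: "\<not> desc s w"
  obtain xs where xs: "word xs = w" "reduced xs" by (rule reduced_wordE)
  then show ?thesis using wact_word[of xs] wact_word[OF reduced_ConsI, of xs s] nd by (simp add: word_Cons)
qed

lemma wact_one: "wact 1 = (1, 0, 0, 0)"
  using wact_word[of "[]"] by simp

definition rep :: "hecke \<Rightarrow> vec" where
  "rep h = (\<Sum>w\<in>Poly_Mapping.keys h. vscale (Poly_Mapping.lookup h w) (vscale (half_q_pow (int (len w))) (wact w)))"

lemma lin_rep: "semilin (\<lambda>a. a) vscale rep"
proof -
  have "semilin (\<lambda>a. a) vscale (\<lambda>h. rep h)"
    unfolding rep_def by (rule semilin_ext[OF vec.module_axioms]) simp_all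
  then show ?thesis .
qed

lemmas rep_simps = semilinD[OF lin_rep]

lemma rep_T: "rep (T_basis w) = vscale (half_q_pow (int (len w))) (wact w)"
  unfolding rep_def by (rule semilin_ext_T_basis[OF vec.module_axioms, of "\<lambda>a. a"]) simp

text \<open>Evaluation at the first basis vector respects left multiplication. For a descent the
  claim reduces to the ascending case via \<open>T_w = v C_s T_(sw) - T_(sw)\<close> and the
  relation \<open>C_s C_s = eta C_s\<close> on both sides.\<close>

lemma rep_cop: "rep (cop s h) = cact s (rep h)"
proof (rule semilin_eqI[OF lin_comp[OF lin_rep lin_cop], of "\<lambda>h. cact s (rep h)"])
  show "semilin (\<lambda>a. a) vscale (\<lambda>h. cact s (rep h))"
    by (simp add: semilin_def rep_simps cact_add cact_scale)
  fix w
  have up: "rep (cop s (T_basis w)) = cact s (rep (T_basis w))" if "\<not> desc s w" for w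
  proof -
    have "rep (cop s (T_basis w)) = vscale (half_q_pow (int (len w))) (nact s (wact w) + vscale (half_q_pow (-1)) (wact w))"
      using that by (simp add: cop_def rep_simps gen_mult_T rep_T wact_gen len_not_desc half_q_pow_add
          vec.scale_right_distrib add.commute)
    then show ?thesis by (simp add: nact_def rep_T cact_scale)
  qed
  show "rep (cop s (T_basis w)) = cact s (rep (T_basis w))"
  proof (cases "desc s w")
    case False
    then show ?thesis by (rule up)
  next
    case True
    define y where "y = gen s * w"
    have nd: "\<not> desc s y" using True by (simp add: y_def)
    have T: "T_basis w = scale (half_q_pow 1) (cop s (T_basis y)) - T_basis y"
      using nd by (simp add: cop_def gen_mult_T half_q_pow_add hecke.scale_right_distrib) (simp add: y_def)
    have "rep (cop s (T_basis w)) = vscale (half_q_pow 1) (rep (cop s (cop s (T_basis y)))) - rep (cop s (T_basis y))"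
      unfolding T by (simp add: semilinD[OF lin_cop] rep_simps)
    also have "\<dots> = vscale (half_q_pow 1) (vscale eta (rep (cop s (T_basis y)))) - rep (cop s (T_basis y))"
      by (simp add: cop_cop rep_simps)
    also have "\<dots> = vscale (half_q_pow 1) (cact s (rep (cop s (T_basis y)))) - cact s (rep (T_basis y))"
      by (simp add: up[OF nd] cact_cact)
    also have "\<dots> = cact s (rep (T_basis w))"
    proof -
      have "cact s (m - n) = cact s m - cact s n" for m n
        using cact_add[of s "m - n" n] by (simp add: algebra_simps)
      then show ?thesis unfolding T by (simp add: rep_simps cact_scale)
    qed
    finally show ?thesis .
  qed
qed

subsection \<open>Degree bounds\<close>

text \<open>A bound on the degree in \<open>v\<close> only, uniform in the powers of
  \<open>X\<close>; correspondingly \<open>lead\<close> extracts one power of \<open>v\<close> and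
  returns a polynomial in \<open>X\<close>.\<close>

definition dle :: "int \<Rightarrow> laurent poly \<Rightarrow> bool" where
  "dle d f \<longleftrightarrow> (\<forall>i n. d < n \<longrightarrow> Poly_Mapping.lookup (coeff f i) n = 0)"

definition lead :: "int \<Rightarrow> laurent poly \<Rightarrow> int poly" where
  "lead d f = map_poly (\<lambda>a. Poly_Mapping.lookup a d) f"

lemma coeff_lead [simp]: "coeff (lead d f) i = Poly_Mapping.lookup (coeff f i) d"
  by (simp add: lead_def coeff_map_poly)

lemma coeff_V [simp]: "coeff (V * f) i = half_q_pow 1 * coeff f i"
  and coeff_Vi [simp]: "coeff (Vi * f) i = half_q_pow (-1) * coeff f i"
  and coeff_X: "coeff (X * f) i = (case i of 0 \<Rightarrow> 0 | Suc j \<Rightarrow> coeff f j)"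
  by (simp_all add: V_def Vi_def X_def coeff_pCons split: nat.split)

lemma dle_0 [simp]: "dle d 0"
  by (simp add: dle_def)

lemma dle_add: "dle d f \<Longrightarrow> dle d g \<Longrightarrow> dle d (f + g)"
  by (simp add: dle_def lookup_add)

lemma dle_diff: "dle d f \<Longrightarrow> dle d g \<Longrightarrow> dle d (f - g)"
  by (simp add: dle_def lookup_minus)

lemma dle_uminus: "dle d f \<Longrightarrow> dle d (- f)"
  by (simp add: dle_def)

lemma dle_V: "dle (d - 1) f \<Longrightarrow> dle d (V * f)"
  by (simp add: dle_def)

lemma dle_Vi: "dle (d + 1) f \<Longrightarrow> dle d (Vi * f)"
  by (simp add: dle_def)

lemma dle_X: "dle d f \<Longrightarrow> dle d (X * f)"
  by (simp add: dle_def coeff_X split: nat.split)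

lemma dle_mono: "dle d f \<Longrightarrow> d \<le> e \<Longrightarrow> dle e f"
  by (simp add: dle_def)

lemmas dle_intros = dle_add dle_diff dle_uminus dle_V dle_Vi dle_X

lemma dle_smult: "\<forall>n>a. Poly_Mapping.lookup c n = 0 \<Longrightarrow> dle d f \<Longrightarrow> dle (a + d) (smult c f)"
proof -
  assume c: "\<forall>n>a. Poly_Mapping.lookup c n = 0" and f: "dle d f"
  have "Poly_Mapping.lookup (c * coeff f i) n = 0" if "a + d < n" for i n
  proof (rule ccontr)
    assume "Poly_Mapping.lookup (c * coeff f i) n \<noteq> 0"
    then have "n \<in> {x + y | x y. x \<in> Poly_Mapping.keys c \<and> y \<in> Poly_Mapping.keys (coeff f i)}"
      using keys_mult[of c "coeff f i"] by (auto simp: in_keys_iff)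
    then obtain x y where "n = x + y" "Poly_Mapping.lookup c x \<noteq> 0" "Poly_Mapping.lookup (coeff f i) y \<noteq> 0"
      by (auto simp: in_keys_iff)
    moreover from this have "x \<le> a" "y \<le> d" using c f unfolding dle_def by force+
    ultimately show False using that by linarith
  qed
  then show ?thesis by (simp add: dle_def)
qed

lemma lead_simps:
  "lead d 0 = 0" "lead d (f + g) = lead d f + lead d g" "lead d (f - g) = lead d f - lead d g"
  "lead d (- f) = - lead d f" "lead d (V * f) = lead (d - 1) f" "lead d (Vi * f) = lead (d + 1) f"
  "lead d (X * f) = [:0, 1:] * lead d f"
  by (rule poly_eqI; simp add: lookup_add lookup_minus coeff_X coeff_pCons split: nat.split)+

lemma lead_dle: "dle e f \<Longrightarrow> e < d \<Longrightarrow> lead d f = 0"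
  by (rule poly_eqI) (simp add: dle_def)

fun vdle :: "int \<Rightarrow> vec \<Rightarrow> bool" where
  "vdle d (x, y, p, q) \<longleftrightarrow> dle d x \<and> dle d y \<and> dle d p \<and> dle d q"

fun vlead :: "int \<Rightarrow> vec \<Rightarrow> int poly \<times> int poly \<times> int poly \<times> int poly" where
  "vlead d (x, y, p, q) = (lead d x, lead d y, lead d p, lead d q)"

lemma vdle_add: "vdle d n \<Longrightarrow> vdle d m \<Longrightarrow> vdle d (n + m)"
  by (cases n; cases m) (simp add: dle_add)

lemma vdle_mono: "vdle d n \<Longrightarrow> d \<le> e \<Longrightarrow> vdle e n"
  by (cases n) (auto intro: dle_mono)

lemma vdle_sum: "(\<And>i. i \<in> A \<Longrightarrow> vdle d (f i)) \<Longrightarrow> vdle d (sum f A)"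
  by (induction A rule: infinite_finite_induct) (auto simp: zero_prod_def intro: vdle_add)

lemma vdle_scale: "\<forall>n>a. Poly_Mapping.lookup c n = 0 \<Longrightarrow> vdle d m \<Longrightarrow> vdle (a + d) (vscale c m)"
  by (cases m) (simp add: dle_smult)

lemma vlead_vdle: "vdle e n \<Longrightarrow> e < d \<Longrightarrow> vlead d n = (0, 0, 0, 0)"
  by (cases n) (auto intro: lead_dle)

lemma vlead_add: "vlead d (n + m) = vlead d n + vlead d m"
  by (cases n; cases m) (simp add: lead_simps)

subsection \<open>Invariant lattices\<close>

text \<open>The weights are such that \<open>rts\<close> preserves the lattice and the shorter words
  \<open>s\<close>, \<open>ts\<close>, \<open>rs\<close>, \<open>sts\<close>, \<open>srs\<close>
  lead to degree at most \<open>d\<close>.\<close>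

fun wlat :: "int \<Rightarrow> vec \<Rightarrow> bool" where
  "wlat d (x, y, p, q) \<longleftrightarrow> dle d x \<and> dle (d - 2) y \<and> dle (d - 1) p \<and> dle (d - 1) q"

text \<open>A priori \<open>q\<close> and \<open>V * y\<close> have degree \<open>d - 1\<close>; the
  extra condition says that their leading terms cancel. This cancellation makes \<open>rsts\<close>
  lower the degree by one. The mirror condition \<open>latM\<close> does the same for
  \<open>tsrs\<close>.\<close>

fun latP :: "int \<Rightarrow> vec \<Rightarrow> bool" where
  "latP d (x, y, p, q) \<longleftrightarrow> wlat d (x, y, p, q) \<and> dle (d - 2) (q + V * y)"

fun latM :: "int \<Rightarrow> vec \<Rightarrow> bool" where
  "latM d (x, y, p, q) \<longleftrightarrow> wlat d (x, y, p, q) \<and> dle (d - 2) (p + V * y)"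

lemma nact_s: "nact Ss (x, y, p, q) = (- (Vi * x), x + p + q + V * y, - (Vi * p), - (Vi * q))"
  by (rule nact_simps)

lemma nact_ts: "nact St (nact Ss (x, y, p, q)) =
   (V * y + p + q - Vi * (X * q), - (Vi * x) - Vi * p - Vi * q - y, x + q + V * y, Vi * (Vi * q))"
  by (simp add: nact_simps algebra_simps)

lemma nact_rs: "nact Sr (nact Ss (x, y, p, q)) =
   (V * y + p + q - Vi * (X * p), - (Vi * x) - Vi * p - Vi * q - y, Vi * (Vi * p), x + p + V * y)"
  by (simp add: nact_simps algebra_simps)

lemma nact_rts: "nact Sr (nact St (nact Ss (x, y, p, q))) =
   (X * x - Vi * x + V * (V * y) + V * (X * y) - y + V * p - Vi * p + V * q - Vi * q,
    Vi * (Vi * x) + Vi * y + Vi * (Vi * p) + Vi * (Vi * q),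
    - (Vi * x) - y - Vi * q, - (Vi * x) - y - Vi * p)"
  by (simp add: nact_simps algebra_simps)

lemma nact_trs: "nact St (nact Sr (nact Ss n)) = nact Sr (nact St (nact Ss n))"
  by (rule nact_rt[symmetric])

text \<open>Here and in the next formulas \<open>q + V * y\<close>, or \<open>p + V * y\<close>, is
  kept together, because the lattice conditions bound the sum better than its terms.\<close>

lemma nact_sts: "nact Ss (nact St (nact Ss (x, y, p, q))) =
   (- y - Vi * p - Vi * q + Vi * (Vi * (X * q)),
    (q + V * y) - Vi * (X * q) + Vi * (Vi * q), - (Vi * x) - y - Vi * q, - (Vi * (Vi * (Vi * q))))"
  by (simp add: nact_simps algebra_simps)

lemma nact_srs: "nact Ss (nact Sr (nact Ss (x, y, p, q))) =
   (- y - Vi * p - Vi * q + Vi * (Vi * (X * p)),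
    (p + V * y) - Vi * (X * p) + Vi * (Vi * p), - (Vi * (Vi * (Vi * p))), - (Vi * x) - y - Vi * p)"
  by (simp add: nact_simps algebra_simps)

lemma nact_rsts: "nact Sr (nact Ss (nact St (nact Ss (x, y, p, q)))) =
   (Vi * (Vi * q) - Vi * (X * x) - X * y - p - Vi * (X * q),
    Vi * (Vi * (X * q)) - Vi * (q + V * y) - Vi * (Vi * (Vi * q)),
    Vi * (Vi * x) + Vi * y + Vi * (Vi * q), (q + V * y) - Vi * (X * q))"
  by (simp add: nact_simps algebra_simps)

lemma nact_tsrs: "nact St (nact Ss (nact Sr (nact Ss (x, y, p, q)))) =
   (Vi * (Vi * p) - Vi * (X * x) - X * y - q - Vi * (X * p),
    Vi * (Vi * (X * p)) - Vi * (p + V * y) - Vi * (Vi * (Vi * p)),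
    (p + V * y) - Vi * (X * p), Vi * (Vi * x) + Vi * y + Vi * (Vi * p))"
  by (simp add: nact_simps algebra_simps)

text \<open>Both cancellations are automatic after \<open>rts\<close>: by the identities
  \<open>e\<close> the critical sums collapse to \<open>Vi * q\<close> and
  \<open>Vi * p\<close>.\<close>

lemma wlat_rts: "wlat d n \<Longrightarrow> latP d (nact Sr (nact St (nact Ss n))) \<and> latM d (nact Sr (nact St (nact Ss n)))"
proof (cases n)
  case (fields x y p q)
  assume "wlat d n"
  then have w: "dle d x" "dle (d - 2) y" "dle (d - 1) p" "dle (d - 1) q" by (simp_all add: fields)
  note m = w[THEN dle_mono]
  have e: "(- (Vi * x) - y - Vi * p) + V * (Vi * (Vi * x) + Vi * y + Vi * (Vi * p) + Vi * (Vi * q)) = Vi * q"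
    "(- (Vi * x) - y - Vi * q) + V * (Vi * (Vi * x) + Vi * y + Vi * (Vi * p) + Vi * (Vi * q)) = Vi * p"
    by (simp_all add: algebra_simps)
  show ?thesis unfolding fields nact_rts latP.simps latM.simps wlat.simps e
    by (intro conjI dle_intros; rule m(1) m(2) m(3) m(4); simp)
qed

lemma latP_rsts: "latP d n \<Longrightarrow> latP (d - 1) (nact Sr (nact Ss (nact St (nact Ss n))))"
proof (cases n)
  case (fields x y p q)
  assume "latP d n"
  then have w: "dle d x" "dle (d - 2) y" "dle (d - 1) p" "dle (d - 1) q" and c: "dle (d - 2) (q + V * y)"
    by (simp_all add: fields)
  have e: "((q + V * y) - Vi * (X * q)) + V * (Vi * (Vi * (X * q)) - Vi * (q + V * y) - Vi * (Vi * (Vi * q))) =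
    - (Vi * (Vi * q))" by (simp add: algebra_simps)
  note m = w[THEN dle_mono] and cm = c[THEN dle_mono]
  show ?thesis unfolding fields nact_rsts latP.simps wlat.simps e
    by (intro conjI dle_diff dle_uminus dle_V dle_Vi dle_X dle_add[of _ _ "Vi * (Vi * q)"]
        dle_add[of _ _ "Vi * y"]; rule m(1) m(2) m(3) m(4) cm; simp)
qed

lemma latM_tsrs: "latM d n \<Longrightarrow> latM (d - 1) (nact St (nact Ss (nact Sr (nact Ss n))))"
proof (cases n)
  case (fields x y p q)
  assume "latM d n"
  then have w: "dle d x" "dle (d - 2) y" "dle (d - 1) p" "dle (d - 1) q" and c: "dle (d - 2) (p + V * y)"
    by (simp_all add: fields)
  have e: "((p + V * y) - Vi * (X * p)) + V * (Vi * (Vi * (X * p)) - Vi * (p + V * y) - Vi * (Vi * (Vi * p))) =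
    - (Vi * (Vi * p))" by (simp add: algebra_simps)
  note m = w[THEN dle_mono] and cm = c[THEN dle_mono]
  show ?thesis unfolding fields nact_tsrs latM.simps wlat.simps e
    by (intro conjI dle_diff dle_uminus dle_V dle_Vi dle_X dle_add[of _ _ "Vi * (Vi * p)"]
        dle_add[of _ _ "Vi * y"]; rule m(1) m(2) m(3) m(4) cm; simp)
qed

lemma wlat_vdle:
  assumes "wlat d n"
  shows "vdle d n" "vdle d (nact Ss n)" "vdle d (nact St (nact Ss n))" "vdle d (nact Sr (nact Ss n))"
    "vdle d (nact Ss (nact St (nact Ss n)))" "vdle d (nact Ss (nact Sr (nact Ss n)))"
proof -
  obtain x y p q where n: "n = (x, y, p, q)" by (cases n)
  have w: "dle d x" "dle (d - 2) y" "dle (d - 1) p" "dle (d - 1) q" using assms by (simp_all add: n)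
  note m = w[THEN dle_mono]
  show "vdle d n" "vdle d (nact Ss n)" "vdle d (nact St (nact Ss n))" "vdle d (nact Sr (nact Ss n))"
    "vdle d (nact Ss (nact St (nact Ss n)))" "vdle d (nact Ss (nact Sr (nact Ss n)))"
    unfolding n nact_srs nact_sts
    unfolding nact_rs nact_ts
    unfolding nact_s vdle.simps
    by (intro conjI dle_intros; rule m(1) m(2) m(3) m(4); simp)+
qed

lemma latP_mono: "latP d n \<Longrightarrow> d \<le> e \<Longrightarrow> latP e n"
  and latM_mono: "latM d n \<Longrightarrow> d \<le> e \<Longrightarrow> latM e n"
  by (cases n; auto elim!: dle_mono)+

lemma latP_wlat: "latP d n \<Longrightarrow> wlat d n" and latM_wlat: "latM d n \<Longrightarrow> wlat d n"
  by (cases n; simp)+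

text \<open>Chebyshev polynomials of the second kind, normalised by \<open>U\<^sub>k(z + 1/z) = (z\<^sup>k\<^sup>+\<^sup>1 - z\<^sup>-\<^sup>k\<^sup>-\<^sup>1)/(z - 1/z)\<close>.\<close>

fun cheb :: "nat \<Rightarrow> int poly" where
  "cheb 0 = 1"
| "cheb (Suc 0) = [:0, 1:]"
| "cheb (Suc (Suc k)) = [:0, 1:] * cheb (Suc k) - cheb k"

definition cheb_prev :: "nat \<Rightarrow> int poly" where
  "cheb_prev k = (case k of 0 \<Rightarrow> 0 | Suc j \<Rightarrow> cheb j)"

lemma cheb_Suc: "cheb (Suc k) = [:0, 1:] * cheb k - cheb_prev k"
  by (cases k) (simp_all add: cheb_prev_def one_pCons)

lemma coeff_cheb: "n \<le> j \<Longrightarrow> coeff (cheb n) j = (if j = n then 1 else 0)"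
proof (induction n arbitrary: j rule: cheb.induct)
  case 1
  then show ?case by (simp add: coeff_1)
next
  case 2
  then show ?case by (cases j) (auto simp: coeff_pCons split: nat.split)
next
  case (3 k)
  then obtain i where "j = Suc i" by (cases j) auto
  then show ?case using 3 by (simp add: coeff_pCons)
qed

text \<open>\<open>cheb k\<close> is monic of degree \<open>k\<close>, so the coefficients vanish
  from the top downwards.\<close>

lemma cheb_independent: "(\<Sum>k\<le>n. smult (c k) (cheb k)) = 0 \<Longrightarrow> k \<le> n \<Longrightarrow> c k = 0"
proof (induction n)
  case 0
  then show ?case by simp
next
  case (Suc n)
  have "coeff (\<Sum>k\<le>n. smult (c k) (cheb k)) (Suc n) = 0"
    unfolding coeff_sum by (intro sum.neutral) (simp add: coeff_cheb)
  then have "c (Suc n) = 0"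
    using arg_cong[OF Suc.prems(1), of "\<lambda>f. coeff f (Suc n)"] coeff_cheb[of "Suc n" "Suc n"]
    by (simp del: cheb.simps)
  then show ?case using Suc by (cases "k = Suc n") auto
qed

text \<open>Exact leading terms along the core. The coordinate \<open>y\<close> is followed at
  exponent -2 because \<open>rts\<close> feeds \<open>V * V * y\<close> into
  \<open>x\<close>.\<close>

fun lat0 :: "nat \<Rightarrow> vec \<Rightarrow> bool" where
  "lat0 k (x, y, p, q) \<longleftrightarrow> latP 0 (x, y, p, q) \<and> latM 0 (x, y, p, q) \<and>
     lead 0 x = cheb k \<and> lead (-2) y = cheb_prev k"

lemma lat0_lat: "lat0 k n \<Longrightarrow> latP 0 n \<and> latM 0 n"
  by (cases n) simp

lemma lat0_rts: "lat0 k n \<Longrightarrow> lat0 (Suc k) (nact Sr (nact St (nact Ss n)))"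
proof (cases n)
  case (fields x y p q)
  assume l: "lat0 k n"
  then have w: "dle 0 x" "dle (-2) y" "dle (-1) p" "dle (-1) q"
    and c: "dle (-2) (q + V * y)" "dle (-2) (p + V * y)"
    and ld: "lead 0 x = cheb k" "lead (-2) y = cheb_prev k"
    by (simp_all add: fields)
  \<comment> \<open>The two cancellation conditions fix the leading parts of \<open>p\<close> and
    \<open>q\<close>. The terms \<open>V * V * y\<close>, \<open>V * p\<close> and
    \<open>V * q\<close> then add up to minus the previous polynomial, which with
    \<open>X * x\<close> gives the Chebyshev recursion.\<close>
  have pq: "lead (-1) p = - cheb_prev k" "lead (-1) q = - cheb_prev k"
    using lead_dle[OF c(2), of "-1"] lead_dle[OF c(1), of "-1"] ld(2)
    by (simp_all add: lead_simps eq_neg_iff_add_eq_0)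
  have z: "lead 1 x = 0" "lead (-1) y = 0" "lead 0 y = 0" "lead 0 p = 0" "lead 0 q = 0" "lead 1 p = 0" "lead 1 q = 0"
    using w by (auto intro: lead_dle)
  have "wlat 0 n" using w by (simp add: fields)
  from wlat_rts[OF this] show ?thesis unfolding fields nact_rts
    by (simp add: lead_simps ld pq z cheb_Suc cheb_prev_def[of "Suc k"] del: latP.simps latM.simps cheb.simps)
qed

lemma lat0_ts:
  assumes "lat0 k n"
  shows "vlead 0 (nact St (nact Ss n)) = (0, 0, cheb k, 0)" "vlead 0 (nact Sr (nact Ss n)) = (0, 0, 0, cheb k)"
    "vlead 0 n = (cheb k, 0, 0, 0)"
proof -
  obtain x y p q where n: "n = (x, y, p, q)" by (cases n)
  have w: "dle 0 x" "dle (-2) y" "dle (-1) p" "dle (-1) q" and ld: "lead 0 x = cheb k"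
    using assms by (simp_all add: n)
  have z: "lead 1 x = 0" "lead (-1) y = 0" "lead 0 y = 0" "lead 0 p = 0" "lead 0 q = 0"
    "lead 1 p = 0" "lead 1 q = 0" "lead 2 q = 0" "lead 2 p = 0"
    using w by (auto intro: lead_dle)
  show "vlead 0 (nact St (nact Ss n)) = (0, 0, cheb k, 0)" "vlead 0 (nact Sr (nact Ss n)) = (0, 0, 0, cheb k)"
    "vlead 0 n = (cheb k, 0, 0, 0)"
    unfolding n nact_ts nact_rs by (simp_all add: lead_simps z ld)
qed

subsection \<open>Bounds for the action of the standard basis\<close>

text \<open>Elements with left descents \<open>r\<close> and \<open>t\<close> away from the
  diagonal, where one degree is lost. The bound 4 makes \<open>3 + c - b\<close> negative, so that
  after \<open>rs\<close> the letter \<open>s\<close> goes down and only \<open>ts\<close> can be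
  followed by \<open>s\<close>.\<close>

definition topP :: "W \<Rightarrow> vec \<Rightarrow> bool" where
  "topP z n \<longleftrightarrow> (\<exists>b c. pt z = (3 - b - c, b, c) \<and> b < 0 \<and> c < 0 \<and> b - c \<ge> 4) \<and> latP (-1) n"

definition topM :: "W \<Rightarrow> vec \<Rightarrow> bool" where
  "topM z n \<longleftrightarrow> (\<exists>b c. pt z = (3 - b - c, b, c) \<and> b < 0 \<and> c < 0 \<and> c - b \<ge> 4) \<and> latM (-1) n"

definition top0 :: "W \<Rightarrow> vec \<Rightarrow> bool" where
  "top0 z n \<longleftrightarrow> (\<exists>k. z = core k 1 \<and> lat0 k n)"

text \<open>
  Here \<open>n\<close> is \<open>q\<^sup>-\<^sup>1 T\<^sub>z\<close> applied to the first basis vector. The left descent sets of \<open>z\<close> in the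
  six cases are \<open>rt\<close>, \<open>s\<close>, \<open>t\<close>, \<open>r\<close>, \<open>st\<close>, \<open>rs\<close>.
\<close>

definition good :: "W \<Rightarrow> vec \<Rightarrow> bool" where
  "good z n \<longleftrightarrow> (\<exists>y m.
     (top0 y m \<or> topP y m \<or> topM y m) \<and>
       (z = y \<and> n = m \<or> z = gen Ss * y \<and> n = nact Ss m \<or>
        z = gen St * (gen Ss * y) \<and> n = nact St (nact Ss m) \<or>
        z = gen Sr * (gen Ss * y) \<and> n = nact Sr (nact Ss m)) \<or>
     (top0 y m \<or> topP y m) \<and> z = gen Ss * (gen St * (gen Ss * y)) \<and> n = nact Ss (nact St (nact Ss m)) \<or>
     (top0 y m \<or> topM y m) \<and> z = gen Ss * (gen Sr * (gen Ss * y)) \<and> n = nact Ss (nact Sr (nact Ss m)))"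

lemma pt_core_one: "pt (core m 1) = (3 - (- 1 - 3 * int m) - (- 1 - 3 * int m), - 1 - 3 * int m, - 1 - 3 * int m)"
  by (induction m) (simp_all add: pt_gen_one)

lemma top_pt:
  assumes "top0 y m \<or> topP y m \<or> topM y m"
  shows "\<exists>b c. pt y = (3 - b - c, b, c) \<and> b < 0 \<and> c < 0 \<and> (top0 y m \<and> b = c \<or> topP y m \<and> b - c \<ge> 4 \<or> topM y m \<and> c - b \<ge> 4)"
  using assms unfolding topP_def topM_def top0_def using pt_core_one by fastforce

lemma top_ptP: "top0 y m \<or> topP y m \<Longrightarrow> \<exists>b c. pt y = (3 - b - c, b, c) \<and> b < 0 \<and> c < 0 \<and> b - c \<ge> 0"
  and top_ptM: "top0 y m \<or> topM y m \<Longrightarrow> \<exists>b c. pt y = (3 - b - c, b, c) \<and> b < 0 \<and> c < 0 \<and> c - b \<ge> 0"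
  using pt_core_one by (fastforce simp: top0_def topP_def topM_def)+

lemma top_rts:
  assumes "top0 y m \<or> topP y m \<or> topM y m"
  shows "top0 (gen Sr * (gen St * (gen Ss * y))) (nact Sr (nact St (nact Ss m))) \<or>
    topP (gen Sr * (gen St * (gen Ss * y))) (nact Sr (nact St (nact Ss m))) \<or>
    topM (gen Sr * (gen St * (gen Ss * y))) (nact Sr (nact St (nact Ss m)))"
  using assms
proof (elim disjE)
  assume "top0 y m"
  then obtain k where k: "y = core k 1" "lat0 k m" by (auto simp: top0_def)
  then have "gen Sr * (gen St * (gen Ss * y)) = core (Suc k) 1" by simp
  then show ?thesis using lat0_rts[OF k(2)] unfolding top0_def by blast
next
  assume "topP y m"
  then obtain b c where *: "pt y = (3 - b - c, b, c)" "b < 0" "c < 0" "b - c \<ge> 4" and l: "latP (-1) m"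
    by (auto simp: topP_def)
  have "pt (gen Sr * (gen St * (gen Ss * y))) = (3 - (c - 3) - (b - 3), c - 3, b - 3)" using * by simp
  then have "topM (gen Sr * (gen St * (gen Ss * y))) (nact Sr (nact St (nact Ss m)))"
    unfolding topM_def using * wlat_rts[OF latP_wlat[OF l]] by (intro conjI exI[of _ "c - 3"] exI[of _ "b - 3"]) auto
  then show ?thesis by blast
next
  assume "topM y m"
  then obtain b c where *: "pt y = (3 - b - c, b, c)" "b < 0" "c < 0" "c - b \<ge> 4" and l: "latM (-1) m"
    by (auto simp: topM_def)
  have "pt (gen Sr * (gen St * (gen Ss * y))) = (3 - (c - 3) - (b - 3), c - 3, b - 3)" using * by simp
  then have "topP (gen Sr * (gen St * (gen Ss * y))) (nact Sr (nact St (nact Ss m)))"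
    unfolding topP_def using * wlat_rts[OF latM_wlat[OF l]] by (intro conjI exI[of _ "c - 3"] exI[of _ "b - 3"]) auto
  then show ?thesis by blast
qed

lemma top_rsts:
  assumes "top0 y m \<or> topP y m"
  shows "topP (gen Sr * (gen Ss * (gen St * (gen Ss * y)))) (nact Sr (nact Ss (nact St (nact Ss m))))"
proof -
  have l: "latP 0 m" using assms latP_mono[of "-1" m 0] by (auto simp: top0_def topP_def dest: lat0_lat)
  obtain b c where *: "pt y = (3 - b - c, b, c)" "b < 0" "c < 0" "b - c \<ge> 0"
    using top_ptP[OF assms] by blast
  have "pt (gen Sr * (gen Ss * (gen St * (gen Ss * y)))) = (3 - b - (c - 6), b, c - 6)" using * by simp
  then show ?thesis unfolding topP_def using * latP_rsts[OF l]
    by (intro conjI exI[of _ b] exI[of _ "c - 6"]) auto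
qed

lemma top_tsrs:
  assumes "top0 y m \<or> topM y m"
  shows "topM (gen St * (gen Ss * (gen Sr * (gen Ss * y)))) (nact St (nact Ss (nact Sr (nact Ss m))))"
proof -
  have l: "latM 0 m" using assms latM_mono[of "-1" m 0] by (auto simp: top0_def topM_def dest: lat0_lat)
  obtain b c where *: "pt y = (3 - b - c, b, c)" "b < 0" "c < 0" "c - b \<ge> 0"
    using top_ptM[OF assms] by blast
  have "pt (gen St * (gen Ss * (gen Sr * (gen Ss * y)))) = (3 - (b - 6) - c, b - 6, c)" using * by simp
  then show ?thesis unfolding topM_def using * latM_tsrs[OF l]
    by (intro conjI exI[of _ "b - 6"] exI[of _ c]) auto
qed

lemma goodI:
  assumes "top0 y m \<or> topP y m \<or> topM y m"
  shows "good y m" "good (gen Ss * y) (nact Ss m)" "good (gen St * (gen Ss * y)) (nact St (nact Ss m))"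
    "good (gen Sr * (gen Ss * y)) (nact Sr (nact Ss m))"
  using assms unfolding good_def by blast+

text \<open>Signs of heights decide which letters lengthen each shape. Completing
  \<open>rts\<close>, \<open>rsts\<close> or \<open>tsrs\<close> leads back to the first shape;
  \<open>rts\<close> reflects the position in the diagonal and so exchanges \<open>topP\<close> and
  \<open>topM\<close>.\<close>

lemma good_step:
  assumes "good z n" "\<not> desc s z"
  shows "good (gen s * z) (nact s n)"
proof -
  from assms(1) obtain y m where
    "(top0 y m \<or> topP y m \<or> topM y m) \<and>
       (z = y \<and> n = m \<or> z = gen Ss * y \<and> n = nact Ss m \<or>
        z = gen St * (gen Ss * y) \<and> n = nact St (nact Ss m) \<or>
        z = gen Sr * (gen Ss * y) \<and> n = nact Sr (nact Ss m)) \<or>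
     (top0 y m \<or> topP y m) \<and> z = gen Ss * (gen St * (gen Ss * y)) \<and> n = nact Ss (nact St (nact Ss m)) \<or>
     (top0 y m \<or> topM y m) \<and> z = gen Ss * (gen Sr * (gen Ss * y)) \<and> n = nact Ss (nact Sr (nact Ss m))"
    unfolding good_def by blast
  then consider
    (a) "top0 y m \<or> topP y m \<or> topM y m" "z = y" "n = m"
    | (b) "top0 y m \<or> topP y m \<or> topM y m" "z = gen Ss * y" "n = nact Ss m"
    | (c) "top0 y m \<or> topP y m \<or> topM y m" "z = gen St * (gen Ss * y)" "n = nact St (nact Ss m)"
    | (d) "top0 y m \<or> topP y m \<or> topM y m" "z = gen Sr * (gen Ss * y)" "n = nact Sr (nact Ss m)"
    | (e) "top0 y m \<or> topP y m" "z = gen Ss * (gen St * (gen Ss * y))" "n = nact Ss (nact St (nact Ss m))"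
    | (f) "top0 y m \<or> topM y m" "z = gen Ss * (gen Sr * (gen Ss * y))" "n = nact Ss (nact Sr (nact Ss m))"
    by blast
  then show ?thesis
  proof cases
    case a
    obtain b c where "pt y = (3 - b - c, b, c)" "b < 0" "c < 0" using top_pt[OF a(1)] by blast
    then have "s = Ss" using assms(2) a(2) by (cases s) (auto simp: desc_iff_height)
    then show ?thesis using goodI[OF a(1)] a by simp
  next
    case b
    obtain b' c where "pt y = (3 - b' - c, b', c)" "b' < 0" "c < 0" using top_pt[OF b(1)] by blast
    then have "s \<noteq> Ss" using assms(2) b(2) by (auto simp: desc_iff_height)
    then show ?thesis using goodI[OF b(1)] b by (cases s) simp_all
  next
    case c
    obtain b c' where *: "pt y = (3 - b - c', b, c')" "b < 0" "c' < 0"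
      "top0 y m \<and> b = c' \<or> topP y m \<and> b - c' \<ge> 4 \<or> topM y m \<and> c' - b \<ge> 4" using top_pt[OF c(1)] by blast
    have "s \<noteq> St" using assms(2) c(2) * by (auto simp: desc_iff_height)
    then show ?thesis
    proof (cases s)
      case Sr
      then show ?thesis using goodI(1)[OF top_rts[OF c(1)]] c by simp
    next
      case Ss
      then have "height Ss (pt z) > 0" using assms(2) not_desc_height by blast
      then have "top0 y m \<or> topP y m" using * c(2) by auto
      then show ?thesis using Ss c(2,3) unfolding good_def by blast
    qed simp
  next
    case d
    obtain b c' where *: "pt y = (3 - b - c', b, c')" "b < 0" "c' < 0"
      "top0 y m \<and> b = c' \<or> topP y m \<and> b - c' \<ge> 4 \<or> topM y m \<and> c' - b \<ge> 4" using top_pt[OF d(1)] by blast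
    have "s \<noteq> Sr" using assms(2) d(2) * by (auto simp: desc_iff_height)
    then show ?thesis
    proof (cases s)
      case St
      then show ?thesis using goodI(1)[OF top_rts[OF d(1)]] d by (simp add: nact_trs gen_rt_left)
    next
      case Ss
      then have "height Ss (pt z) > 0" using assms(2) not_desc_height by blast
      then have "top0 y m \<or> topM y m" using * d(2) by auto
      then show ?thesis using Ss d(2,3) unfolding good_def by blast
    qed simp
  next
    case e
    obtain b c where *: "pt y = (3 - b - c, b, c)" "b < 0" "c < 0" "b - c \<ge> 0" using top_ptP[OF e(1)] by blast
    then have "s = Sr" using assms(2) e(2) * by (cases s) (auto simp: desc_iff_height)
    then show ?thesis using goodI(1)[of _ "nact Sr (nact Ss (nact St (nact Ss m)))"] top_rsts[OF e(1)] e by simp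
  next
    case f
    obtain b c where *: "pt y = (3 - b - c, b, c)" "b < 0" "c < 0" "c - b \<ge> 0" using top_ptM[OF f(1)] by blast
    then have "s = St" using assms(2) f(2) * by (cases s) (auto simp: desc_iff_height)
    then show ?thesis using goodI(1)[of _ "nact St (nact Ss (nact Sr (nact Ss m)))"] top_tsrs[OF f(1)] f by simp
  qed
qed

lemma top_wlat: "top0 y m \<or> topP y m \<or> topM y m \<Longrightarrow> wlat 0 m"
  using lat0_lat latP_wlat latM_wlat latP_mono[of "-1" m 0] latM_mono[of "-1" m 0]
  unfolding top0_def topP_def topM_def by (metis neg_le_0_iff_le zero_le_one)

lemma good_vdle: "good z n \<Longrightarrow> vdle 0 n"
  unfolding good_def using top_wlat wlat_vdle by (elim exE disjE conjE) blast+

lemma good_two_desc: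
  assumes "good z n" "desc Sr z" "desc St z"
  shows "top0 z n \<or> topP z n \<or> topM z n"
proof -
  have "\<not> (desc Sr (gen Ss * y) \<and> desc St (gen Ss * y))"
    "\<not> desc Sr (gen St * (gen Ss * y))" "\<not> desc St (gen Sr * (gen Ss * y))"
    "\<not> desc Sr (gen Ss * (gen St * (gen Ss * y)))" "\<not> desc St (gen Ss * (gen Sr * (gen Ss * y)))"
    if t: "top0 y m \<or> topP y m \<or> topM y m" for y m
  proof -
    obtain b c where "pt y = (3 - b - c, b, c)" "b < 0" "c < 0" using top_pt[OF t] by blast
    then show "\<not> (desc Sr (gen Ss * y) \<and> desc St (gen Ss * y))"
      "\<not> desc Sr (gen St * (gen Ss * y))" "\<not> desc St (gen Sr * (gen Ss * y))"
      "\<not> desc Sr (gen Ss * (gen St * (gen Ss * y)))" "\<not> desc St (gen Ss * (gen Sr * (gen Ss * y)))"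
      by (auto simp: desc_iff_height)
  qed
  then show ?thesis using assms unfolding good_def by metis
qed

text \<open>Write \<open>z = x rt\<close> reduced; a left descent of \<open>x\<close> can be removed
  without touching the right descents \<open>r\<close> and \<open>t\<close>.\<close>

lemma rt_induct:
  assumes "rdesc Sr z" "rdesc St z" "z \<noteq> core 0 1"
  obtains s where "desc s z" "rdesc Sr (gen s * z)" "rdesc St (gen s * z)"
proof -
  define x where "x = z * (gen St * gen Sr)"
  have l: "len z = 2 + len x"
    using two_desc_rt[OF assms(1,2)] len_inverse[of x] by (simp add: x_def mult.assoc)
  have z: "z = x * (gen Sr * gen St)"
    by (simp add: x_def mult.assoc)
  have "x \<noteq> 1" using z assms(3) by auto
  then obtain s where s: "desc s x" using desc_exists by blast
  have sz: "gen s * z = (gen s * x) * (gen Sr * gen St)" by (simp add: z mult.assoc)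
  have lx: "len x = Suc (len (gen s * x))" by (rule len_desc[OF s])
  have "len (gen s * z) \<le> len (gen s * x) + 2"
    unfolding sz using len_times_le[of "gen s * x" "gen Sr * gen St"] len_word_le[of "[Sr, St]"]
    by (simp add: word_Cons)
  then have d: "desc s z" and lz: "len (gen s * z) = len (gen s * x) + 2"
    using l lx len_gen_cases[of s z] unfolding desc_def by linarith+
  have e: "gen s * z * gen Sr = gen s * x * gen St" "gen s * z * gen St = gen s * x * gen Sr"
    unfolding sz mult.assoc by (simp_all add: gen_rt_left)
  have "len (gen s * z * gen Sr) < len (gen s * z)" "len (gen s * z * gen St) < len (gen s * z)"
    unfolding e using lz len_gen_right_cases[of "gen s * x" St] len_gen_right_cases[of "gen s * x" Sr]
    by linarith+
  then show thesis using that[OF d] unfolding rdesc_def by blast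
qed

text \<open>Origin of the normalisation by \<open>v^(-2)\<close>: both letters multiply the first
  basis vector by \<open>v\<close>.\<close>

lemma wact_rt: "wact (core 0 1) = (V * V, 0, 0, 0)"
proof -
  have "\<not> desc St 1" "\<not> desc Sr (gen St)" by (auto simp: desc_iff_height pt_gen_one)
  then show ?thesis using wact_gen[of St 1] wact_gen[of Sr "gen St"] by (simp add: wact_one nact_simps)
qed

lemma good_wact:
  assumes "rdesc Sr z" "rdesc St z"
  shows "good z (vscale (half_q_pow (-2)) (wact z))"
  using assms
proof (induction "len z" arbitrary: z rule: less_induct)
  case less
  show ?case
  proof (cases "z = core 0 1")
    case True
    have "vscale (half_q_pow (-2)) (wact z) = (1, 0, 0, 0)"
      unfolding True wact_rt by (simp add: V_def half_q_pow_add one_pCons)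
    moreover have "lat0 0 (1, 0, 0, 0)"
    proof -
      have "dle 0 1" "lead 0 1 = 1" by (auto simp: dle_def lookup_one coeff_1 when_def intro: poly_eqI)
      then show ?thesis by (simp add: cheb_prev_def lead_simps)
    qed
    ultimately show ?thesis using goodI(1)[of z] True unfolding top0_def by metis
  next
    case False
    then obtain s where s: "desc s z" "rdesc Sr (gen s * z)" "rdesc St (gen s * z)"
      using rt_induct less.prems by blast
    define y where "y = gen s * z"
    have z: "z = gen s * y" and nd: "\<not> desc s y" using s(1) by (simp_all add: y_def)
    have "len y < len z" using len_desc[OF s(1)] by (simp add: y_def)
    then have "good y (vscale (half_q_pow (-2)) (wact y))" using less.hyps s y_def by blast
    from good_step[OF this nd] show ?thesis by (simp add: z wact_gen[OF nd] nact_scale)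
  qed
qed

subsection \<open>The image of the Kazhdan-Lusztig basis\<close>

definition binv :: "laurent poly \<Rightarrow> bool" where
  "binv f \<longleftrightarrow> (\<forall>i. laurent_bar (coeff f i) = coeff f i)"

fun vbinv :: "vec \<Rightarrow> bool" where
  "vbinv (x, y, p, q) \<longleftrightarrow> binv x \<and> binv y \<and> binv p \<and> binv q"

lemma binv_simps: "binv 0" "binv 1" "binv f \<Longrightarrow> binv g \<Longrightarrow> binv (f + g)" "binv f \<Longrightarrow> binv (- f)"
  "binv f \<Longrightarrow> binv (X * f)" "binv f \<Longrightarrow> binv ((V + Vi) * f)" "binv f \<Longrightarrow> binv (smult (of_int c) f)"
proof -
  have u: "laurent_bar (- a) = - laurent_bar a" for a
    using laurent_bar_minus[of 0 a] by simp
  show "binv 0" "binv 1" "binv f \<Longrightarrow> binv g \<Longrightarrow> binv (f + g)" "binv f \<Longrightarrow> binv (- f)"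
    "binv f \<Longrightarrow> binv (X * f)" "binv f \<Longrightarrow> binv (smult (of_int c) f)"
    by (auto simp: binv_def laurent_bar_add u coeff_X coeff_1 laurent_bar_mult split: nat.split)
  show "binv f \<Longrightarrow> binv ((V + Vi) * f)"
    by (simp add: binv_def ring_distribs laurent_bar_add laurent_bar_mult add.commute)
qed

lemma vbinv_cact: "vbinv n \<Longrightarrow> vbinv (cact s n)"
  by (cases n; cases s) (auto intro!: binv_simps)

lemma vbinv_diff: "vbinv n \<Longrightarrow> vbinv m \<Longrightarrow> vbinv (n - m)"
  by (cases n; cases m) (simp, metis add_uminus_conv_diff binv_simps(3,4))

lemma vbinv_of_int: "vbinv n \<Longrightarrow> vbinv (vscale (of_int c) n)"
  by (cases n) (simp add: binv_simps)

lemma vbinv_sum: "(\<And>i. i \<in> A \<Longrightarrow> vbinv (f i)) \<Longrightarrow> vbinv (sum f A)"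
proof (induction A rule: infinite_finite_induct)
  case (insert x A)
  have "vbinv (n + m)" if "vbinv n" "vbinv m" for n m
    using that by (cases n; cases m) (simp add: binv_simps)
  with insert show ?case by simp
qed (simp_all add: zero_prod_def binv_simps)

lemma kl_basis_one: "kl_basis 1 = T_basis 1"
proof -
  have "is_klh 1 (T_basis 1)" by (auto simp: is_klh_def co_T_basis)
  then show ?thesis using is_klh_unique is_klh_kl_basis by blast
qed

lemma kl_basis_rt: "kl_basis (core 0 1) = cop Sr (cop St (T_basis 1))"
proof -
  have d: "\<not> desc St 1" "\<not> desc Sr (gen St)" by (auto simp: desc_iff_height pt_gen_one)
  have lt: "len (gen St) = 1" using len_not_desc[OF d(1)] by simp
  have e1: "{z. z \<le>\<^sub>B 1 \<and> z \<noteq> 1 \<and> desc St z} = {}" using bruhat_le_len by fastforce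
  have e2: "{z. z \<le>\<^sub>B gen St \<and> z \<noteq> gen St \<and> desc Sr z} = {}"
  proof -
    have "z = 1" if "z \<le>\<^sub>B gen St" "z \<noteq> gen St" for z
      using bruhat_le_len[OF that(1)] that(2) lt by simp
    then show ?thesis by fastforce
  qed
  show ?thesis using cop_kl_up[OF d(1)] cop_kl_up[OF d(2)] unfolding e1 e2 by (simp add: kl_basis_one)
qed

lemma mu_rdesc_mono:
  assumes "mu z y \<noteq> 0" "desc s z" "\<not> desc s y" "rdesc a y"
  shows "rdesc a z"
proof -
  have "left_step z y" unfolding left_step_iff using assms by blast
  then show ?thesis using left_step_rdesc assms(4) by blast
qed

text \<open>All terms of the recursion keep \<open>r\<close> and \<open>t\<close> as right descents,
  so it can start from \<open>C_r C_t\<close>, which multiplies the first basis vector by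
  \<open>eta * eta\<close>. Carrying the bar invariant cofactor through the induction makes a
  division unnecessary.\<close>

lemma rep_kl_eta:
  assumes "rdesc Sr w" "rdesc St w"
  shows "\<exists>\<psi>. vbinv \<psi> \<and> rep (kl_basis w) = vscale (eta * eta) \<psi>"
  using assms
proof (induction "len w" arbitrary: w rule: less_induct)
  case less
  show ?case
  proof (cases "w = core 0 1")
    case True
    have e: "V + Vi = [:eta:]" by (simp add: V_def Vi_def eta_def)
    have "rep (T_basis 1) = (1, 0, 0, 0)" by (simp add: rep_T wact_one)
    then have "rep (kl_basis w) = vscale (eta * eta) (1, 0, 0, 0)"
      unfolding True kl_basis_rt by (simp add: rep_cop e one_pCons)
    then show ?thesis using binv_simps(1,2) by (intro exI[of _ "(1, 0, 0, 0)"]) simp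
  next
    case False
    then obtain s where s: "desc s w" "rdesc Sr (gen s * w)" "rdesc St (gen s * w)"
      using rt_induct less.prems by blast
    define y where "y = gen s * w"
    have w: "w = gen s * y" and nd: "\<not> desc s y" using s(1) by (simp_all add: y_def)
    have ly: "len y < len w" using len_desc[OF s(1)] by (simp add: y_def)
    let ?Z = "{z. z \<le>\<^sub>B y \<and> z \<noteq> y \<and> desc s z}"
    have "\<exists>\<psi>. vbinv \<psi> \<and> vscale (of_int (mu z y)) (rep (kl_basis z)) = vscale (eta * eta) \<psi>" if z: "z \<in> ?Z" for z
    proof (cases "mu z y = 0")
      case True
      then show ?thesis by (intro exI[of _ 0]) (simp add: zero_prod_def binv_simps)
    next
      case False
      then have "rdesc Sr z" "rdesc St z" using mu_rdesc_mono[OF False _ nd] z s(2,3) y_def by auto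
      moreover have "len z < len w" using z bruhat_le_len[of z y] ly by auto
      ultimately obtain \<psi> where \<psi>: "vbinv \<psi>" "rep (kl_basis z) = vscale (eta * eta) \<psi>"
        using less.hyps by blast
      then have "vscale (of_int (mu z y)) (rep (kl_basis z)) = vscale (eta * eta) (vscale (of_int (mu z y)) \<psi>)"
        by (simp add: mult_ac)
      then show ?thesis using vbinv_of_int[OF \<psi>(1)] by blast
    qed
    then obtain g where g: "\<And>z. z \<in> ?Z \<Longrightarrow> vbinv (g z) \<and> vscale (of_int (mu z y)) (rep (kl_basis z)) = vscale (eta * eta) (g z)"
      by metis
    obtain \<psi> where \<psi>: "vbinv \<psi>" "rep (kl_basis y) = vscale (eta * eta) \<psi>"
      using less.hyps[OF ly] s(2,3) y_def by blast
    have "kl_basis w = cop s (kl_basis y) - (\<Sum>z\<in>?Z. scale (of_int (mu z y)) (kl_basis z))"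
      using cop_kl_up[OF nd] by (simp add: w)
    then have "rep (kl_basis w) = cact s (rep (kl_basis y)) - (\<Sum>z\<in>?Z. vscale (of_int (mu z y)) (rep (kl_basis z)))"
      by (simp add: rep_simps rep_cop)
    also have "(\<Sum>z\<in>?Z. vscale (of_int (mu z y)) (rep (kl_basis z))) = (\<Sum>z\<in>?Z. vscale (eta * eta) (g z))"
      by (rule sum.cong[OF refl]) (use g in blast)
    finally have "rep (kl_basis w) = vscale (eta * eta) (cact s \<psi> - (\<Sum>z\<in>?Z. g z))"
      by (simp add: \<psi>(2) cact_scale vec.scale_right_diff_distrib vec.scale_sum_right)
    moreover have "vbinv (cact s \<psi> - (\<Sum>z\<in>?Z. g z))"
      by (intro vbinv_diff vbinv_cact \<psi>(1) vbinv_sum) (use g in blast)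
    ultimately show ?thesis by blast
  qed
qed

lemma wact_coset:
  assumes "rdesc Sr z" "rdesc St z"
  shows "vdle 2 (wact z)"
proof -
  let ?n = "vscale (half_q_pow (-2)) (wact z)"
  have "vdle 0 ?n" using good_wact[OF assms] good_vdle by blast
  then have "vdle (2 + 0) (vscale (half_q_pow 2) ?n)"
    by (intro vdle_scale) (simp_all add: lookup_half_q_pow)
  then show ?thesis by (simp add: half_q_pow_add)
qed

lemma wact_right_gen:
  assumes "a \<noteq> Ss" "\<not> rdesc a w"
  shows "wact (w * gen a) = vscale (half_q_pow 1) (wact w)"
proof -
  obtain xs where xs: "word xs = w" "reduced xs" by (rule reduced_wordE)
  have wa: "w * gen a = word (xs @ [a])" using xs(1) by (simp add: times_word[symmetric] word_Cons)
  have "reduced (xs @ [a])" unfolding wa[symmetric]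
    using assms(2) len_gen_right_cases[of w a] xs by (simp add: rdesc_def)
  then have "wact (w * gen a) = foldr nact xs (nact a (1, 0, 0, 0))" unfolding wa by (simp add: wact_word)
  also have "nact a (1, 0, 0, 0) = vscale (half_q_pow 1) (1, 0, 0, 0)"
    using assms(1) by (cases a) (simp_all add: nact_simps V_def)
  also have "foldr nact xs (vscale (half_q_pow 1) n) = vscale (half_q_pow 1) (foldr nact xs n)" for n
    by (induction xs) (simp_all add: nact_scale)
  finally show ?thesis using wact_word[OF xs(2)] xs(1) by simp
qed

text \<open>Lengthening on the right by \<open>r\<close> or \<open>t\<close> multiplies the vector
  by \<open>v\<close>, so it suffices to bound the longest element of the coset, which has both as
  right descents.\<close>

lemma vdle_wact: "vdle 2 (wact w)"
proof -
  have step: "vdle 2 (wact w)" if "vdle 2 (wact (w * gen a))" "a \<noteq> Ss" "\<not> rdesc a w" for w a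
  proof -
    have "vdle (-1 + 2) (vscale (half_q_pow (-1)) (wact (w * gen a)))"
      by (rule vdle_scale[OF _ that(1)]) (simp add: lookup_half_q_pow)
    then have "vdle 1 (wact w)" by (simp add: wact_right_gen[OF that(2,3)] half_q_pow_add)
    then show ?thesis by (rule vdle_mono) simp
  qed
  have r: "vdle 2 (wact w)" if "rdesc Sr w" for w
  proof (cases "rdesc St w")
    case True
    then show ?thesis using wact_coset that by blast
  next
    case False
    \<comment> \<open>Reflecting in the wall \<open>t\<close> leaves the height at \<open>r\<close>
      unchanged.\<close>
    have "rdesc Sr (w * gen St)"
    proof (rule ccontr)
      assume n: "\<not> rdesc Sr (w * gen St)"
      have "desc St (gen St * inverse w)" using False by simp
      moreover have h: "height Sr (pt (gen St * inverse w)) = height Sr (pt (inverse w))"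
        by (cases "pt (inverse w)") simp
      ultimately show False using n that by (simp add: desc_iff_height)
    qed
    moreover have "rdesc St (w * gen St)" using False by simp
    ultimately show ?thesis using step[of w St] wact_coset False by blast
  qed
  show ?thesis
  proof (cases "rdesc Sr w")
    case False
    then have "rdesc Sr (w * gen Sr)" by simp
    then show ?thesis using step[of w Sr] r False by blast
  qed (rule r)
qed

text \<open>Expand \<open>C_w\<close> in normalised \<open>T_u\<close>: each contributes degree at
  most 2, and for \<open>u \<noteq> w\<close> its coefficient has only negative exponents.\<close>

lemma rep_kl_leading: "vdle 1 (rep (kl_basis w) - wact w)"
proof -
  let ?K = "Poly_Mapping.keys (kl_basis w)"
  have K: "w \<in> ?K" by (simp add: in_keys_iff lookup_kl_basis)
  have "rep (kl_basis w) = (\<Sum>u\<in>?K. vscale (pc u w) (wact u))"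
    unfolding rep_def by (rule sum.cong) (simp_all add: lookup_kl_basis half_q_pow_add_left mult_ac half_q_pow_add)
  also have "\<dots> = wact w + (\<Sum>u\<in>?K - {w}. vscale (pc u w) (wact u))"
    by (subst sum.remove[OF _ K]) simp_all
  finally have "rep (kl_basis w) - wact w = (\<Sum>u\<in>?K - {w}. vscale (pc u w) (wact u))" by simp
  moreover have "vdle (-1 + 2) (vscale (pc u w) (wact u))" if "u \<noteq> w" for u
    by (rule vdle_scale[OF _ vdle_wact]) (use pc_neg[OF that] in simp)
  ultimately show ?thesis by (auto intro: vdle_sum)
qed

lemma vlead_rep_kl: "vlead 2 (rep (kl_basis w)) = vlead 2 (wact w)"
  using vlead_add[of 2 "rep (kl_basis w) - wact w" "wact w"] vlead_vdle[OF rep_kl_leading[of w], of 2]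
  by (cases "vlead 2 (wact w)") simp

lemma vdle_rep_kl: "vdle 2 (rep (kl_basis w))"
  using vdle_add[OF vdle_mono[OF rep_kl_leading[of w], of 2] vdle_wact[of w]] by simp

subsection \<open>The values of $\mu$ on the family\<close>

definition integral :: "laurent poly \<Rightarrow> bool" where
  "integral f \<longleftrightarrow> (\<forall>i n. n \<noteq> 0 \<longrightarrow> Poly_Mapping.lookup (coeff f i) n = 0)"

lemma lookup_eta_eta: "Poly_Mapping.lookup (eta * eta * c) n =
  Poly_Mapping.lookup c (n - 2) + 2 * Poly_Mapping.lookup c n + Poly_Mapping.lookup c (n + 2)"
proof -
  have eq: "eta * eta * c = half_q_pow 2 * c + (c + c) + half_q_pow (-2) * c"
    by (simp add: eta_def ring_distribs mult.assoc half_q_pow_add_left half_q_pow_add add_ac)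
  show ?thesis unfolding eq lookup_add lookup_half_q_pow_mult by simp
qed

text \<open>\<open>eta * eta\<close> has top term \<open>v^2\<close>, so the bound 2 on the product
  leaves no positive exponent in \<open>f\<close>; bar invariance then excludes negative
  ones.\<close>

lemma integral_of_binv:
  assumes "binv f" "dle 2 (smult (eta * eta) f)"
  shows "integral f"
  unfolding integral_def
proof (intro allI impI)
  fix i and n :: int assume "n \<noteq> 0"
  let ?c = "coeff f i"
  have pos: "Poly_Mapping.lookup ?c k = 0" if "0 < k" for k
  proof (rule ccontr)
    assume k: "Poly_Mapping.lookup ?c k \<noteq> 0"
    define j where "j = Max (Poly_Mapping.keys ?c)"
    have kk: "k \<in> Poly_Mapping.keys ?c" using k by (simp add: in_keys_iff)
    have j: "j \<in> Poly_Mapping.keys ?c" "k \<le> j" using kk by (auto simp: j_def intro!: Max_in Max_ge)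
    have "Poly_Mapping.lookup ?c l = 0" if "j < l" for l
    proof (rule ccontr)
      assume "Poly_Mapping.lookup ?c l \<noteq> 0"
      then have "l \<in> Poly_Mapping.keys ?c" by (simp add: in_keys_iff)
      then have "l \<le> j" unfolding j_def by (intro Max_ge) auto
      then show False using that by simp
    qed
    then have "Poly_Mapping.lookup (eta * eta * ?c) (j + 2) = Poly_Mapping.lookup ?c j"
      by (simp add: lookup_eta_eta)
    moreover have "Poly_Mapping.lookup (eta * eta * ?c) (j + 2) = 0"
      using assms(2) j(2) \<open>0 < k\<close> unfolding dle_def by (metis add_strict_increasing coeff_smult less_le_trans less_add_same_cancel2)
    ultimately show False using j(1) by (simp add: in_keys_iff)
  qed
  have "Poly_Mapping.lookup (laurent_bar ?c) n = Poly_Mapping.lookup ?c n" using assms(1) by (simp add: binv_def)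
  then show "Poly_Mapping.lookup ?c n = 0" using pos[of n] pos[of "- n"] \<open>n \<noteq> 0\<close> by (cases "0 < n") auto
qed

lemma lead_eta_eta: "integral f \<Longrightarrow> lead 2 (smult (eta * eta) f) = lead 0 f"
  by (rule poly_eqI) (simp add: lookup_eta_eta integral_def)

lemma integral_0: "integral f \<Longrightarrow> lead 0 f = 0 \<Longrightarrow> f = 0"
proof (rule poly_eqI, rule poly_mapping_eqI)
  fix i n assume *: "integral f" "lead 0 f = 0"
  have "coeff (lead 0 f) i = 0" using *(2) by simp
  then show "Poly_Mapping.lookup (coeff f i) n = Poly_Mapping.lookup (coeff 0 i) n"
    using *(1) by (cases "n = 0") (auto simp: integral_def)
qed

lemma integral_X: "integral f \<Longrightarrow> integral (X * f)"
  by (simp add: integral_def coeff_X split: nat.split)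

fun vintegral :: "vec \<Rightarrow> bool" where
  "vintegral (x, y, p, q) \<longleftrightarrow> integral x \<and> integral y \<and> integral p \<and> integral q"

lemma rep_kl_integral:
  assumes "rdesc Sr w" "rdesc St w"
  shows "\<exists>\<psi>. vintegral \<psi> \<and> rep (kl_basis w) = vscale (eta * eta) \<psi> \<and> vlead 0 \<psi> = vlead 2 (wact w)"
proof -
  obtain \<psi> where \<psi>: "vbinv \<psi>" "rep (kl_basis w) = vscale (eta * eta) \<psi>"
    using rep_kl_eta[OF assms] by blast
  obtain x y p q where n: "\<psi> = (x, y, p, q)" by (cases \<psi>)
  have "vdle 2 (vscale (eta * eta) \<psi>)" using vdle_rep_kl \<psi>(2) by metis
  then have i: "integral x" "integral y" "integral p" "integral q"
    using \<psi>(1) by (auto simp: n intro: integral_of_binv)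
  have "vlead 2 (vscale (eta * eta) \<psi>) = vlead 0 \<psi>" by (simp add: n lead_eta_eta i)
  then show ?thesis using \<psi>(2) vlead_rep_kl[of w] i n by (intro exI[of _ \<psi>]) auto
qed

lemma vlead_half: "vlead 0 (vscale (half_q_pow (-2)) n) = vlead 2 n"
  by (cases n) (auto intro!: poly_eqI)

lemma lat0_core: "lat0 m (vscale (half_q_pow (-2)) (wact (core m 1)))"
proof (induction m)
  case 0
  have "vscale (half_q_pow (-2)) (wact (core 0 1)) = (1, 0, 0, 0)"
    unfolding wact_rt by (simp add: V_def half_q_pow_add one_pCons)
  moreover have "dle 0 1" "lead 0 1 = 1" by (auto simp: dle_def lookup_one coeff_1 when_def intro: poly_eqI)
  ultimately show ?case by (simp add: cheb_prev_def lead_simps)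
next
  case (Suc m)
  have "\<not> desc Ss (core m 1)" "\<not> desc St (gen Ss * core m 1)" "\<not> desc Sr (gen St * (gen Ss * core m 1))"
    using desc_fam[of "[]" "[]" Ss m] desc_fam[of "[Ss]" "[]" St m] desc_fam[of "[St, Ss]" "[]" Sr m]
    by (simp_all add: fam_Nil fam_Cons del: desc_gen)
  then show ?case using lat0_rts[OF Suc] by (simp add: wact_gen nact_scale del: lat0.simps desc_gen)
qed

lemma vlead_wact_core: "vlead 2 (wact (core m 1)) = (cheb m, 0, 0, 0)"
  using lat0_ts(3)[OF lat0_core] by (simp add: vlead_half)

lemma vlead_wact_fam:
  "vlead 2 (wact (fam [St, Ss] m [])) = (0, 0, cheb m, 0)"
  "vlead 2 (wact (fam [Sr, Ss] m [])) = (0, 0, 0, cheb m)"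
proof -
  have "\<not> desc Ss (core m 1)" "\<not> desc St (gen Ss * core m 1)" "\<not> desc Sr (gen Ss * core m 1)"
    using desc_fam[of "[]" "[]" Ss m] desc_fam[of "[Ss]" "[]" St m] desc_fam[of "[Ss]" "[]" Sr m]
    by (simp_all add: fam_Nil fam_Cons del: desc_gen)
  then have "vscale (half_q_pow (-2)) (wact (fam [St, Ss] m [])) = nact St (nact Ss (vscale (half_q_pow (-2)) (wact (core m 1))))"
    "vscale (half_q_pow (-2)) (wact (fam [Sr, Ss] m [])) = nact Sr (nact Ss (vscale (half_q_pow (-2)) (wact (core m 1))))"
    by (simp_all add: fam_Nil fam_Cons wact_gen nact_scale del: desc_gen)
  then show "vlead 2 (wact (fam [St, Ss] m [])) = (0, 0, cheb m, 0)"
    "vlead 2 (wact (fam [Sr, Ss] m [])) = (0, 0, 0, cheb m)"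
    using lat0_ts(1,2)[OF lat0_core[of m]] vlead_half by metis+
qed

text \<open>Off the family the lattice index is -1 instead of 0, so nothing reaches the top
  degree.\<close>

lemma vlead_wact_lowest:
  assumes "rdesc Sr z" "rdesc St z" "desc Sr z" "desc St z" "z \<notin> range (\<lambda>k. core k 1)"
  shows "vlead 2 (wact z) = (0, 0, 0, 0)"
proof -
  let ?n = "vscale (half_q_pow (-2)) (wact z)"
  have "topP z ?n \<or> topM z ?n"
    using good_two_desc[OF good_wact[OF assms(1,2)] assms(3,4)] assms(5) by (auto simp: top0_def)
  then have "wlat (-1) ?n" using latP_wlat latM_wlat unfolding topP_def topM_def by blast
  then have "vdle (-1) ?n" by (rule wlat_vdle(1))
  then show ?thesis using vlead_vdle[of "-1" ?n 0] by (simp add: vlead_half)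
qed

lemma rdesc_fam: "\<alpha> \<in> ends \<Longrightarrow> \<beta> \<in> ends \<Longrightarrow>
  rdesc s (fam \<alpha> m \<beta>) \<longleftrightarrow> s \<in> (case \<beta> of [] \<Rightarrow> {Sr, St} | a # _ \<Rightarrow> {a})"
  unfolding inverse_fam by (rule desc_fam)

lemma fam_Suc': "{a, b} = {Sr, St} \<Longrightarrow> fam [] (Suc m) \<beta> = gen b * fam [a, Ss] m \<beta>"
proof -
  assume "{a, b} = {Sr, St}"
  then have "a = St \<and> b = Sr \<or> a = Sr \<and> b = St" by (auto simp: doubleton_eq_iff)
  then show ?thesis
  proof (elim disjE conjE)
    assume ab: "a = St" "b = Sr"
    show ?thesis unfolding ab by (rule fam_Suc(1))
  next
    assume ab: "a = Sr" "b = St"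
    show ?thesis unfolding ab by (rule fam_Suc(2))
  qed
qed

lemma fam_inj: "fam [] k \<beta> = fam [] m \<beta> \<Longrightarrow> \<beta> \<in> ends \<Longrightarrow> k = m"
proof -
  assume eq: "fam [] k \<beta> = fam [] m \<beta>" and b: "\<beta> \<in> ends"
  have "len (fam [] k \<beta>) = len (fam [] m \<beta>)" unfolding eq ..
  then show ?thesis using len_fam[OF ends_simps(1) b, of k] len_fam[OF ends_simps(1) b, of m] by linarith
qed

definition xlead :: "vec \<Rightarrow> int poly" where
  "xlead n = lead 2 (fst n)"

lemma xlead_simps: "xlead (n + m) = xlead n + xlead m" "xlead (vscale (of_int c) n) = smult c (xlead n)"
  "xlead 0 = 0" "xlead (sum f A) = (\<Sum>i\<in>A. xlead (f i))"
proof -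
  show a: "xlead (n + m) = xlead n + xlead m" for n m by (simp add: xlead_def lead_simps)
  show "xlead (vscale (of_int c) n) = smult c (xlead n)"
    by (cases n) (auto simp: xlead_def single_of_int[symmetric] lookup_single_mult intro!: poly_eqI)
  show z: "xlead 0 = 0" by (simp add: xlead_def lead_simps)
  show "xlead (sum f A) = (\<Sum>i\<in>A. xlead (f i))"
    by (induction A rule: infinite_finite_induct) (simp_all add: a z)
qed

lemma xlead_rep_kl: "vlead 2 (wact w) = (x, y, p, q) \<Longrightarrow> xlead (rep (kl_basis w)) = x"
  using vlead_rep_kl[of w] by (cases "rep (kl_basis w)") (simp add: xlead_def)

text \<open>The top part of the first coordinate of \<open>C_b C_A\<close> is \<open>X U_m\<close>
  by the module action, and \<open>U_(m+1)\<close> plus the sum of \<open>mu (E k) A\<close> times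
  \<open>U_k\<close> by the multiplication rule. Hence that sum is \<open>U_(m-1)\<close>.\<close>

lemma mu_fam_Nil:
  assumes ab: "{a, b} = {Sr, St}"
  shows "mu (fam [] k []) (fam [a, Ss] m []) = (if Suc k = m then 1 else 0)"
proof -
  define A where "A = fam [a, Ss] m []"
  define E where "E k = fam [] k []" for k
  have Ecore: "E k = core k 1" for k by (simp add: E_def fam_Nil)
  have aends: "[a, Ss] \<in> ends" and ne: "a \<noteq> b" "a \<noteq> Ss" "b \<noteq> Ss" using ab by (auto simp: doubleton_eq_iff)
  have dA: "desc s A \<longleftrightarrow> s = a" for s using desc_fam[OF aends ends_simps(1)] by (simp add: A_def)
  have rA: "rdesc Sr A" "rdesc St A" using rdesc_fam[OF aends ends_simps(1)] by (simp_all add: A_def)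
  have dE: "desc b (E k)" for k using desc_fam[of "[]" "[]"] ab by (auto simp: E_def doubleton_eq_iff)
  have ndb: "\<not> desc b A" using dA ne by simp
  have bA: "gen b * A = E (Suc m)" using fam_Suc'[OF ab] by (simp add: A_def E_def)
  have lA: "len A = 4 + 3 * m" using len_fam[OF aends ends_simps(1)] by (simp add: A_def)
  have lE: "len (E k) = 2 + 3 * k" for k using len_fam[of "[]" "[]" k] by (simp add: E_def)
  let ?Z = "{z. z \<le>\<^sub>B A \<and> z \<noteq> A \<and> desc b z}"
  define F where "F z = smult (mu z A) (xlead (rep (kl_basis z)))" for z
  have lhs: "xlead (rep (cop b (kl_basis A))) = [:0, 1:] * cheb m"
  proof -
    obtain \<psi> where \<psi>: "vintegral \<psi>" "rep (kl_basis A) = vscale (eta * eta) \<psi>" "vlead 0 \<psi> = vlead 2 (wact A)"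
      using rep_kl_integral[OF rA] by blast
    obtain x y p q where n: "\<psi> = (x, y, p, q)" by (cases \<psi>)
    have i: "integral x" "integral y" "integral p" "integral q" using \<psi>(1) by (simp_all add: n)
    have "a = St \<and> b = Sr \<or> a = Sr \<and> b = St" using ab by (auto simp: doubleton_eq_iff)
    \<comment> \<open>The first coordinate of \<open>cact b\<close> involves \<open>x\<close>,
      \<open>y\<close> and the coordinate of the left end \<open>as\<close>. Here \<open>x\<close>
      and \<open>y\<close> have zero leading part and are integral, so they vanish.\<close>
    then have "\<exists>f. integral f \<and> lead 0 f = cheb m \<and> fst (cact b \<psi>) = X * f"
    proof (elim disjE conjE)
      assume c: "a = St" "b = Sr"
      then have "lead 0 x = 0" "lead 0 y = 0" "lead 0 p = cheb m"
        using \<psi>(3) vlead_wact_fam(1)[of m] by (simp_all add: n A_def)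
      then show ?thesis using c i integral_0[OF i(1)] integral_0[OF i(2)] by (intro exI[of _ p]) (simp add: n)
    next
      assume c: "a = Sr" "b = St"
      then have "lead 0 x = 0" "lead 0 y = 0" "lead 0 q = cheb m"
        using \<psi>(3) vlead_wact_fam(2)[of m] by (simp_all add: n A_def)
      then show ?thesis using c i integral_0[OF i(1)] integral_0[OF i(2)] by (intro exI[of _ q]) (simp add: n)
    qed
    then obtain f where f: "integral f" "lead 0 f = cheb m" "fst (cact b \<psi>) = X * f" by blast
    have "fst (vscale c n) = smult c (fst n)" for c n by (cases n) simp
    then have "fst (rep (cop b (kl_basis A))) = smult (eta * eta) (X * f)"
      by (simp add: rep_cop \<psi>(2) cact_scale f(3) del: vscale.simps)
    then show ?thesis using lead_eta_eta[OF integral_X[OF f(1)]] f(2) by (simp add: xlead_def lead_simps)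
  qed
  have rhs: "xlead (rep (cop b (kl_basis A))) = cheb (Suc m) + (\<Sum>z\<in>?Z. F z)"
    unfolding cop_kl_up[OF ndb] bA F_def
    by (simp add: rep_simps xlead_simps Ecore xlead_rep_kl[OF vlead_wact_core] del: cheb.simps core.simps)
  have FE: "F (E k) = smult (mu (E k) A) (cheb k)" for k
    by (simp add: F_def Ecore xlead_rep_kl[OF vlead_wact_core])
  \<comment> \<open>If \<open>a\<close> is no left descent of \<open>z\<close>, then
    \<open>z\<close> has left end \<open>s\<close> and lacks the descent \<open>b\<close>. So
    \<open>z\<close> has \<open>r\<close> and \<open>t\<close> as descents on both sides, and it is
    a core or has no top part.\<close>
  have Fz: "F z = 0" if z: "z \<in> ?Z" "z \<notin> E ` {..m}" for z
  proof (rule ccontr)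
    assume "F z \<noteq> 0"
    then have mu: "mu z A \<noteq> 0" and x: "xlead (rep (kl_basis z)) \<noteq> 0" by (auto simp: F_def)
    have db: "desc b z" using z by simp
    have rz: "rdesc Sr z" "rdesc St z" using mu_rdesc_mono[OF mu db ndb] rA by auto
    have da: "desc a z"
    proof (rule ccontr)
      assume na: "\<not> desc a z"
      then have "gen a * z = A" using mu_desc[of a A z] dA mu by (auto split: if_splits)
      then have "z = fam [Ss] m []" by (simp add: A_def fam_Cons gen_mult_eq_iff)
      then show False using db desc_fam[of "[Ss]" "[]" b m] ne by simp
    qed
    then have d: "desc Sr z" "desc St z" using db ab by (auto simp: doubleton_eq_iff)
    show False
    proof (cases "z \<in> range (\<lambda>k. core k 1)")
      case True
      then obtain k where k: "z = E k" by (auto simp: Ecore)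
      then have "k \<le> m" using mu_nonzero_less[OF mu] lA lE[of k] by simp
      then show False using z(2) k by blast
    next
      case False
      then show False using xlead_rep_kl[OF vlead_wact_lowest[OF rz d]] x by blast
    qed
  qed
  have FE0: "F z = 0" if "z \<in> E ` {..m}" "z \<notin> ?Z" for z
    using that dE mu_nonzero_less[of z A] by (auto simp: F_def)
  have inj: "inj_on E {..m}" using fam_inj by (auto simp: inj_on_def E_def)
  have "(\<Sum>z\<in>?Z. F z) = (\<Sum>z\<in>?Z \<union> E ` {..m}. F z)"
    by (rule sum.mono_neutral_left) (auto intro: FE0)
  also have "\<dots> = (\<Sum>z\<in>E ` {..m}. F z)"
    by (rule sum.mono_neutral_right) (auto intro: Fz)
  also have "\<dots> = (\<Sum>k\<le>m. smult (mu (E k) A) (cheb k))"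
    by (simp add: sum.reindex[OF inj] FE)
  \<comment> \<open>For \<open>m = 0\<close> the right side is 0, as \<open>cheb_prev\<close>
    prescribes.\<close>
  finally have S: "(\<Sum>k\<le>m. smult (mu (E k) A) (cheb k)) = cheb_prev m"
    using lhs rhs by (simp add: cheb_Suc del: cheb.simps)
  have "cheb_prev m = (\<Sum>k\<le>m. smult (if Suc k = m then 1 else 0) (cheb k))"
  proof (cases m)
    case (Suc j)
    have "(\<Sum>k\<le>m. smult (if Suc k = m then 1 else 0) (cheb k)) = (\<Sum>k\<le>m. if k = j then cheb k else 0)"
      by (rule sum.cong) (auto simp: Suc)
    then show ?thesis using Suc by (simp add: cheb_prev_def)
  qed (simp add: cheb_prev_def)
  then have "(\<Sum>k\<le>m. smult (mu (E k) A - (if Suc k = m then 1 else 0)) (cheb k)) = 0"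
    using S by (simp add: smult_diff_left sum_subtractf)
  then have "mu (E k) A - (if Suc k = m then 1 else 0) = 0" if "k \<le> m" for k
    by (rule cheb_independent) (rule that)
  moreover have "mu (E k) A = 0" if "\<not> k \<le> m" for k
    using mu_nonzero_less[of "E k" A] lA lE[of k] that by fastforce
  ultimately show ?thesis unfolding A_def[symmetric] E_def[symmetric] by (cases "k \<le> m") (auto split: if_splits)
qed

lemma fam_snoc:
  "fam \<alpha> m [Ss] = fam \<alpha> m [] * gen Ss" "fam \<alpha> m [c, Ss] = fam \<alpha> m [Ss] * gen c"
  unfolding fam_def core_eq[of m "inverse _"] by (simp_all add: word_Cons mult.assoc)

lemma rdesc_extend: "rdesc s y \<Longrightarrow> \<not> desc a y \<Longrightarrow> rdesc s (gen a * y)"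
  using left_step_rdesc left_step_down by blast

lemma desc_up_right: "desc a y \<Longrightarrow> \<not> rdesc s y \<Longrightarrow> desc a (y * gen s)"
proof -
  assume d: "desc a y" and "\<not> rdesc s y"
  then have "len (y * gen s) = len y + len (gen s)"
    using len_gen_right_cases[of y s] len_not_desc[of s 1] by (simp add: rdesc_def)
  then show ?thesis by (rule desc_extend_right[OF d])
qed

text \<open>Since \<open>C_A C_s = C_(As)\<close>, the coefficient of \<open>E' k\<close> in
  \<open>C_b C_(As) = (C_b C_A) C_s\<close> can be traced back to that of \<open>E k\<close> in
  \<open>C_b C_A\<close>.\<close>

lemma mu_fam_Ss:
  assumes ab: "{a, b} = {Sr, St}"
  shows "mu (fam [] k [Ss]) (fam [a, Ss] m [Ss]) = (if Suc k = m then 1 else 0)"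
proof -
  define A where "A = fam [a, Ss] m []"
  define A' where "A' = fam [a, Ss] m [Ss]"
  define E where "E k = fam [] k []" for k
  define E' where "E' k = fam [] k [Ss]" for k
  have snoc: "A' = A * gen Ss" "\<And>k. E' k = E k * gen Ss"
    by (simp_all add: A_def A'_def E_def E'_def fam_snoc)
  have aends: "[a, Ss] \<in> ends" and ne: "a \<noteq> b" "b \<noteq> Ss" using ab by (auto simp: doubleton_eq_iff)
  have ndA: "\<not> desc b A" "\<not> desc b A'"
    using desc_fam[OF aends ends_simps(1)] desc_fam[OF aends ends_simps(2)] ne by (auto simp: A_def A'_def)
  have dE: "desc b (E k)" "desc b (E' k)" for k
    using desc_fam[of "[]" "[]" b k] desc_fam[of "[]" "[Ss]" b k] ne by (cases b; simp add: E_def E'_def)+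
  have bA: "gen b * A = E (Suc m)" "gen b * A' = E' (Suc m)"
    using fam_Suc'[OF ab] by (simp_all add: A_def E_def A'_def E'_def)
  have rA: "rdesc Sr A" "rdesc St A" "\<not> rdesc Ss A"
    using rdesc_fam[OF aends ends_simps(1)] by (simp_all add: A_def)
  have rE: "\<not> rdesc Sr (E' k)" "\<not> rdesc St (E' k)" "rdesc Ss (E' k)" for k
    using rdesc_fam[of "[]" "[Ss]"] by (simp_all add: E'_def)
  have eqE: "E k = E j \<longleftrightarrow> k = j" for k j using fam_inj[of k "[]" j] by (auto simp: E_def)
  have eqE': "E' k = E' j \<longleftrightarrow> k = j" for k j using fam_inj[of k "[Ss]" j] by (auto simp: E'_def)
  have ropA: "rop Ss (kl_basis A) = kl_basis A'"
  proof -
    \<comment> \<open>A correction term \<open>z\<close> would have the right descent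
      \<open>s\<close>. Lacking \<open>r\<close> or \<open>t\<close>, it would be \<open>A c\<close>
      for a letter \<open>c\<close> whose removal destroys that descent; having both, it would have
      all three descents.\<close>
    have mu0: "mu z A = 0" if z: "rdesc Ss z" for z
    proof (rule ccontr)
      assume mu: "mu z A \<noteq> 0"
      have "rdesc c z" if c: "c \<in> {Sr, St}" for c
      proof (rule ccontr)
        assume n: "\<not> rdesc c z"
        have "rdesc c A" using c rA by auto
        then have "z * gen c = A" using mu_rdesc[OF _ n] mu by (auto split: if_splits)
        then have z': "z = A * gen c" using mult_gen_eq_iff by blast
        obtain b c' where p: "pt (core m (inverse (word [a, Ss]))) = (3 - b - c', b, c')"
          "b < 0" "c' < 0" "\<bar>b - c'\<bar> \<le> 2" using pt_core[OF aends] by blast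
        have "inverse z = gen c * core m (inverse (word [a, Ss]))"
          unfolding z' A_def inverse_times_W inverse_fam by (simp add: fam_Nil)
        then have "\<not> rdesc Ss z" using c p by (auto simp: desc_iff_height)
        then show False using z by blast
      qed
      then show False using not_all_desc[of "inverse z"] z by blast
    qed
    have "kc (rop Ss (kl_basis A)) = kc (kl_basis A')"
      by (rule poly_mapping_eqI)
        (use mu0 rA(3) in \<open>auto simp: lookup_kc_rop_kl lookup_T_basis snoc(1)\<close>)
    then show ?thesis by (metis kl_comb_kc)
  qed
  let ?g = "kc (cop b (kl_basis A))"
  have keys: "rdesc Sr z \<and> rdesc St z" if "z \<in> Poly_Mapping.keys ?g" for z
  proof -
    have "z = gen b * A \<or> (desc b z \<and> mu z A \<noteq> 0)"
      using that ndA(1) by (auto simp: in_keys_iff lookup_kc_cop_kl split: if_splits)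
    then show ?thesis
      using rdesc_extend[OF _ ndA(1)] mu_rdesc_mono[OF _ _ ndA(1)] rA by blast
  qed
  \<comment> \<open>A nonzero \<open>mu (E' k) z\<close> would force \<open>z\<close> to be both
    \<open>E' k r\<close> and \<open>E' k t\<close>.\<close>
  have val: "Poly_Mapping.lookup (kc (rop Ss (kl_basis z))) (E' k) = (if z = E k then 1 else 0)"
    if z: "z \<in> Poly_Mapping.keys ?g" for z
  proof -
    have n: "\<not> rdesc Ss z" using keys[OF z] not_all_desc[of "inverse z"] by blast
    have "mu (E' k) z = 0"
    proof (rule ccontr)
      assume mu: "mu (E' k) z \<noteq> 0"
      have "E' k * gen Sr = z" "E' k * gen St = z"
        using mu_rdesc[of Sr z "E' k"] mu_rdesc[of St z "E' k"] keys[OF z] rE mu by (auto split: if_splits)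
      then have "E' k * gen Sr = E' k * gen St" by simp
      then show False by simp
    qed
    then show ?thesis using n rE(3) by (auto simp: lookup_kc_rop_kl snoc(2))
  qed
  have "Poly_Mapping.lookup (kc (rop Ss (cop b (kl_basis A)))) (E' k) = Poly_Mapping.lookup ?g (E k)"
  proof -
    have "Poly_Mapping.lookup (kc (rop Ss (cop b (kl_basis A)))) (E' k) =
      (\<Sum>z\<in>Poly_Mapping.keys ?g. Poly_Mapping.lookup ?g z * (if z = E k then 1 else 0))"
      unfolding lookup_kc_lin[OF lin_rop, of Ss "cop b (kl_basis A)"] by (rule sum.cong[OF refl]) (simp add: val)
    also have "\<dots> = (\<Sum>z\<in>Poly_Mapping.keys ?g. if z = E k then Poly_Mapping.lookup ?g (E k) else 0)"
      by (rule sum.cong) auto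
    also have "\<dots> = Poly_Mapping.lookup ?g (E k)" by (auto simp: in_keys_iff)
    finally show ?thesis .
  qed
  moreover have "rop Ss (cop b (kl_basis A)) = cop b (kl_basis A')" by (simp add: cop_rop[symmetric] ropA)
  ultimately have "Poly_Mapping.lookup (kc (cop b (kl_basis A'))) (E' k) = Poly_Mapping.lookup ?g (E k)" by simp
  then have "(of_int (mu (E' k) A') :: laurent) = of_int (mu (E k) A)"
    using ndA dE by (simp add: lookup_kc_cop_kl bA eqE eqE')
  then have "mu (E' k) A' = mu (E k) A" by simp
  then show ?thesis using mu_fam_Nil[OF ab, of k m] by (simp add: A_def A'_def E_def E'_def)
qed

text \<open>Here \<open>C_A' C_c\<close> has terms besides \<open>C_A''\<close>, but none of them
  produces \<open>E'' k\<close> under \<open>C_b\<close>. Computing the coefficient of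
  \<open>E'' k\<close> in \<open>C_b C_A' C_c\<close> in both orders therefore equates the two
  values of \<mu>.\<close>

lemma mu_fam_Cons:
  assumes ab: "{a, b} = {Sr, St}" and cd: "{c, d} = {Sr, St}"
  shows "mu (fam [] k [c, Ss]) (fam [a, Ss] m [c, Ss]) = (if Suc k = m then 1 else 0)"
proof -
  define A where "A = fam [a, Ss] m []"
  define A' where "A' = fam [a, Ss] m [Ss]"
  define A'' where "A'' = fam [a, Ss] m [c, Ss]"
  define E' where "E' k = fam [] k [Ss]" for k
  define E'' where "E'' k = fam [] k [c, Ss]" for k
  have snoc: "A' = A * gen Ss" "A'' = A' * gen c" "\<And>k. E'' k = E' k * gen c"
    by (simp_all add: A_def A'_def A''_def E'_def E''_def fam_snoc)
  have aends: "[a, Ss] \<in> ends" and cends: "[c, Ss] \<in> ends" and ne: "a \<noteq> b" "b \<noteq> Ss" "c \<noteq> d" "c \<noteq> Ss" "d \<noteq> Ss"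
    using ab cd by (auto simp: doubleton_eq_iff)
  have cd': "x = Ss \<or> x = c \<or> x = d" for x using cd by (cases x) (auto simp: doubleton_eq_iff)
  have ndA: "\<not> desc b A" "\<not> desc b A'" "\<not> desc b A''"
    using desc_fam[OF aends ends_simps(1)] desc_fam[OF aends ends_simps(2)] desc_fam[OF aends cends] ne
    by (auto simp: A_def A'_def A''_def)
  have dE: "desc b (E' k)" "desc b (E'' k)" for k
    using desc_fam[OF ends_simps(1) cends, of b k] desc_fam[of "[]" "[Ss]" b k] ne
    by (cases b; simp add: E'_def E''_def)+
  have bA: "gen b * A' = E' (Suc m)" "gen b * A'' = E'' (Suc m)"
    using fam_Suc'[OF ab] by (simp_all add: A'_def E'_def A''_def E''_def)
  have rA: "rdesc c A" "rdesc d A" "rdesc Ss A'" "\<not> rdesc c A'" "rdesc c A''"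
    using rdesc_fam[OF aends ends_simps(1)] rdesc_fam[OF aends ends_simps(2)] rdesc_fam[OF aends cends] cd ne
    by (auto simp: A_def A'_def A''_def doubleton_eq_iff)
  have rE: "rdesc s (E'' k) \<longleftrightarrow> s = c" for k s
    using rdesc_fam[OF ends_simps(1) cends] by (simp add: E''_def)
  have eqE': "E' k = E' j \<longleftrightarrow> k = j" for k j using fam_inj[of k "[Ss]" j] by (auto simp: E'_def)
  have eqE'': "E'' k = E'' j \<longleftrightarrow> k = j" for k j using fam_inj[of k "[c, Ss]" j] cends by (auto simp: E''_def)
  \<comment> \<open>The sole right descent of \<open>E'' k\<close> is \<open>c\<close>, so a
    different right descent of \<open>z\<close> determines \<open>z\<close>, and lengthening on the
    right keeps the left descent \<open>b\<close>.\<close>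
  have up: "z = E'' k * gen s \<and> desc b z" if "mu (E'' k) z \<noteq> 0" "rdesc s z" "s \<noteq> c" for z s
  proof -
    have n: "\<not> rdesc s (E'' k)" using rE that(3) by blast
    then have "E'' k * gen s = z" using mu_rdesc[OF that(2) n] that(1) by (auto split: if_splits)
    then show ?thesis using desc_up_right[OF dE(2) n] by blast
  qed
  have inv: "\<exists>b. pt (inverse (E'' k)) = reflect c (reflect Ss (3 - b - b, b, b)) \<and> b < 0"
  proof -
    have "inverse (E'' k) = gen c * (gen Ss * core k 1)"
      unfolding E''_def inverse_fam by (simp add: fam_Nil fam_Cons)
    then show ?thesis by (intro exI[of _ "- 1 - 3 * int k"]) (simp add: pt_core_one)
  qed
  have cext: "rdesc c (E'' k * gen s)" if s: "s \<noteq> c" for s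
  proof -
    obtain b where p: "pt (inverse (E'' k)) = reflect c (reflect Ss (3 - b - b, b, b))" "b < 0" using inv by blast
    have "inverse (E'' k * gen s) = gen s * inverse (E'' k)" by simp
    then show ?thesis using p s ne(4) by (cases c; cases s) (auto simp: desc_iff_height)
  qed
  let ?h = "kc (rop c (kl_basis A'))" and ?g = "kc (cop b (kl_basis A'))"
  \<comment> \<open>A term without right descent \<open>s\<close> differs from \<open>A'\<close> by
    that letter, because \<mu> is nonzero; this leaves only \<open>A\<close>, apart from
    \<open>A''\<close> itself.\<close>
  have keysh: "z = A'' \<or> z = A \<or> (rdesc Ss z \<and> rdesc c z)" if "z \<in> Poly_Mapping.keys ?h" for z
  proof -
    have *: "z = A' * gen c \<or> (rdesc c z \<and> mu z A' \<noteq> 0)"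
      using that rA(4) by (auto simp: in_keys_iff lookup_kc_rop_kl split: if_splits)
    show ?thesis
    proof (cases "rdesc Ss z \<or> z = A''")
      case True
      then show ?thesis using * snoc(2) by blast
    next
      case False
      then have "mu z A' \<noteq> 0" "\<not> rdesc Ss z" using * snoc(2) by auto
      then have "z * gen Ss = A * gen Ss" using mu_rdesc[OF rA(3)] snoc(1) by (auto split: if_splits)
      then show ?thesis by simp
    qed
  qed
  have hA: "Poly_Mapping.lookup ?h A'' = 1"
    using mu_nonzero_less[of A'' A'] rA(4) snoc(2) len_gen_right_cases[of A' c]
    by (auto simp: lookup_kc_rop_kl rdesc_def)
  have valh: "Poly_Mapping.lookup ?h z * Poly_Mapping.lookup (kc (cop b (kl_basis z))) (E'' k) =
    (if z = A'' then (if k = Suc m then 1 else 0) + of_int (mu (E'' k) A'') else 0)"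
    if z: "z \<in> Poly_Mapping.keys ?h" for z
  proof (cases "z = A''")
    case True
    then show ?thesis using hA ndA(3) dE by (simp add: lookup_kc_cop_kl bA eqE'')
  next
    case zA'': False
    have "Poly_Mapping.lookup (kc (cop b (kl_basis z))) (E'' k) = 0"
    proof (cases "z = A")
      case True
      have "E'' k \<noteq> gen b * A"
        using rdesc_extend[OF rA(2) ndA(1)] rE[of d k] ne by auto
      moreover have "mu (E'' k) A = 0" using up[of A d] rA(2) ne ndA(1) by blast
      ultimately show ?thesis using ndA(1) by (simp add: True lookup_kc_cop_kl)
    next
      case False
      then have rz: "rdesc Ss z" using keysh[OF z] zA'' by blast
      show ?thesis
      proof (cases "desc b z")
        case True
        moreover have "E'' k \<noteq> z" using rz rE[of Ss k] ne by auto
        ultimately show ?thesis by (simp add: lookup_kc_cop_kl)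
      next
        case False
        have "E'' k \<noteq> gen b * z" using rdesc_extend[OF rz False] rE[of Ss k] ne by auto
        moreover have "mu (E'' k) z = 0" using up[of z Ss] rz ne False by blast
        ultimately show ?thesis using False by (simp add: lookup_kc_cop_kl)
      qed
    qed
    then show ?thesis using zA'' by simp
  qed
  have "Poly_Mapping.lookup (kc (cop b (rop c (kl_basis A')))) (E'' k) =
    (\<Sum>z\<in>Poly_Mapping.keys ?h. if z = A'' then (if k = Suc m then 1 else 0) + of_int (mu (E'' k) A'') else 0)"
    unfolding lookup_kc_lin[OF lin_cop, of b "rop c (kl_basis A')"] by (rule sum.cong[OF refl valh])
  moreover have "A'' \<in> Poly_Mapping.keys ?h" by (simp add: in_keys_iff hA)
  ultimately have lhs: "Poly_Mapping.lookup (kc (cop b (rop c (kl_basis A')))) (E'' k) =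
    (if k = Suc m then 1 else 0) + of_int (mu (E'' k) A'')" by simp
  have muA': "mu (E'' k) A' = 0" using up[of A' Ss] rA(3) ne ndA(2) by blast
  \<comment> \<open>If \<open>c\<close> is a right descent of \<open>z\<close>, only
    \<open>z = E'' k\<close> could contribute, and it does not occur in \<open>C_b C_A'\<close>. If
    not, nonzero \<mu> would force \<open>z = E'' k s'\<close> for some
    \<open>s' \<noteq> c\<close>, which has \<open>c\<close> as a right descent by
    \<open>cext\<close>.\<close>
  have valg: "Poly_Mapping.lookup ?g z * Poly_Mapping.lookup (kc (rop c (kl_basis z))) (E'' k) =
    (if z = E' k then Poly_Mapping.lookup ?g (E' k) else 0)"
    if z: "z \<in> Poly_Mapping.keys ?g" for z
  proof (cases "rdesc c z")
    case True
    have "z \<noteq> E'' k"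
    proof
      assume e: "z = E'' k"
      have "E'' k \<noteq> gen b * A'" using rdesc_extend[OF rA(3) ndA(2)] rE[of Ss k] ne by auto
      then show False using z ndA(2) by (simp add: e in_keys_iff lookup_kc_cop_kl muA' split: if_splits)
    qed
    moreover have "z \<noteq> E' k"
      using True rdesc_fam[OF ends_simps(1) ends_simps(2), of c k] ne by (auto simp: E'_def)
    ultimately show ?thesis using True by (simp add: lookup_kc_rop_kl)
  next
    case False
    have "mu (E'' k) z = 0"
    proof (rule ccontr)
      assume mu: "mu (E'' k) z \<noteq> 0"
      then have "z \<noteq> 1" using mu_nonzero_less[OF mu] by auto
      then have "inverse z \<noteq> 1" by (metis inverse_inverse_W inverse_one_W)
      then obtain s where s: "rdesc s z" using desc_exists by blast
      then have "s \<noteq> c" using False by auto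
      then show False using up[OF mu s] cext[of s] False by auto
    qed
    then show ?thesis using False rE[of c k] by (auto simp: lookup_kc_rop_kl snoc(3))
  qed
  have "Poly_Mapping.lookup (kc (rop c (cop b (kl_basis A')))) (E'' k) =
    (\<Sum>z\<in>Poly_Mapping.keys ?g. if z = E' k then Poly_Mapping.lookup ?g (E' k) else 0)"
    unfolding lookup_kc_lin[OF lin_rop, of c "cop b (kl_basis A')"] by (rule sum.cong[OF refl valg])
  also have "\<dots> = Poly_Mapping.lookup ?g (E' k)" by (auto simp: in_keys_iff)
  also have "\<dots> = (if k = Suc m then 1 else 0) + of_int (mu (E' k) A')"
    using ndA(2) dE by (simp add: lookup_kc_cop_kl bA eqE')
  finally have "(of_int (mu (E'' k) A'') :: laurent) = of_int (mu (E' k) A')"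
    using lhs by (simp add: cop_rop)
  then have "mu (E'' k) A'' = mu (E' k) A'" by simp
  then show ?thesis using mu_fam_Ss[OF ab, of k m] by (simp add: A'_def A''_def E'_def E''_def)
qed

lemma mu_fam:
  assumes "\<beta> \<in> ends" "a \<in> {Sr, St}"
  shows "mu (fam [] k \<beta>) (fam [a, Ss] m \<beta>) = (if Suc k = m then 1 else 0)"
proof -
  obtain b where ab: "{a, b} = {Sr, St}" using assms(2) by auto
  have "\<beta> = [] \<or> \<beta> = [Ss] \<or> (\<exists>c d. {c, d} = {Sr, St} \<and> \<beta> = [c, Ss])"
    using assms(1) by (rule ends_cases) blast+
  then show ?thesis using mu_fam_Nil[OF ab] mu_fam_Ss[OF ab] mu_fam_Cons[OF ab] by blast
qed

section \<open>Assembly of the two cases\<close>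

lemma right_cell_refl: "w \<sim>\<^sub>R w"
  by (simp add: right_cell_eq_def right_le_def)

theorem theorem5p8:
  fixes u w :: W
  assumes "u \<in> c2" and "w \<in> c2"
    and "u \<le>\<^sub>B w" and "u \<sim>\<^sub>L w" and "\<not> u \<sim>\<^sub>R w"
  shows "(\<not> left_descents w \<subseteq> left_descents u \<longrightarrow>
           mu u w = (if int (len w) - int (len u) = 1 then 1 else 0)) \<and>
         (left_descents w \<subseteq> left_descents u \<longrightarrow>
           mu u w = (if int (len w) - int (len u) = 5 then 1 else 0))"
proof (intro conjI impI)
  assume "\<not> left_descents w \<subseteq> left_descents u"
  then obtain s where s: "desc s w" "\<not> desc s u" by (auto simp: left_descents_desc)
  \<comment> \<open>The lifting property puts \<open>gen s * u\<close> below \<open>w\<close>, so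
    equality is decided by comparing lengths.\<close>
  have "gen s * u \<le>\<^sub>B w" by (rule bruhat_lift[OF assms(3) s(1)])
  then have "gen s * u = w \<longleftrightarrow> len w = Suc (len u)"
    using bruhat_le_len[of "gen s * u" w] len_not_desc[OF s(2)] by auto
  then show "mu u w = (if int (len w) - int (len u) = 1 then 1 else 0)"
    using mu_desc[OF s] by auto
next
  assume sub: "left_descents w \<subseteq> left_descents u"
  have low: "u \<notin> lowest" "w \<notin> lowest" using assms(1,2) a_fun_lowest by (auto simp: c2_def)
  have ne: "w \<noteq> u" using assms(5) right_cell_refl by auto
  \<comment> \<open>A left cell cannot mix the two kinds of elements, and by nested descents two
    elements with unique reduced expressions would lie in one right cell.\<close>
  have not_single: "\<not> single u" "\<not> single w"
  proof -
    have "single u \<longleftrightarrow> single w" using assms(4) left_le_single unfolding left_cell_eq_def by blast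
    moreover have False if su: "single u" and sw: "single w"
    proof -
      have "w \<noteq> 1" using bruhat_le_len[OF assms(3)] ne by auto
      then obtain s where "desc s w" using desc_exists by blast
      moreover from this have "desc s u" using sub by (auto simp: left_descents_desc)
      ultimately show False using single_right_cell[OF su sw] assms(5) by blast
    qed
    ultimately show "\<not> single u" "\<not> single w" by blast+
  qed
  then have "u \<in> rt_type" "w \<in> rt_type" using not_single_cases low by blast+
  then obtain \<alpha> \<beta> m \<alpha>' \<beta>' m' where u: "u = fam \<alpha> m \<beta>" "\<alpha> \<in> ends" "\<beta> \<in> ends"
    and w: "w = fam \<alpha>' m' \<beta>'" "\<alpha>' \<in> ends" "\<beta>' \<in> ends"
    using fam_exists low by metis
  let ?D = "\<lambda>\<gamma>. case \<gamma> of [] \<Rightarrow> {Sr, St} | a # _ \<Rightarrow> {a}"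
  \<comment> \<open>Right descents are constant on left cells, and those of a family element
    determine its right end.\<close>
  have "s \<in> ?D \<beta> \<longleftrightarrow> s \<in> ?D \<beta>'" for s
    using left_cell_rdesc[OF assms(4), of s] rdesc_fam[OF u(2,3)] rdesc_fam[OF w(2,3)] u(1) w(1) by simp
  then have "?D \<beta> = ?D \<beta>'" by blast
  then have \<beta>: "\<beta>' = \<beta>"
    by - (rule ends_cases[OF u(3)]; rule ends_cases[OF w(3)]; simp add: doubleton_eq_iff)
  have mu: "mu (fam [] k \<gamma>) (fam [St, Ss] (Suc k) \<gamma>) \<noteq> 0" if "\<gamma> \<in> ends" for k \<gamma>
    using mu_fam[OF that, of St k "Suc k"] by simp
  have "\<alpha> \<noteq> \<alpha>'" using fam_right_cell[OF u(2,3) w(3) mu[OF u(2)], of m m'] assms(5) u(1) w(1) by auto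
  moreover have "?D \<alpha>' \<subseteq> ?D \<alpha>"
    using sub desc_fam[OF u(2,3), of _ m] desc_fam[OF w(2,3), of _ m'] u(1) w(1)
    by (auto simp: left_descents_desc)
  ultimately have "\<alpha> = [] \<and> (\<alpha>' = [Sr, Ss] \<or> \<alpha>' = [St, Ss])"
    by - (rule ends_cases[OF u(2)]; rule ends_cases[OF w(2)]; simp)
  then obtain a where a: "a \<in> {Sr, St}" "\<alpha> = []" "\<alpha>' = [a, Ss]" by blast
  \<comment> \<open>The left ends have lengths 2 and 0, so the difference is
    \<open>2 + 3 (m' - m)\<close>.\<close>
  have "int (len w) - int (len u) = 5 \<longleftrightarrow> Suc m = m'"
    using len_fam[OF u(2,3), of m] len_fam[OF w(2,3), of m'] u(1) w(1) a \<beta> by auto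
  then show "mu u w = (if int (len w) - int (len u) = 5 then 1 else 0)"
    using mu_fam[OF u(3) a(1), of m m'] u(1) w(1) a \<beta> by simp
qed

end
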